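(* Let $\Gamma<\mathrm{SL}_2(\mathbb R)$ be a finitely generated discrete subgroup with critical exponent $\delta>1/2$ such that $\Gamma\backslash\mathbb H$ has infinite volume and the horocycle $(N\cap\Gamma)\backslash N$ is closed in $\Gamma\backslash\mathrm{SL}_2(\mathbb R)$ and infinite (i.e. $N\cap\Gamma$ is trivial). Let $\phi\in L^2(\Gamma\backslash\mathbb H)$ be an eigenfunction of $\Delta$ with eigenvalue $\lambda=s(1-s)<1/4$, $s>1/2$. Then there exist $x_0>0$ and $y_0<1$ such that for $|x|>x_0$ and $0<y<y_0$, $$\phi(x+iy)\ll_\phi\Big(\frac{y}{x^2+y^2}\Big)^{s}.$$
   Context: $N=\{n_x=\begin{pmatrix}1&x\\0&1\end{pmatrix}\}$; $\mathrm{SL}_2(\mathbb R)$ acts on $\mathbb H$ by Möbius transformations and functions on $\Gamma\backslash\mathbb H$ are viewed as $\Gamma$-invariant functions on $\mathbb H$. $\Delta=-y^2(\partial_{xx}+\partial_{yy})$, $L^2$ taken with respect to $dx\,dy/y^2$. Critical exponent: abscissa of convergence of $\sum_{\gamma\in\Gamma}\|\gamma\|^{-s}$. *)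

theory Defs
  imports "HOL-Analysis.Analysis"
begin

text \<open>2x2 real matrices (a,b,c,d) = [[a,b],[c,d]], as elements of the Euclidean
  space real^4 (product type); the norm is the Frobenius norm.\<close>

type_synonym mat2 = "real \<times> real \<times> real \<times> real"

fun mmul :: "mat2 \<Rightarrow> mat2 \<Rightarrow> mat2" where
  "mmul (a,b,c,d) (e,f,g,h) = (a*e + b*g, a*f + b*h, c*e + d*g, c*f + d*h)"

definition mid :: mat2 where "mid = (1,0,0,1)"

fun minv :: "mat2 \<Rightarrow> mat2" where
  "minv (a,b,c,d) = (d, -b, -c, a)"

fun mdet :: "mat2 \<Rightarrow> real" where
  "mdet (a,b,c,d) = a*d - b*c"

definition SL2 :: "mat2 set" where
  "SL2 = {g. mdet g = 1}"

definition nx :: "real \<Rightarrow> mat2" where "nx x = (1, x, 0, 1)"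

definition Nsub :: "mat2 set" where "Nsub = range nx"

definition is_subgroup_SL2 :: "mat2 set \<Rightarrow> bool" where
  "is_subgroup_SL2 G \<longleftrightarrow> G \<subseteq> SL2 \<and> mid \<in> G \<and>
     (\<forall>g\<in>G. \<forall>h\<in>G. mmul g h \<in> G) \<and> (\<forall>g\<in>G. minv g \<in> G)"

inductive_set gen_group :: "mat2 set \<Rightarrow> mat2 set" for S where
  gen_id: "mid \<in> gen_group S"
| gen_gen: "s \<in> S \<Longrightarrow> s \<in> gen_group S"
| gen_mul: "g \<in> gen_group S \<Longrightarrow> h \<in> gen_group S \<Longrightarrow> mmul g h \<in> gen_group S"
| gen_inv: "g \<in> gen_group S \<Longrightarrow> minv g \<in> gen_group S"

definition finitely_generated :: "mat2 set \<Rightarrow> bool" where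
  "finitely_generated G \<longleftrightarrow> (\<exists>S. finite S \<and> S \<subseteq> G \<and> G = gen_group S)"

definition discrete_set :: "mat2 set \<Rightarrow> bool" where
  "discrete_set G \<longleftrightarrow> (\<forall>g\<in>G. \<exists>e>0. \<forall>h\<in>G. dist h g < e \<longrightarrow> h = g)"

definition critical_exponent :: "mat2 set \<Rightarrow> real" where
  "critical_exponent G = Inf {s::real. (\<lambda>g. norm g powr (-s)) summable_on G}"

definition Hplane :: "complex set" where "Hplane = {z. Im z > 0}"

fun mob :: "mat2 \<Rightarrow> complex \<Rightarrow> complex" where
  "mob (a,b,c,d) z = (of_real a * z + of_real b) / (of_real c * z + of_real d)"

definition hyp_measure :: "complex measure" where
  "hyp_measure = density lborel (\<lambda>z. indicator Hplane z * ennreal (1 / (Im z)^2))"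

definition fund_domain :: "mat2 set \<Rightarrow> complex set \<Rightarrow> bool" where
  "fund_domain G F \<longleftrightarrow> F \<in> sets lborel \<and> F \<subseteq> Hplane \<and>
     (\<forall>z\<in>Hplane. \<exists>g\<in>G. mob g z \<in> F) \<and>
     (\<forall>g\<in>G. g \<noteq> mid \<and> g \<noteq> (-1,0,0,-1) \<longrightarrow>
         emeasure hyp_measure (F \<inter> mob g ` F) = 0)"

definition infinite_covolume :: "mat2 set \<Rightarrow> bool" where
  "infinite_covolume G \<longleftrightarrow> (\<exists>F. fund_domain G F \<and> emeasure hyp_measure F = \<infinity>)"

definition invariant :: "mat2 set \<Rightarrow> (complex \<Rightarrow> complex) \<Rightarrow> bool" where
  "invariant G \<phi> \<longleftrightarrow> (\<forall>g\<in>G. \<forall>z\<in>Hplane. \<phi> (mob g z) = \<phi> z)"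

definition L2_quot :: "mat2 set \<Rightarrow> (complex \<Rightarrow> complex) \<Rightarrow> bool" where
  "L2_quot G \<phi> \<longleftrightarrow> \<phi> \<in> borel_measurable lborel \<and>
     (\<exists>F. fund_domain G F \<and>
        (\<integral>\<^sup>+ z. ennreal ((cmod (\<phi> z))^2) * indicator F z \<partial>hyp_measure) < \<infinity>)"

definition laplace_eigenfunction :: "(complex \<Rightarrow> complex) \<Rightarrow> real \<Rightarrow> bool" where
  "laplace_eigenfunction \<phi> lam \<longleftrightarrow>
     (\<exists>\<phi>x \<phi>y \<phi>xx \<phi>yy.
        continuous_on Hplane \<phi> \<and> continuous_on Hplane \<phi>x \<and> continuous_on Hplane \<phi>y \<and>
        continuous_on Hplane \<phi>xx \<and> continuous_on Hplane \<phi>yy \<and>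
        (\<forall>z\<in>Hplane.
           ((\<lambda>t. \<phi> (Complex t (Im z))) has_vector_derivative \<phi>x z) (at (Re z)) \<and>
           ((\<lambda>t. \<phi> (Complex (Re z) t)) has_vector_derivative \<phi>y z) (at (Im z)) \<and>
           ((\<lambda>t. \<phi>x (Complex t (Im z))) has_vector_derivative \<phi>xx z) (at (Re z)) \<and>
           ((\<lambda>t. \<phi>y (Complex (Re z) t)) has_vector_derivative \<phi>yy z) (at (Im z)) \<and>
           - (of_real ((Im z)^2)) * (\<phi>xx z + \<phi>yy z) = of_real lam * \<phi> z))"

end

theory Submission
  imports Defs
begin

text \<open>
  The closed horocycle with trivial stabiliser makes the bottom rows \<open>(c, d)\<close> of the group locally finite away
  from 0, by Baire's theorem. If they accumulated at 0, the group would contain a hyperbolic element fixing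
  infinity and be elementary, so its critical exponent would be at most \<open>1/2\<close>. Hence the orbit of \<open>\<i>\<close> has bounded
  height. As the group is finitely generated, a neighbourhood \<open>X\<close> of the orbit is connected, and its quotient is
  compact. If the orbit were unbounded, then by compactness some \<open>g\<close> with \<open>g\<infinity> \<noteq> \<infinity>\<close> would preserve the component of the
  complement of \<open>X\<close> above the orbit; a curve in it from infinity to \<open>g\<infinity>\<close> would separate the far points of \<open>X\<close>
  from their images under \<open>g\<close>. So the orbit is bounded, infinity is an ordinary point, and \<open>\<phi>\<close> is square integrable
  on \<open>|z| > R\<close> for some \<open>R\<close>.

  There \<open>|\<phi>|\<^sup>2\<close> is compared with a solution. If \<open>h = V\<^sup>s\<close> with \<open>V = Im (-1/z)\<close>, then \<open>\<phi>\<^sup>2 / h\<^sup>2\<close> is a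
  subsolution of the weighted Laplacian \<open>div (h\<^sup>2 \<nabla>)\<close>, hence has a nonnegative integral against the image of every
  nonnegative test function under this operator. The test function is a truncation of a supersolution with pole at
  \<open>z\<^sub>0\<close>, built from \<open>V\<close> and \<open>cosh d(z, z\<^sub>0)\<close> and normalised at infinity. The square integrability of \<open>\<phi>\<close> against
  the hyperbolic area is exactly what is needed to discard the contribution of the real axis.\<close>

text \<open>The analytic half is best read in the coordinate \<open>w = -1/z\<close>: infinity
  becomes the boundary point 0, V is the height of w, and the claim says that \<phi> is O(V^s).
  Sub-mean-value estimates on hyperbolic balls would bound \<phi> near infinity without giving a
  rate. The rate comes from a global test function. With \<open>w0 = -1/z0\<close> and
  \<open>v0 = Im w0\<close>, its main part is \<tau> T^(-s) for
  \<open>T = (Re w - Re w0)^2 + (Im w)^2 + v0^2\<close>. At the pole this has order v0^(-2s), while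
  the error made by truncating it is at most a constant times the hyperbolic density, uniformly in
  z0. So v0^(-2s) \<phi>(z0)^2 is bounded by a multiple of the norm of \<phi> near infinity.
  Subtracting 1 keeps the error inside |z| > R, but the set where the barrier is positive would
  still reach the real axis, where \<phi> is not controlled pointwise. The function V^(1-s) is a
  second solution besides V^s, and their quotient V^(1-2s) blows up at that axis; subtracting
  \<epsilon> times it makes the support compact. Square integrability then enters as dominated
  convergence for \<epsilon> tending to 0 with z0 fixed.\<close>

section \<open>A weighted Green inequality\<close>

text \<open>A convex-near-0 truncation with \<open>cutoff'' \<le> 0\<close> for large arguments, so that composing it with a barrier
  spoils the differential inequality only where the barrier is bounded.\<close>

definition cutoff :: "real \<Rightarrow> real" where "cutoff x = (max 0 x)^3 / (1 + x^2)"
definition cutoff' :: "real \<Rightarrow> real" where "cutoff' x = (if x \<le> 0 then 0 else (x^4 + 3*x^2) / (1 + x^2)^2)"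
definition cutoff'' :: "real \<Rightarrow> real" where "cutoff'' x = (if x \<le> 0 then 0 else (6*x - 2*x^3) / (1 + x^2)^3)"

lemma one_plus_sq_nonzero: "1 + x\<^sup>2 \<noteq> (0::real)"
  by (metis add_pos_nonneg less_irrefl zero_le_power2 zero_less_one)

text \<open>Value and slope of both pieces agree at the junction. It is applied twice, to the
  formula for \<open>cutoff\<close> and to that for \<open>cutoff'\<close>.\<close>

lemma DERIV_max0:
  fixes F F' :: "real \<Rightarrow> real"
  assumes "\<And>x. (F has_real_derivative F' x) (at x)" "F 0 = 0" "F' 0 = 0"
  shows "((\<lambda>x. if x \<le> 0 then 0 else F x) has_real_derivative (if x \<le> 0 then 0 else F' x)) (at x)"
proof -
  have cl: "closure {0::real<..} = {0..}" "{..0} \<union> {0<..} = (UNIV :: real set)" by auto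
  have "((\<lambda>x. if x \<in> {..0} then 0 else F x) has_derivative (if x \<in> {..0} then (\<lambda>h. 0) else (\<lambda>h. F' x * h)))
      (at x within {..0} \<union> {0<..})"
  proof (rule has_derivative_If_within_closures)
    show "((\<lambda>x. 0) has_derivative (\<lambda>h. 0)) (at x within {..0} \<union> closure {..0} \<inter> closure {0<..})" by simp
    show "(F has_derivative (\<lambda>h. F' x * h)) (at x within {0<..} \<union> closure {..0} \<inter> closure {0<..})"
      using assms(1)[of x] unfolding has_field_derivative_def
      by (rule has_derivative_at_withinI)
    show "0 = F x" "(\<lambda>h. 0) = (*) (F' x)" if "x \<in> closure {..0}" "x \<in> closure {0<..}"
      using that assms(2,3) by (auto simp: cl)
  qed (auto simp: cl)
  moreover have "(*) (0::real) = (\<lambda>h. 0)" by (simp add: fun_eq_iff)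
  ultimately show ?thesis unfolding has_field_derivative_def cl by (auto split: if_splits)
qed

lemma DERIV_cutoff: "(cutoff has_real_derivative cutoff' x) (at x)"
proof -
  have "((\<lambda>x. if x \<le> 0 then 0 else x^3 / (1 + x^2)) has_real_derivative
     (if x \<le> 0 then 0 else (x^4 + 3*x^2) / (1 + x^2)^2)) (at x)"
  proof (rule DERIV_max0)
    show "((\<lambda>x. x^3 / (1 + x^2)) has_real_derivative (x^4 + 3*x^2) / (1 + x^2)^2) (at x)" for x :: real
    proof -
      have *: "(3*x^2 * (1 + x^2) - x^3 * (2*x)) / ((1 + x^2) * (1 + x^2)) = (x^4 + 3*x^2) / (1 + x^2)^2"
        by (simp add: eval_nat_numeral algebra_simps)
      have "((\<lambda>x. x^3 / (1 + x^2)) has_real_derivative (3*x^2 * (1 + x^2) - x^3 * (2*x)) / ((1 + x^2) * (1 + x^2))) (at x)"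
        by (rule DERIV_divide) (auto intro!: derivative_eq_intros simp: one_plus_sq_nonzero)
      then show ?thesis unfolding * .
    qed
  qed auto
  also have "(\<lambda>x::real. if x \<le> 0 then 0 else x^3 / (1 + x^2)) = cutoff"
    by (auto simp: cutoff_def fun_eq_iff)
  finally show ?thesis by (simp add: cutoff'_def)
qed

lemma DERIV_cutoff': "(cutoff' has_real_derivative cutoff'' x) (at x)"
proof -
  have "((\<lambda>x. (x^4 + 3*x^2) / (1 + x^2)^2) has_real_derivative (6*x - 2*x^3) / (1 + x^2)^3) (at x)" for x :: real
  proof -
    have *: "(((4*x^3 + 6*x) * (1+x^2)^2 - (x^4 + 3*x^2) * (2 * (1+x^2) * (2*x))) / ((1+x^2)^2 * (1+x^2)^2)) = (6*x - 2*x^3) / (1 + x^2)^3"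
    proof -
      have "(4*x^3 + 6*x) * (1+x^2)^2 - (x^4 + 3*x^2) * (2 * (1+x^2) * (2*x)) = (6*x - 2*x^3) * (1+x^2)"
        by (simp add: eval_nat_numeral algebra_simps)
      moreover have "(1+x^2)^2 * (1+x^2)^2 = (1+x^2)^3 * (1+x^2)"
        by (simp add: eval_nat_numeral algebra_simps)
      ultimately show ?thesis using one_plus_sq_nonzero[of x] by simp
    qed
    have "((\<lambda>x. (x^4 + 3*x^2) / (1 + x^2)^2) has_real_derivative
       (((4*x^3 + 6*x) * (1+x^2)^2 - (x^4 + 3*x^2) * (2 * (1+x^2) * (2*x))) / ((1+x^2)^2 * (1+x^2)^2))) (at x)"
    proof (rule DERIV_divide)
      show "((\<lambda>x. x^4 + 3*x^2) has_real_derivative 4*x^3 + 6*x) (at x)"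
        by (auto intro!: derivative_eq_intros)
      show "((\<lambda>x. (1 + x^2)^2) has_real_derivative 2 * (1+x^2) * (2*x)) (at x)"
        by (auto intro!: derivative_eq_intros)
      show "(1 + x^2)^2 \<noteq> 0" by (simp add: one_plus_sq_nonzero)
    qed
    then show ?thesis unfolding * .
  qed
  from DERIV_max0[OF this] show ?thesis
    by (simp add: cutoff'_def[abs_def] cutoff''_def)
qed

lemma isCont_cutoff'': "isCont cutoff'' x"
proof -
  have c: "continuous_on S (\<lambda>x::real. (6*x - 2*x^3) / (1 + x^2)^3)" for S
    by (intro continuous_intros) (simp add: one_plus_sq_nonzero)
  have "continuous_on ({..0} \<union> {0..}) (\<lambda>x::real. if x \<le> 0 then 0 else (6*x - 2*x^3) / (1 + x^2)^3)"
    by (rule continuous_on_If[OF _ _ _ c]) auto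
  moreover have "{..0} \<union> {0..} = (UNIV :: real set)" by auto
  ultimately have "continuous_on UNIV cutoff''"
    by (simp add: cutoff''_def[abs_def])
  then show ?thesis by (simp add: continuous_on_eq_continuous_at)
qed

lemma cutoff_nonneg: "cutoff x \<ge> 0"
  by (simp add: cutoff_def add_nonneg_nonneg)

lemma cutoff'_nonneg: "cutoff' x \<ge> 0"
  by (simp add: cutoff'_def)

text \<open>Near the pole the barrier is at least 2, so truncation does not weaken the source
  there.\<close>

lemma cutoff'_ge_1: assumes "x \<ge> 1" shows "cutoff' x \<ge> 1"
proof -
  have "x^2 \<ge> 1" using assms by simp
  then have "(1 + x^2)^2 \<le> x^4 + 3*x^2" by (simp add: power2_eq_square eval_nat_numeral algebra_simps)
  then show ?thesis using assms one_plus_sq_nonzero[of x] by (simp add: cutoff'_def)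
qed

lemma cutoff_neg: "x \<le> 0 \<Longrightarrow> cutoff x = 0" "x \<le> 0 \<Longrightarrow> cutoff' x = 0" "x \<le> 0 \<Longrightarrow> cutoff'' x = 0"
  by (simp_all add: cutoff_def cutoff'_def cutoff''_def)

lemma cutoff''_nonpos: assumes "x \<ge> 2" shows "cutoff'' x \<le> 0"
proof -
  have "x * 2^2 \<le> x * x^2" using assms by (intro mult_left_mono power_mono) auto
  then have "6*x - 2*x^3 \<le> 0" using assms by (simp add: power3_eq_cube power2_eq_square)
  then show ?thesis using assms by (simp add: cutoff''_def divide_nonpos_nonneg)
qed

lemma cutoff''_le: "cutoff'' x \<le> 6"
proof (cases "x \<le> 0")
  case False
  have 1: "1 + x^2 \<le> (1+x^2)^3" using self_le_power[of "1+x^2" 3] by simp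
  have "x \<le> 1 + x^2" using False by (smt (verit) mult_left_mono power2_eq_square zero_le_power2 mult_cancel_left2)
  then have "6*x - 2*x^3 \<le> 6 * (1+x^2)^3" using False 1 by (smt (verit) zero_less_power)
  moreover have "(1+x^2)^3 > 0" by (simp add: add_pos_nonneg)
  ultimately show ?thesis using False unfolding cutoff''_def by (simp add: pos_divide_le_eq del: zero_less_power)
qed (simp add: cutoff''_def)

text \<open>Only pure second derivatives are recorded: the Laplacian and a divergence integrated one
  coordinate at a time involve no mixed ones. The derivatives are two-sided even at boundary points
  of \<open>S\<close>.\<close>

definition C2_on :: "(real \<times> real) set \<Rightarrow> (real \<Rightarrow> real \<Rightarrow> real) \<Rightarrow> (real \<Rightarrow> real \<Rightarrow> real) \<Rightarrow> (real \<Rightarrow> real \<Rightarrow> real) \<Rightarrow>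
   (real \<Rightarrow> real \<Rightarrow> real) \<Rightarrow> (real \<Rightarrow> real \<Rightarrow> real) \<Rightarrow> bool" where
  "C2_on S f fx fy fxx fyy \<longleftrightarrow>
     continuous_on S (case_prod f) \<and> continuous_on S (case_prod fx) \<and> continuous_on S (case_prod fy) \<and>
     continuous_on S (case_prod fxx) \<and> continuous_on S (case_prod fyy) \<and>
     (\<forall>(x,y)\<in>S. ((\<lambda>t. f t y) has_real_derivative fx x y) (at x) \<and> ((\<lambda>t. f x t) has_real_derivative fy x y) (at y)
        \<and> ((\<lambda>t. fx t y) has_real_derivative fxx x y) (at x) \<and> ((\<lambda>t. fy x t) has_real_derivative fyy x y) (at y))"

lemma C2_onD:
  assumes "C2_on S f fx fy fxx fyy" "(x,y) \<in> S"
  shows "((\<lambda>t. f t y) has_real_derivative fx x y) (at x)" "((\<lambda>t. f x t) has_real_derivative fy x y) (at y)"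
    "((\<lambda>t. fx t y) has_real_derivative fxx x y) (at x)" "((\<lambda>t. fy x t) has_real_derivative fyy x y) (at y)"
  using assms unfolding C2_on_def by blast+

text \<open>The vector field \<open>(X, Y)\<close> is \<open>\<Phi> \<nabla>\<psi>\<^sup>2 - \<psi>\<^sup>2 \<nabla>\<Phi> - 2 s \<Phi> \<psi>\<^sup>2 \<nabla>L\<close> with \<open>\<Phi> = cutoff f\<close>;
  its flux through the boundary vanishes, and its divergence is the sum of
  \<open>2 \<Phi> |\<nabla>\<psi> - s \<psi> \<nabla>L|\<^sup>2\<close> and the negative of the integrand.\<close>

lemma cutoff_integral_nonneg:
  fixes x1 x2 y1 y2 s :: real
  defines "R \<equiv> cbox (x1, y1) (x2, y2)"
  assumes le: "x1 \<le> x2" "y1 \<le> y2"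
    and \<psi>: "C2_on R \<psi> \<psi>x \<psi>y \<psi>xx \<psi>yy" and f: "C2_on R f fx fy fxx fyy" and L: "C2_on R L Lx Ly Lxx Lyy"
    and eig: "\<And>x y. (x,y) \<in> R \<Longrightarrow> \<psi>xx x y + \<psi>yy x y = c x y * \<psi> x y"
    and hL: "\<And>x y. (x,y) \<in> R \<Longrightarrow> s * (Lxx x y + Lyy x y) + s\<^sup>2 * ((Lx x y)\<^sup>2 + (Ly x y)\<^sup>2) = c x y"
    and bd: "\<And>x y. (x,y) \<in> R \<Longrightarrow> x = x1 \<or> x = x2 \<or> y = y1 \<or> y = y2 \<Longrightarrow> f x y \<le> 0"
  shows "(\<lambda>(x,y). (\<psi> x y)\<^sup>2 * (cutoff' (f x y) * (fxx x y + fyy x y + 2 * s * (Lx x y * fx x y + Ly x y * fy x y))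
             + cutoff'' (f x y) * ((fx x y)\<^sup>2 + (fy x y)\<^sup>2))) integrable_on R" (is "?I integrable_on R")
    and "integral R (\<lambda>(x,y). (\<psi> x y)\<^sup>2 * (cutoff' (f x y) * (fxx x y + fyy x y + 2 * s * (Lx x y * fx x y + Ly x y * fy x y))
             + cutoff'' (f x y) * ((fx x y)\<^sup>2 + (fy x y)\<^sup>2))) \<ge> 0"
proof -
  have contR: "continuous_on R (case_prod g)" if "g \<in> {\<psi>,\<psi>x,\<psi>y,\<psi>xx,\<psi>yy,f,fx,fy,fxx,fyy,L,Lx,Ly,Lxx,Lyy}" for g
    using that \<psi> f L unfolding C2_on_def by auto
  have cc: "continuous_on R (\<lambda>p. cutoff (f (fst p) (snd p)))" "continuous_on R (\<lambda>p. cutoff' (f (fst p) (snd p)))"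
     "continuous_on R (\<lambda>p. cutoff'' (f (fst p) (snd p)))"
  proof -
    have "continuous_on UNIV cutoff" "continuous_on UNIV cutoff'" "continuous_on UNIV cutoff''"
      using DERIV_cutoff DERIV_cutoff' isCont_cutoff''
      by (auto simp: continuous_on_eq_continuous_at intro: DERIV_isCont)
    moreover have "continuous_on R (\<lambda>p. f (fst p) (snd p))" using contR[of f] by (simp add: case_prod_beta)
    ultimately show "continuous_on R (\<lambda>p. cutoff (f (fst p) (snd p)))" "continuous_on R (\<lambda>p. cutoff' (f (fst p) (snd p)))"
     "continuous_on R (\<lambda>p. cutoff'' (f (fst p) (snd p)))"
      by (auto intro: continuous_on_compose2)
  qed
  have cR: "continuous_on R (\<lambda>p. g (fst p) (snd p))" if "g \<in> {\<psi>,\<psi>x,\<psi>y,\<psi>xx,\<psi>yy,f,fx,fy,fxx,fyy,L,Lx,Ly,Lxx,Lyy}" for g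
    using contR[OF that] by (simp add: case_prod_beta)
  define X where "X x y = 2 * cutoff (f x y) * \<psi> x y * \<psi>x x y - (\<psi> x y)\<^sup>2 * (cutoff' (f x y) * fx x y)
      - 2 * s * cutoff (f x y) * (\<psi> x y)\<^sup>2 * Lx x y" for x y
  define Y where "Y x y = 2 * cutoff (f x y) * \<psi> x y * \<psi>y x y - (\<psi> x y)\<^sup>2 * (cutoff' (f x y) * fy x y)
      - 2 * s * cutoff (f x y) * (\<psi> x y)\<^sup>2 * Ly x y" for x y
  \<comment> \<open>The derivative of one component of the field along its own coordinate; one
    expression serves both directions.\<close>
  define D where "D q qx qxx g gx gxx l lx =
     2 * cutoff g * (qx\<^sup>2 + q * qxx) - q\<^sup>2 * (cutoff'' g * gx\<^sup>2 + cutoff' g * gxx)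
      - 2 * s * (cutoff' g * gx * q\<^sup>2 * l + cutoff g * (2 * q * qx * l + q\<^sup>2 * lx))" for q qx qxx g gx gxx l lx :: real
  define dX where "dX x y = D (\<psi> x y) (\<psi>x x y) (\<psi>xx x y) (f x y) (fx x y) (fxx x y) (Lx x y) (Lxx x y)" for x y
  define dY where "dY x y = D (\<psi> x y) (\<psi>y x y) (\<psi>yy x y) (f x y) (fy x y) (fyy x y) (Ly x y) (Lyy x y)" for x y
  have gen: "((\<lambda>t. 2 * cutoff (g t) * q t * qx t - (q t)\<^sup>2 * (cutoff' (g t) * gx t)
      - 2 * s * cutoff (g t) * (q t)\<^sup>2 * l t) has_real_derivative D (q t) (qx t) qxx (g t) (gx t) gxx (l t) lx) (at t)"
    if "(q has_real_derivative qx t) (at t)" "(qx has_real_derivative qxx) (at t)"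
      "(g has_real_derivative gx t) (at t)" "(gx has_real_derivative gxx) (at t)"
      "(l has_real_derivative lx) (at t)" for q qx g gx l :: "real \<Rightarrow> real" and qxx gxx lx t
  proof -
    note [derivative_intros] = that DERIV_chain2[OF DERIV_cutoff] DERIV_chain2[OF DERIV_cutoff']
    show ?thesis unfolding D_def
      by (auto intro!: derivative_eq_intros simp: power2_eq_square algebra_simps)
  qed
  have dXc: "continuous_on R (case_prod dX)" and dYc: "continuous_on R (case_prod dY)"
    unfolding dX_def dY_def D_def case_prod_beta
    by (intro continuous_intros cc cR; simp)+
  have X0: "integral {x1..x2} (\<lambda>x. dX x y) = 0" if "y \<in> {y1..y2}" for y
  proof -
    have "((\<lambda>x. dX x y) has_integral X x2 y - X x1 y) {x1..x2}"
    proof (rule fundamental_theorem_of_calculus[OF le(1)])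
      fix x assume "x \<in> {x1..x2}"
      then have "(x,y) \<in> R" using that by (simp add: R_def cbox_Pair_eq)
      note R = this
      have "((\<lambda>x. X x y) has_real_derivative dX x y) (at x)"
        unfolding X_def Y_def dX_def dY_def
        by (rule gen[where q="\<lambda>t. \<psi> t y" and qx="\<lambda>t. \<psi>x t y" and g="\<lambda>t. f t y" and gx="\<lambda>t. fx t y" and l="\<lambda>t. Lx t y"])
          (rule C2_onD[OF \<psi> R] C2_onD[OF f R] C2_onD[OF L R])+
      then show "((\<lambda>x. X x y) has_vector_derivative dX x y) (at x within {x1..x2})"
        by (simp add: has_real_derivative_iff_has_vector_derivative has_vector_derivative_at_within)
    qed
    \<comment> \<open>On the sides of the rectangle \<open>f\<close> is nonpositive, so
      \<open>cutoff\<close> and \<open>cutoff'\<close> vanish there together, and every term of the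
      field contains one of them.\<close>
    moreover have "X x2 y = 0" "X x1 y = 0"
      using bd[of x1 y] bd[of x2 y] that le by (auto simp: X_def cutoff_neg R_def cbox_Pair_eq)
    ultimately show ?thesis by (simp add: integral_unique)
  qed
  have Y0: "integral {y1..y2} (\<lambda>y. dY x y) = 0" if "x \<in> {x1..x2}" for x
  proof -
    have "((\<lambda>y. dY x y) has_integral Y x y2 - Y x y1) {y1..y2}"
    proof (rule fundamental_theorem_of_calculus[OF le(2)])
      fix y assume "y \<in> {y1..y2}"
      then have "(x,y) \<in> R" using that by (simp add: R_def cbox_Pair_eq)
      note R = this
      have "((\<lambda>y. Y x y) has_real_derivative dY x y) (at y)"
        unfolding X_def Y_def dX_def dY_def
        by (rule gen[where q="\<lambda>t. \<psi> x t" and qx="\<lambda>t. \<psi>y x t" and g="\<lambda>t. f x t" and gx="\<lambda>t. fy x t" and l="\<lambda>t. Ly x t"])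
          (rule C2_onD[OF \<psi> R] C2_onD[OF f R] C2_onD[OF L R])+
      then show "((\<lambda>y. Y x y) has_vector_derivative dY x y) (at y within {y1..y2})"
        by (simp add: has_real_derivative_iff_has_vector_derivative has_vector_derivative_at_within)
    qed
    moreover have "Y x y2 = 0" "Y x y1 = 0"
      using bd[of x y1] bd[of x y2] that le by (auto simp: Y_def cutoff_neg R_def cbox_Pair_eq)
    ultimately show ?thesis by (simp add: integral_unique)
  qed
  have "integral R (case_prod dY) = integral (cbox x1 x2) (\<lambda>x. integral (cbox y1 y2) (\<lambda>y. case_prod dY (x,y)))"
    using dYc unfolding R_def by (rule integral_prod_continuous)
  also have "\<dots> = integral (cbox x1 x2) (\<lambda>x. 0)" by (rule integral_cong) (use Y0 in simp)
  finally have IY: "integral R (case_prod dY) = 0" by simp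
  have "integral R (case_prod dX) = integral (cbox x1 x2) (\<lambda>x. integral (cbox y1 y2) (\<lambda>y. dX x y))"
    using integral_prod_continuous[OF dXc[unfolded R_def]] unfolding R_def by simp
  also have "\<dots> = integral (cbox y1 y2) (\<lambda>y. integral (cbox x1 x2) (\<lambda>x. dX x y))"
    using dXc unfolding R_def by (rule integral_swap_continuous)
  also have "\<dots> = integral (cbox y1 y2) (\<lambda>y. 0)" by (rule integral_cong) (use X0 in simp)
  finally have IX: "integral R (case_prod dX) = 0" by simp
  have Ic: "continuous_on R ?I"
    unfolding case_prod_beta by (intro continuous_intros cc cR; simp)
  then show I: "?I integrable_on R" unfolding R_def by (rule integrable_continuous)
  have dXi: "case_prod dX integrable_on R" and dYi: "case_prod dY integrable_on R"
    using dXc dYc unfolding R_def by (auto intro: integrable_continuous)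
  have "0 = - integral R (\<lambda>p. case_prod dX p + case_prod dY p)"
    using IX IY by (simp add: integral_add dXi dYi)
  also have "\<dots> = integral R (\<lambda>p. - (case_prod dX p + case_prod dY p))" by (rule integral_neg[symmetric])
  also have "\<dots> \<le> integral R ?I"
  proof (rule integral_le)
    show "(\<lambda>p. - (case_prod dX p + case_prod dY p)) integrable_on R"
      by (intro integrable_neg integrable_add dXi dYi)
    show "- (case_prod dX p + case_prod dY p) \<le> ?I p" if "p \<in> R" for p
    proof -
      obtain x y where p: "p = (x,y)" by (cases p)
      \<comment> \<open>The potentials of \<psi> and of \<open>exp (s * L)\<close> are the same
        \<open>c\<close>; eliminating it together with \<open>\<psi>yy\<close> leaves precisely the
        completed squares.\<close>
      have e: "\<psi>yy x y = (s * (Lxx x y + Lyy x y) + s\<^sup>2 * ((Lx x y)\<^sup>2 + (Ly x y)\<^sup>2)) * \<psi> x y - \<psi>xx x y"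
        using eig[of x y] hL[of x y] that p by simp
      have "?I p + (case_prod dX p + case_prod dY p)
        = 2 * cutoff (f x y) * ((\<psi>x x y - s * \<psi> x y * Lx x y)\<^sup>2 + (\<psi>y x y - s * \<psi> x y * Ly x y)\<^sup>2)"
        unfolding p dX_def dY_def D_def prod.case e by (simp add: power2_eq_square algebra_simps)
      moreover have "\<dots> \<ge> 0" using cutoff_nonneg[of "f x y"] by simp
      ultimately show ?thesis by linarith
    qed
  qed (rule I)
  finally show "0 \<le> integral R ?I" .
qed

section \<open>A radial supersolution\<close>

text \<open>The logarithm produces the singularity at \<open>N = 1\<close> as \<open>a\<close> tends to 0; it decays like \<open>N\<^sup>-\<^sup>2\<close>, fast enough to be
  absorbed for this choice of \<open>radial_delta\<close> by the defect of \<open>N\<^sup>-\<^sup>s\<close> from being a solution.\<close>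

definition radial_delta :: "real \<Rightarrow> real" where "radial_delta s = s * (s + 1) / (4 * s + 2)"

definition radial_corr :: "real \<Rightarrow> real \<Rightarrow> real \<Rightarrow> real" where
  "radial_corr s a N = 1 + radial_delta s * (ln (N\<^sup>2 + a) - ln (N\<^sup>2 - 1 + a))"

definition radial_corr' :: "real \<Rightarrow> real \<Rightarrow> real \<Rightarrow> real" where
  "radial_corr' s a N = radial_delta s * (2 * N / (N\<^sup>2 + a) - 2 * N / (N\<^sup>2 - 1 + a))"

definition radial_corr'' :: "real \<Rightarrow> real \<Rightarrow> real \<Rightarrow> real" where
  "radial_corr'' s a N = radial_delta s * (2 / (N\<^sup>2 + a) - 4 * N\<^sup>2 / (N\<^sup>2 + a)\<^sup>2 - 2 / (N\<^sup>2 - 1 + a) + 4 * N\<^sup>2 / (N\<^sup>2 - 1 + a)\<^sup>2)"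

definition radial :: "real \<Rightarrow> real \<Rightarrow> real \<Rightarrow> real" where
  "radial s a N = N powr (-s) * radial_corr s a N"

definition radial' :: "real \<Rightarrow> real \<Rightarrow> real \<Rightarrow> real" where
  "radial' s a N = N powr (-s) * (radial_corr' s a N - s * radial_corr s a N / N)"

definition radial'' :: "real \<Rightarrow> real \<Rightarrow> real \<Rightarrow> real" where
  "radial'' s a N = N powr (-s) *
     (radial_corr'' s a N - 2 * s * radial_corr' s a N / N + s * (s + 1) * radial_corr s a N / N\<^sup>2)"

lemma radial_rho_pos: fixes N a :: real assumes "N \<ge> 1" "a > 0" shows "N\<^sup>2 - 1 + a > 0" "N\<^sup>2 + a > 0"
proof -
  have "N\<^sup>2 \<ge> 1" using assms by simp
  then show "N\<^sup>2 - 1 + a > 0" "N\<^sup>2 + a > 0" using assms by linarith+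
qed

lemma DERIV_radial_corr:
  assumes "N \<ge> 1" "a > 0"
  shows "(radial_corr s a has_real_derivative radial_corr' s a N) (at N)"
    "(radial_corr' s a has_real_derivative radial_corr'' s a N) (at N)"
proof -
  note p = radial_rho_pos[OF assms]
  show "(radial_corr s a has_real_derivative radial_corr' s a N) (at N)"
    unfolding radial_corr_def[abs_def] radial_corr'_def
    using p by (auto intro!: derivative_eq_intros)
  \<comment> \<open>Used with \<open>k = a\<close> and with \<open>k = a - 1\<close>.\<close>
  have d: "((\<lambda>N. 2 * N / (N\<^sup>2 + k)) has_real_derivative 2 / (N\<^sup>2 + k) - 4 * N\<^sup>2 / (N\<^sup>2 + k)\<^sup>2) (at N)"
    if "N\<^sup>2 + k > 0" for k :: real
  proof -
    have "((\<lambda>N. 2 * N / (N\<^sup>2 + k)) has_real_derivative (2 * (N\<^sup>2 + k) - 2 * N * (2 * N)) / ((N\<^sup>2 + k) * (N\<^sup>2 + k))) (at N)"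
      using that by (intro DERIV_divide) (auto intro!: derivative_eq_intros)
    also have "(2 * (N\<^sup>2 + k) - 2 * N * (2 * N)) / ((N\<^sup>2 + k) * (N\<^sup>2 + k)) = 2 / (N\<^sup>2 + k) - 4 * N\<^sup>2 / (N\<^sup>2 + k)\<^sup>2"
    proof -
      have "(2 * Q - 2 * N * (2 * N)) / (Q * Q) = 2 / Q - 4 * N\<^sup>2 / Q\<^sup>2" if "Q > 0" for Q
        using that by (simp add: diff_divide_distrib power2_eq_square)
      then show ?thesis using that by blast
    qed
    finally show ?thesis .
  qed
  have "((\<lambda>N. radial_delta s * (2 * N / (N\<^sup>2 + a) - 2 * N / (N\<^sup>2 + (a - 1)))) has_real_derivative
     radial_delta s * ((2 / (N\<^sup>2 + a) - 4 * N\<^sup>2 / (N\<^sup>2 + a)\<^sup>2) - (2 / (N\<^sup>2 + (a - 1)) - 4 * N\<^sup>2 / (N\<^sup>2 + (a-1))\<^sup>2))) (at N)"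
    using p by (intro DERIV_cmult DERIV_diff d) auto
  then show "(radial_corr' s a has_real_derivative radial_corr'' s a N) (at N)"
    unfolding radial_corr'_def[abs_def] radial_corr''_def by (simp add: algebra_simps)
qed

lemma DERIV_radial:
  assumes "N \<ge> 1" "a > 0"
  shows "(radial s a has_real_derivative radial' s a N) (at N)"
    "(radial' s a has_real_derivative radial'' s a N) (at N)"
proof -
  have N: "N > 0" using assms by simp
  note d = DERIV_radial_corr[OF assms, of s]
  have P: "((\<lambda>N. N powr (-s)) has_real_derivative N powr (-s) * (- s / N)) (at N)"
    using N by (auto intro!: derivative_eq_intros simp: powr_diff)
  have "((\<lambda>N. N powr (-s) * radial_corr s a N) has_real_derivative
     N powr (-s) * (- s / N) * radial_corr s a N + radial_corr' s a N * N powr (-s)) (at N)"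
    by (rule DERIV_mult[OF P d(1)])
  then show "(radial s a has_real_derivative radial' s a N) (at N)"
    unfolding radial_def[abs_def] radial'_def by (simp add: algebra_simps)
  have Q: "((\<lambda>N. radial_corr' s a N - s * radial_corr s a N / N) has_real_derivative
      radial_corr'' s a N - (s * radial_corr' s a N * N - s * radial_corr s a N * 1) / (N * N)) (at N)"
    using N by (intro DERIV_diff d DERIV_divide DERIV_cmult DERIV_ident) auto
  have "((\<lambda>N. N powr (-s) * (radial_corr' s a N - s * radial_corr s a N / N)) has_real_derivative
     N powr (-s) * (- s / N) * (radial_corr' s a N - s * radial_corr s a N / N) +
     (radial_corr'' s a N - (s * radial_corr' s a N * N - s * radial_corr s a N * 1) / (N * N)) * N powr (-s)) (at N)"
    by (rule DERIV_mult[OF P Q])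
  also have "N powr (-s) * (- s / N) * (radial_corr' s a N - s * radial_corr s a N / N) +
     (radial_corr'' s a N - (s * radial_corr' s a N * N - s * radial_corr s a N * 1) / (N * N)) * N powr (-s) = radial'' s a N"
    using N unfolding radial''_def by (simp add: field_simps power2_eq_square)
  finally show "(radial' s a has_real_derivative radial'' s a N) (at N)"
    unfolding radial'_def[abs_def] .
qed

lemma radial_corr_ge_1:
  assumes "N \<ge> 1" "a > 0" "s > 0" shows "radial_corr s a N \<ge> 1"
proof -
  note p = radial_rho_pos[OF assms(1,2)]
  have "ln (N\<^sup>2 - 1 + a) \<le> ln (N\<^sup>2 + a)" using p by simp
  then show ?thesis using assms(3) by (simp add: radial_corr_def radial_delta_def)
qed

text \<open>The left side is the radial hyperbolic Laplacian of the logarithmic term of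
  \<open>radial_corr\<close>, divided by \<open>radial_delta\<close>, with \<open>m = N^2\<close>
  and \<open>r = N^2 - 1 + a\<close>. Over the common denominator \<open>r^2 (r+1)^2\<close> the
  slack is \<open>a (2 (r+1) + 4 (2 r + 1) (r - a))\<close>, nonnegative because
  \<open>a \<le> r\<close>.\<close>

lemma radial_source_term:
  fixes r a :: real
  assumes "r > 0" "0 \<le> a" "a \<le> r"
  defines "m \<equiv> r + 1 - a"
  shows "(m - 1) * (2 / (r+1) - 4*m/(r+1)\<^sup>2 - 2/r + 4*m/r\<^sup>2) + 2 * m * (2/(r+1) - 2/r) \<le> 2 / (r+1) - 2*a/r\<^sup>2"
proof -
  define D A B C E where "D = r\<^sup>2 * (r+1)\<^sup>2" and "A = 1 / (r+1)" and "B = 1 / (r+1)\<^sup>2" and "C = 1 / r" and "E = 1 / r\<^sup>2"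
  have D: "A * D = r\<^sup>2 * (r+1)" "B * D = r\<^sup>2" "C * D = r * (r+1)\<^sup>2" "E * D = (r+1)\<^sup>2" "D > 0"
    using assms by (simp_all add: D_def A_def B_def C_def E_def power2_eq_square)
  define X where "X = (2 * A - 2 * a * E) - ((m - 1) * (2 * A - 4 * m * B - 2 * C + 4 * m * E) + 2 * m * (2 * A - 2 * C))"
  have "X * D = (2 * (A * D) - 2 * a * (E * D)) -
     ((m - 1) * (2 * (A * D) - 4 * m * (B * D) - 2 * (C * D) + 4 * m * (E * D)) + 2 * m * (2 * (A * D) - 2 * (C * D)))"
    unfolding X_def by (simp add: algebra_simps)
  also have "\<dots> = a * (2 * (r+1) + 4 * (2*r+1) * (r-a))"
    unfolding D m_def by (simp add: power2_eq_square algebra_simps)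
  also have "\<dots> \<ge> 0" using assms by simp
  finally have "X \<ge> 0" using D(5) by (simp add: zero_le_mult_iff)
  then show ?thesis unfolding X_def A_def B_def C_def E_def by simp
qed

text \<open>The right hand side is a source whose mass stays bounded below while it concentrates at \<open>N = 1\<close>
  as \<open>a\<close> tends to 0.\<close>

lemma radial_supersolution:
  assumes "N \<ge> 1" "a > 0" "s > 0"
  shows "(N\<^sup>2 - 1) * radial'' s a N + 2 * N * radial' s a N - s * (s - 1) * radial s a N
     \<le> - (N powr (-s) * (2 * radial_delta s * a / (N\<^sup>2 - 1 + a)\<^sup>2))"
proof -
  define r where "r = N\<^sup>2 - 1 + a"
  define B B1 B2 \<delta> where "B = radial_corr s a N" and "B1 = radial_corr' s a N" and "B2 = radial_corr'' s a N"
    and "\<delta> = radial_delta s"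
  have N: "N > 0" and N2: "N\<^sup>2 \<ge> 1" using assms by auto
  have r: "r > 0" "a \<le> r" "r + 1 = N\<^sup>2 + a" "N\<^sup>2 = r + 1 - a" using radial_rho_pos[OF assms(1,2)] N2 by (auto simp: r_def)
  have \<delta>: "\<delta> > 0" "\<delta> * (4 * s + 2) = s * (s + 1)" using assms by (auto simp: \<delta>_def radial_delta_def)
  have "(N\<^sup>2 - 1) * radial'' s a N + 2 * N * radial' s a N - s * (s - 1) * radial s a N
    = N powr (-s) * ((N\<^sup>2 - 1) * (B2 - 2 * s * B1 / N + s * (s + 1) * B / N\<^sup>2) + 2 * N * (B1 - s * B / N) - s * (s - 1) * B)"
    unfolding radial''_def radial'_def radial_def B_def B1_def B2_def by (simp add: algebra_simps)
  \<comment> \<open>The last term is the defect of N^(-s) from being a solution. It is the negative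
    term that has to pay for the logarithmic correction.\<close>
  also have "(N\<^sup>2 - 1) * (B2 - 2 * s * B1 / N + s * (s + 1) * B / N\<^sup>2) + 2 * N * (B1 - s * B / N) - s * (s - 1) * B
    = ((N\<^sup>2 - 1) * B2 + 2 * N * B1) - 2 * s * ((N\<^sup>2 - 1) * (B1 / N)) - s * (s + 1) * B / N\<^sup>2"
    using N by (simp add: field_simps power2_eq_square)
  also have "\<dots> \<le> - (2 * \<delta> * a / r\<^sup>2)"
  proof -
    have "(N\<^sup>2 - 1) * B2 + 2 * N * B1
       = \<delta> * ((N\<^sup>2 - 1) * (2 / (r+1) - 4*N\<^sup>2/(r+1)\<^sup>2 - 2/r + 4*N\<^sup>2/r\<^sup>2) + 2 * N\<^sup>2 * (2/(r+1) - 2/r))"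
      unfolding B2_def B1_def radial_corr''_def radial_corr'_def \<delta>_def[symmetric] r(3) r_def[symmetric]
      by (simp add: algebra_simps power2_eq_square)
    also have "\<dots> \<le> \<delta> * (2 / (r+1) - 2*a/r\<^sup>2)"
      using radial_source_term[OF r(1) _ r(2)] assms \<delta> r(4) by (intro mult_left_mono) auto
    finally have 1: "(N\<^sup>2 - 1) * B2 + 2 * N * B1 \<le> \<delta> * (2 / (r+1)) - 2 * \<delta> * a / r\<^sup>2"
      by (simp add: algebra_simps)
    have "B1 = N * (\<delta> * (2 / (r+1) - 2 / r))"
      unfolding B1_def radial_corr'_def \<delta>_def[symmetric] r(3)[symmetric] r_def[symmetric]
      by (simp add: algebra_simps)
    then have "B1 / N = \<delta> * (2 / (r+1) - 2 / r)" using N by simp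
    also have "\<dots> = - (2 * \<delta> / (r * (r+1)))" using r(1) by (simp add: field_simps)
    finally have "- 2 * s * ((N\<^sup>2 - 1) * (B1 / N)) = 4 * s * \<delta> * ((N\<^sup>2 - 1) / r) / (r+1)" by simp
    also have "\<dots> \<le> 4 * s * \<delta> * 1 / (r+1)"
      using r assms \<delta> N2 by (intro divide_right_mono mult_left_mono) (auto simp: pos_divide_le_eq)
    finally have 2: "- 2 * s * ((N\<^sup>2 - 1) * (B1 / N)) \<le> 4 * s * \<delta> / (r+1)" by simp
    \<comment> \<open>The choice of \<open>radial_delta\<close>: the two positive contributions of
      the logarithm, over the common denominator \<open>r + 1 = N^2 + a\<close>, use up exactly the
      coefficient \<open>s (s + 1)\<close> of the defect.\<close>
    have "\<delta> * 2 + 4 * s * \<delta> = s * (s + 1)" using \<delta>(2) by (simp add: algebra_simps)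
    then have "\<delta> * (2 / (r+1)) + 4 * s * \<delta> / (r+1) = s * (s + 1) / (r+1)"
      by (metis add_divide_distrib times_divide_eq_right)
    also have "\<dots> \<le> s * (s + 1) / N\<^sup>2" using assms r N2 by (intro divide_left_mono) auto
    also have "\<dots> \<le> s * (s + 1) * B / N\<^sup>2"
      using radial_corr_ge_1[OF assms] assms by (intro divide_right_mono) (auto simp: B_def)
    finally show ?thesis using 1 2 by linarith
  qed
  finally show ?thesis
    unfolding r_def[symmetric] \<delta>_def[symmetric] by (simp add: mult_left_mono)
qed

section \<open>The barrier\<close>

text \<open>\<open>coshd x0 y0\<close> is the hyperbolic cosine of the distance to \<open>x0 + i y0\<close>, and \<open>height x y\<close> is the imaginary
  part of \<open>-1/(x + i y)\<close>.\<close>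

definition coshd :: "real \<Rightarrow> real \<Rightarrow> real \<Rightarrow> real \<Rightarrow> real" where
  "coshd x0 y0 x y = ((x - x0)\<^sup>2 + y\<^sup>2 + y0\<^sup>2) / (2 * y * y0)"

definition height :: "real \<Rightarrow> real \<Rightarrow> real" where "height x y = y / (x\<^sup>2 + y\<^sup>2)"

lemma coshd_ge_1: assumes "y > 0" "y0 > 0" shows "coshd x0 y0 x y \<ge> 1"
proof -
  have "2 * y * y0 \<le> (x - x0)\<^sup>2 + y\<^sup>2 + y0\<^sup>2"
    using sum_squares_bound[of y y0] zero_le_power2[of "x - x0"] by linarith
  then show ?thesis using assms by (simp add: coshd_def le_divide_eq)
qed

text \<open>As a function of the height t alone, \<open>coshd\<close> has the form
  \<open>A / t + h t\<close>. Its vertical derivatives are expressed through \<open>coshd\<close>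
  itself so that later identities can treat it as an unknown N.\<close>

lemma DERIV_coshd:
  assumes "y > 0" "y0 > 0"
  shows "((\<lambda>t. coshd x0 y0 t y) has_real_derivative (x - x0) / (y * y0)) (at x)"
    "((\<lambda>t. (t - x0) / (y * y0)) has_real_derivative 1 / (y * y0)) (at x)"
    "((\<lambda>t. coshd x0 y0 x t) has_real_derivative 1 / y0 - coshd x0 y0 x y / y) (at y)"
    "((\<lambda>t. 1 / y0 - coshd x0 y0 x t / t) has_real_derivative 2 * coshd x0 y0 x y / y\<^sup>2 - 1 / (y * y0)) (at y)"
proof -
  show "((\<lambda>t. coshd x0 y0 t y) has_real_derivative (x - x0) / (y * y0)) (at x)"
    unfolding coshd_def using assms by (auto intro!: derivative_eq_intros simp: field_simps)
  show "((\<lambda>t. (t - x0) / (y * y0)) has_real_derivative 1 / (y * y0)) (at x)"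
    using assms by (auto intro!: derivative_eq_intros)
  define A h where "A = ((x - x0)\<^sup>2 + y0\<^sup>2) / (2 * y0)" and "h = 1 / (2 * y0)"
  have h: "1 / y0 = 2 * h" by (simp add: h_def)
  have eq: "coshd x0 y0 x t = A * (1 / t) + t * h" if "t > 0" for t
  proof -
    have "coshd x0 y0 x t = (((x - x0)\<^sup>2 + y0\<^sup>2) + t\<^sup>2) / (2 * y0 * t)"
      by (simp add: coshd_def algebra_simps)
    then show ?thesis using that
      by (simp add: add_divide_distrib A_def h_def power2_eq_square)
  qed
  have d1: "((\<lambda>t. A * (1 / t) + t * h) has_real_derivative A * (- 1 / y\<^sup>2) + h) (at y)"
    using assms by (auto intro!: derivative_eq_intros simp: power2_eq_square)
  have e1: "A * (- 1 / y\<^sup>2) + h = 1 / y0 - coshd x0 y0 x y / y"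
    using assms by (simp add: eq h add_divide_distrib power2_eq_square)
  show D: "((\<lambda>t. coshd x0 y0 x t) has_real_derivative 1 / y0 - coshd x0 y0 x y / y) (at y)"
    using d1 unfolding e1
    by (rule has_field_derivative_transform_within_open[where S="{0<..}"]) (use assms eq in auto)
  have "((\<lambda>t. 1 / y0 - coshd x0 y0 x t / t) has_real_derivative
     0 - ((1 / y0 - coshd x0 y0 x y / y) * y - coshd x0 y0 x y * 1) / (y * y)) (at y)"
    using assms by (intro DERIV_diff DERIV_const DERIV_divide D DERIV_ident) auto
  also have "0 - ((1 / y0 - coshd x0 y0 x y / y) * y - coshd x0 y0 x y * 1) / (y * y)
    = 2 * coshd x0 y0 x y / y\<^sup>2 - 1 / (y * y0)"
  proof -
    have "(1 / y0 - c / y) * y - c * 1 = y / y0 - 2 * c" for c using assms by (simp add: algebra_simps)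
    then show ?thesis using assms by (simp add: diff_divide_distrib power2_eq_square)
  qed
  finally show "((\<lambda>t. 1 / y0 - coshd x0 y0 x t / t) has_real_derivative 2 * coshd x0 y0 x y / y\<^sup>2 - 1 / (y * y0)) (at y)" .
qed

text \<open>For N = cosh d this is the identity sinh^2 = cosh^2 - 1, since the distance d has
  hyperbolic gradient of length 1.\<close>

lemma coshd_eikonal:
  assumes "y > 0" "y0 > 0"
  shows "y\<^sup>2 * (((x - x0) / (y * y0))\<^sup>2 + (1 / y0 - coshd x0 y0 x y / y)\<^sup>2) = (coshd x0 y0 x y)\<^sup>2 - 1"
proof -
  define c where "c = coshd x0 y0 x y"
  have "c * (2 * y * y0) = (x - x0)\<^sup>2 + y\<^sup>2 + y0\<^sup>2" using assms by (simp add: c_def coshd_def)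
  then have c: "(x - x0)\<^sup>2 = 2 * c * y * y0 - y\<^sup>2 - y0\<^sup>2" by (simp add: mult_ac)
  have 1: "y\<^sup>2 * ((x - x0) / (y * y0))\<^sup>2 = (x - x0)\<^sup>2 / y0\<^sup>2" using assms by (simp add: power_divide power_mult_distrib)
  have "y * (1 / y0 - c / y) = y / y0 - c" using assms by (simp add: right_diff_distrib)
  then have "y\<^sup>2 * (1 / y0 - c / y)\<^sup>2 = (y / y0 - c)\<^sup>2" by (metis power_mult_distrib)
  moreover have "(2 * c * y * y0 - y\<^sup>2 - y0\<^sup>2) / y0\<^sup>2 + (y / y0 - c)\<^sup>2 = c\<^sup>2 - 1"
    using assms by (simp add: field_simps power2_eq_square)
  ultimately show ?thesis unfolding c_def[symmetric] distrib_left 1 c by simp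
qed

lemma height_pos: "y > 0 \<Longrightarrow> height x y > 0"
  by (simp add: height_def add_nonneg_pos)

lemma norm2_pos: "y > 0 \<Longrightarrow> x\<^sup>2 + y\<^sup>2 > (0::real)"
  by (simp add: add_nonneg_pos)

lemma DERIV_height:
  fixes x y :: real
  assumes "y > 0"
  defines "r \<equiv> x\<^sup>2 + y\<^sup>2"
  shows "((\<lambda>t. height t y) has_real_derivative - 2 * x * y / r\<^sup>2) (at x)"
    "((\<lambda>t. - 2 * t * y / (t\<^sup>2 + y\<^sup>2)\<^sup>2) has_real_derivative (- 2 * y * r + 8 * x\<^sup>2 * y) / r^3) (at x)"
    "((\<lambda>t. height x t) has_real_derivative (x\<^sup>2 - y\<^sup>2) / r\<^sup>2) (at y)"
    "((\<lambda>t. (x\<^sup>2 - t\<^sup>2) / (x\<^sup>2 + t\<^sup>2)\<^sup>2) has_real_derivative (- 2 * y * r - 4 * y * (x\<^sup>2 - y\<^sup>2)) / r^3) (at y)"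
proof -
  have r: "r > 0" using assms norm2_pos by simp
  show "((\<lambda>t. height t y) has_real_derivative - 2 * x * y / r\<^sup>2) (at x)"
  proof -
    have "((\<lambda>t. y / (t\<^sup>2 + y\<^sup>2)) has_real_derivative (0 * (x\<^sup>2 + y\<^sup>2) - y * (2 * x)) / ((x\<^sup>2 + y\<^sup>2) * (x\<^sup>2 + y\<^sup>2))) (at x)"
      using r by (intro DERIV_divide) (auto intro!: derivative_eq_intros simp: r_def)
    then show ?thesis by (simp add: height_def[abs_def] r_def power2_eq_square mult.commute)
  qed
  show "((\<lambda>t. height x t) has_real_derivative (x\<^sup>2 - y\<^sup>2) / r\<^sup>2) (at y)"
  proof -
    have "((\<lambda>t. t / (x\<^sup>2 + t\<^sup>2)) has_real_derivative (1 * (x\<^sup>2 + y\<^sup>2) - y * (2 * y)) / ((x\<^sup>2 + y\<^sup>2) * (x\<^sup>2 + y\<^sup>2))) (at y)"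
      using r by (intro DERIV_divide) (auto intro!: derivative_eq_intros simp: r_def)
    then show ?thesis by (simp add: height_def[abs_def] r_def power2_eq_square)
  qed
  show "((\<lambda>t. - 2 * t * y / (t\<^sup>2 + y\<^sup>2)\<^sup>2) has_real_derivative (- 2 * y * r + 8 * x\<^sup>2 * y) / r^3) (at x)"
  proof -
    have "((\<lambda>t. - 2 * t * y / (t\<^sup>2 + y\<^sup>2)\<^sup>2) has_real_derivative
       ((- 2 * y) * r\<^sup>2 - (- 2 * x * y) * (2 * r * (2 * x))) / (r\<^sup>2 * r\<^sup>2)) (at x)"
      unfolding r_def using r by (intro DERIV_divide) (auto intro!: derivative_eq_intros simp: r_def)
    also have "((- 2 * y) * r\<^sup>2 - (- 2 * x * y) * (2 * r * (2 * x))) = (- 2 * y * r + 8 * x\<^sup>2 * y) * r"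
      by (simp add: power2_eq_square algebra_simps)
    also have "(- 2 * y * r + 8 * x\<^sup>2 * y) * r / (r\<^sup>2 * r\<^sup>2) = (- 2 * y * r + 8 * x\<^sup>2 * y) / r^3"
      using r by (simp add: power2_eq_square power3_eq_cube)
    finally show ?thesis .
  qed
  show "((\<lambda>t. (x\<^sup>2 - t\<^sup>2) / (x\<^sup>2 + t\<^sup>2)\<^sup>2) has_real_derivative (- 2 * y * r - 4 * y * (x\<^sup>2 - y\<^sup>2)) / r^3) (at y)"
  proof -
    have "((\<lambda>t. (x\<^sup>2 - t\<^sup>2) / (x\<^sup>2 + t\<^sup>2)\<^sup>2) has_real_derivative
       ((- 2 * y) * r\<^sup>2 - (x\<^sup>2 - y\<^sup>2) * (2 * r * (2 * y))) / (r\<^sup>2 * r\<^sup>2)) (at y)"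
      unfolding r_def using r by (intro DERIV_divide) (auto intro!: derivative_eq_intros simp: r_def)
    also have "((- 2 * y) * r\<^sup>2 - (x\<^sup>2 - y\<^sup>2) * (2 * r * (2 * y))) = (- 2 * y * r - 4 * y * (x\<^sup>2 - y\<^sup>2)) * r"
      by (simp add: power2_eq_square algebra_simps)
    also have "(- 2 * y * r - 4 * y * (x\<^sup>2 - y\<^sup>2)) * r / (r\<^sup>2 * r\<^sup>2) = (- 2 * y * r - 4 * y * (x\<^sup>2 - y\<^sup>2)) / r^3"
      using r by (simp add: power2_eq_square power3_eq_cube)
    finally show ?thesis .
  qed
qed

lemma height_harmonic:
  fixes x y :: real
  shows "(- 2 * y * (x\<^sup>2 + y\<^sup>2) + 8 * x\<^sup>2 * y) / (x\<^sup>2 + y\<^sup>2)^3 + (- 2 * y * (x\<^sup>2 + y\<^sup>2) - 4 * y * (x\<^sup>2 - y\<^sup>2)) / (x\<^sup>2 + y\<^sup>2)^3 = 0"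
  unfolding add_divide_distrib[symmetric] by (simp add: algebra_simps power2_eq_square)

text \<open>The function y has hyperbolic gradient of length y, and \<open>height\<close> is y
  composed with the isometry \<open>z \<mapsto> -1/z\<close>.\<close>

lemma height_eikonal:
  assumes "y > 0"
  shows "y\<^sup>2 * ((- 2 * x * y / (x\<^sup>2 + y\<^sup>2)\<^sup>2)\<^sup>2 + ((x\<^sup>2 - y\<^sup>2) / (x\<^sup>2 + y\<^sup>2)\<^sup>2)\<^sup>2) = (height x y)\<^sup>2"
proof -
  define r where "r = x\<^sup>2 + y\<^sup>2"
  have r: "r > 0" using assms norm2_pos by (simp add: r_def)
  have "(- 2 * x * y / r\<^sup>2)\<^sup>2 + ((x\<^sup>2 - y\<^sup>2) / r\<^sup>2)\<^sup>2 = ((- 2 * x * y)\<^sup>2 + (x\<^sup>2 - y\<^sup>2)\<^sup>2) / (r\<^sup>2)\<^sup>2"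
    by (simp add: power_divide add_divide_distrib)
  also have "(- 2 * x * y)\<^sup>2 + (x\<^sup>2 - y\<^sup>2)\<^sup>2 = r\<^sup>2" by (simp add: r_def power2_eq_square algebra_simps)
  also have "r\<^sup>2 / (r\<^sup>2)\<^sup>2 = 1 / r\<^sup>2" using r by (simp add: power2_eq_square)
  finally show ?thesis unfolding r_def height_def by (simp add: power_divide)
qed

definition height_x :: "real \<Rightarrow> real \<Rightarrow> real" where "height_x x y = - 2 * x * y / (x\<^sup>2 + y\<^sup>2)\<^sup>2"
definition height_y :: "real \<Rightarrow> real \<Rightarrow> real" where "height_y x y = (x\<^sup>2 - y\<^sup>2) / (x\<^sup>2 + y\<^sup>2)\<^sup>2"
definition height_xx :: "real \<Rightarrow> real \<Rightarrow> real" where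
  "height_xx x y = (- 2 * y * (x\<^sup>2 + y\<^sup>2) + 8 * x\<^sup>2 * y) / (x\<^sup>2 + y\<^sup>2)^3"
definition height_yy :: "real \<Rightarrow> real \<Rightarrow> real" where
  "height_yy x y = (- 2 * y * (x\<^sup>2 + y\<^sup>2) - 4 * y * (x\<^sup>2 - y\<^sup>2)) / (x\<^sup>2 + y\<^sup>2)^3"

definition coshd_x :: "real \<Rightarrow> real \<Rightarrow> real \<Rightarrow> real \<Rightarrow> real" where "coshd_x x0 y0 x y = (x - x0) / (y * y0)"
definition coshd_y :: "real \<Rightarrow> real \<Rightarrow> real \<Rightarrow> real \<Rightarrow> real" where "coshd_y x0 y0 x y = 1 / y0 - coshd x0 y0 x y / y"
definition coshd_xx :: "real \<Rightarrow> real \<Rightarrow> real" where "coshd_xx y0 y = 1 / (y * y0)"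
definition coshd_yy :: "real \<Rightarrow> real \<Rightarrow> real \<Rightarrow> real \<Rightarrow> real" where
  "coshd_yy x0 y0 x y = 2 * coshd x0 y0 x y / y\<^sup>2 - 1 / (y * y0)"

abbreviation upper :: "(real \<times> real) set" where "upper \<equiv> {p. snd p > 0}"

lemma continuous_on_pair_norm2:
  "p \<in> upper \<Longrightarrow> (fst p)\<^sup>2 + (snd p)\<^sup>2 \<noteq> 0"
  using norm2_pos[of "snd p" "fst p"] by simp

lemma C2_height: "C2_on upper height height_x height_y height_xx height_yy"
  unfolding C2_on_def
proof (intro conjI)
  show "continuous_on upper (case_prod height)" "continuous_on upper (case_prod height_x)"
    "continuous_on upper (case_prod height_y)" "continuous_on upper (case_prod height_xx)"
    "continuous_on upper (case_prod height_yy)"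
    unfolding case_prod_beta height_def height_x_def height_y_def height_xx_def height_yy_def
    by (intro continuous_intros ballI; use continuous_on_pair_norm2 in force)+
  show "\<forall>(x, y)\<in>upper. ((\<lambda>t. height t y) has_real_derivative height_x x y) (at x) \<and>
    ((\<lambda>t. height x t) has_real_derivative height_y x y) (at y) \<and>
    ((\<lambda>t. height_x t y) has_real_derivative height_xx x y) (at x) \<and>
    ((\<lambda>t. height_y x t) has_real_derivative height_yy x y) (at y)"
    using DERIV_height unfolding height_x_def height_y_def height_xx_def height_yy_def by auto
qed

lemma C2_coshd:
  assumes "y0 > 0"
  shows "C2_on upper (coshd x0 y0) (coshd_x x0 y0) (coshd_y x0 y0) (\<lambda>x. coshd_xx y0) (coshd_yy x0 y0)"
  unfolding C2_on_def
proof (intro conjI)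
  have c: "continuous_on upper (\<lambda>p. coshd x0 y0 (fst p) (snd p))"
    unfolding coshd_def using assms by (intro continuous_intros) auto
  show "continuous_on upper (case_prod (coshd x0 y0))" "continuous_on upper (case_prod (coshd_x x0 y0))"
    "continuous_on upper (case_prod (coshd_y x0 y0))" "continuous_on upper (\<lambda>(x, y). coshd_xx y0 y)"
    "continuous_on upper (case_prod (coshd_yy x0 y0))"
    unfolding case_prod_beta coshd_x_def coshd_y_def coshd_xx_def coshd_yy_def
    using assms by (intro continuous_intros c; force)+
  show "\<forall>(x, y)\<in>upper. ((\<lambda>t. coshd x0 y0 t y) has_real_derivative coshd_x x0 y0 x y) (at x) \<and>
    ((\<lambda>t. coshd x0 y0 x t) has_real_derivative coshd_y x0 y0 x y) (at y) \<and>
    ((\<lambda>t. coshd_x x0 y0 t y) has_real_derivative coshd_xx y0 y) (at x) \<and>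
    ((\<lambda>t. coshd_y x0 y0 x t) has_real_derivative coshd_yy x0 y0 x y) (at y)"
    using DERIV_coshd[OF _ assms] unfolding coshd_x_def coshd_y_def coshd_xx_def coshd_yy_def by auto
qed

text \<open>Together with \<open>coshd_sums\<close>, the only differential identities of V and N on
  which the computation of the barrier rests.\<close>

lemma height_sums:
  assumes "y > 0"
  shows "(height_x x y)\<^sup>2 + (height_y x y)\<^sup>2 = (height x y)\<^sup>2 / y\<^sup>2" "height_xx x y + height_yy x y = 0"
proof -
  show "(height_x x y)\<^sup>2 + (height_y x y)\<^sup>2 = (height x y)\<^sup>2 / y\<^sup>2"
    using height_eikonal[OF assms, of x] assms unfolding height_x_def height_y_def
    by (metis nonzero_mult_div_cancel_left not_less_iff_gr_or_eq power_eq_0_iff)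
  show "height_xx x y + height_yy x y = 0" unfolding height_xx_def height_yy_def by (rule height_harmonic)
qed

lemma coshd_sums:
  assumes "y > 0" "y0 > 0"
  shows "(coshd_x x0 y0 x y)\<^sup>2 + (coshd_y x0 y0 x y)\<^sup>2 = ((coshd x0 y0 x y)\<^sup>2 - 1) / y\<^sup>2"
    "coshd_xx y0 y + coshd_yy x0 y0 x y = 2 * coshd x0 y0 x y / y\<^sup>2"
proof -
  show "(coshd_x x0 y0 x y)\<^sup>2 + (coshd_y x0 y0 x y)\<^sup>2 = ((coshd x0 y0 x y)\<^sup>2 - 1) / y\<^sup>2"
    using coshd_eikonal[OF assms, of x x0] assms unfolding coshd_x_def coshd_y_def
    by (metis nonzero_mult_div_cancel_left not_less_iff_gr_or_eq power_eq_0_iff)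
  show "coshd_xx y0 y + coshd_yy x0 y0 x y = 2 * coshd x0 y0 x y / y\<^sup>2"
    by (simp add: coshd_xx_def coshd_yy_def)
qed

lemma C2_log_height:
  "C2_on upper (\<lambda>x y. ln (height x y)) (\<lambda>x y. height_x x y / height x y) (\<lambda>x y. height_y x y / height x y)
    (\<lambda>x y. height_xx x y / height x y - (height_x x y / height x y)\<^sup>2)
    (\<lambda>x y. height_yy x y / height x y - (height_y x y / height x y)\<^sup>2)"
proof -
  have c: "continuous_on upper (\<lambda>p. height (fst p) (snd p))" "continuous_on upper (\<lambda>p. height_x (fst p) (snd p))"
    "continuous_on upper (\<lambda>p. height_y (fst p) (snd p))" "continuous_on upper (\<lambda>p. height_xx (fst p) (snd p))"
    "continuous_on upper (\<lambda>p. height_yy (fst p) (snd p))"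
    using C2_height unfolding C2_on_def case_prod_beta by auto
  have p: "height (fst p) (snd p) > 0" if "p \<in> upper" for p using that height_pos by auto
  then have pn: "height (fst p) (snd p) \<noteq> 0" if "p \<in> upper" for p using that by fastforce
  have gen: "((\<lambda>t. ln (V t)) has_real_derivative V1 t / V t) (at t)"
    "((\<lambda>t. V1 t / V t) has_real_derivative V2 / V t - (V1 t / V t)\<^sup>2) (at t)"
    if "(V has_real_derivative V1 t) (at t)" "(V1 has_real_derivative V2) (at t)" "V t > 0" for V V1 :: "real \<Rightarrow> real" and V2 t
  proof -
    show "((\<lambda>t. ln (V t)) has_real_derivative V1 t / V t) (at t)"
      using that(1,3) by (auto intro!: derivative_eq_intros simp: field_simps)
    have "((\<lambda>t. V1 t / V t) has_real_derivative (V2 * V t - V1 t * V1 t) / (V t * V t)) (at t)"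
      using that by (intro DERIV_divide) auto
    then show "((\<lambda>t. V1 t / V t) has_real_derivative V2 / V t - (V1 t / V t)\<^sup>2) (at t)"
      using that(3) by (simp add: diff_divide_distrib power2_eq_square)
  qed
  show ?thesis unfolding C2_on_def
  proof (intro conjI)
    show "\<forall>(x, y)\<in>upper. ((\<lambda>t. ln (height t y)) has_real_derivative height_x x y / height x y) (at x) \<and>
       ((\<lambda>t. ln (height x t)) has_real_derivative height_y x y / height x y) (at y) \<and>
       ((\<lambda>t. height_x t y / height t y) has_real_derivative height_xx x y / height x y - (height_x x y / height x y)\<^sup>2) (at x) \<and>
       ((\<lambda>t. height_y x t / height x t) has_real_derivative height_yy x y / height x y - (height_y x y / height x y)\<^sup>2) (at y)"
    proof (intro ballI, clarsimp, intro conjI)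
      fix x y :: real assume y: "0 < y"
      then have u: "(x,y) \<in> upper" by simp
      note d = C2_onD[OF C2_height u]
      show "((\<lambda>t. ln (height t y)) has_real_derivative height_x x y / height x y) (at x)"
        "((\<lambda>t. height_x t y / height t y) has_real_derivative height_xx x y / height x y - (height_x x y / height x y)\<^sup>2) (at x)"
        using gen[of "\<lambda>t. height t y" "\<lambda>t. height_x t y" x, OF d(1,3) height_pos[OF y]] by auto
      show "((\<lambda>t. ln (height x t)) has_real_derivative height_y x y / height x y) (at y)"
        "((\<lambda>t. height_y x t / height x t) has_real_derivative height_yy x y / height x y - (height_y x y / height x y)\<^sup>2) (at y)"
        using gen[of "\<lambda>t. height x t" "\<lambda>t. height_y x t" y, OF d(2,4) height_pos[OF y]] by auto
    qed
    show "continuous_on upper (\<lambda>(x, y). ln (height x y))" "continuous_on upper (\<lambda>(x, y). height_x x y / height x y)"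
      "continuous_on upper (\<lambda>(x, y). height_y x y / height x y)"
      "continuous_on upper (\<lambda>(x, y). height_xx x y / height x y - (height_x x y / height x y)\<^sup>2)"
      "continuous_on upper (\<lambda>(x, y). height_yy x y / height x y - (height_y x y / height x y)\<^sup>2)"
      unfolding case_prod_beta by (intro continuous_intros c ballI p pn; assumption)+
  qed
qed

text \<open>The last term of the barrier is annihilated by the operator of \<open>barr_operator\<close> and makes the barrier negative
  near the real axis, where the eigenfunction is only known to be square integrable.\<close>

definition barr :: "real \<Rightarrow> real \<Rightarrow> real \<Rightarrow> real \<Rightarrow> real \<Rightarrow> real \<Rightarrow> real" where
  "barr s a c \<epsilon> V N = c * (V powr (-s)) * radial s a N - 1 - \<epsilon> * V powr (1 - 2 * s)"

definition barr1 :: "real \<Rightarrow> real \<Rightarrow> real \<Rightarrow> real \<Rightarrow> real \<Rightarrow> real \<Rightarrow> real \<Rightarrow> real \<Rightarrow> real" where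
  "barr1 s a c \<epsilon> V V1 N N1 = c * (V powr (-s)) * (radial' s a N * N1 - s * radial s a N * (V1 / V))
     - \<epsilon> * (1 - 2 * s) * V powr (1 - 2 * s) * (V1 / V)"

definition barr2 :: "real \<Rightarrow> real \<Rightarrow> real \<Rightarrow> real \<Rightarrow> real \<Rightarrow> real \<Rightarrow> real \<Rightarrow> real \<Rightarrow> real \<Rightarrow> real \<Rightarrow> real" where
  "barr2 s a c \<epsilon> V V1 V2 N N1 N2 = c * (V powr (-s)) *
      (s * (s+1) * radial s a N * (V1 / V)\<^sup>2 - s * radial s a N * (V2 / V) - 2 * s * radial' s a N * N1 * (V1 / V)
        + radial'' s a N * N1\<^sup>2 + radial' s a N * N2)
     - \<epsilon> * (1 - 2 * s) * V powr (1 - 2 * s) * (V2 / V - 2 * s * (V1 / V)\<^sup>2)"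

text \<open>Formulated along a line for arbitrary V and N, so that the horizontal and the vertical
  derivatives are two instances.\<close>

lemma DERIV_barr:
  assumes V: "(V has_real_derivative V1 t) (at t)" "(V1 has_real_derivative V2) (at t)" "V t > 0"
    and N: "(N has_real_derivative N1 t) (at t)" "(N1 has_real_derivative N2) (at t)" "N t \<ge> 1" and a: "a > 0"
  shows "((\<lambda>t. barr s a c \<epsilon> (V t) (N t)) has_real_derivative barr1 s a c \<epsilon> (V t) (V1 t) (N t) (N1 t)) (at t)"
    "((\<lambda>t. barr1 s a c \<epsilon> (V t) (V1 t) (N t) (N1 t)) has_real_derivative
       barr2 s a c \<epsilon> (V t) (V1 t) V2 (N t) (N1 t) N2) (at t)"
proof -
  have pw: "((\<lambda>t. V t powr k) has_real_derivative k * V t powr k * (V1 t / V t)) (at t)" for k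
    using DERIV_powr[OF V(1) V(3) DERIV_const[of k]] by (simp add: mult_ac)
  have r: "((\<lambda>t. radial s a (N t)) has_real_derivative radial' s a (N t) * N1 t) (at t)"
    "((\<lambda>t. radial' s a (N t)) has_real_derivative radial'' s a (N t) * N1 t) (at t)"
    using DERIV_chain2[OF DERIV_radial(1)[OF N(3) a] N(1)] DERIV_chain2[OF DERIV_radial(2)[OF N(3) a] N(1)] by auto
  have q: "((\<lambda>t. V1 t / V t) has_real_derivative V2 / V t - (V1 t / V t)\<^sup>2) (at t)"
  proof -
    have "((\<lambda>t. V1 t / V t) has_real_derivative (V2 * V t - V1 t * V1 t) / (V t * V t)) (at t)"
      using V by (intro DERIV_divide) auto
    then show ?thesis using V(3) by (simp add: diff_divide_distrib power2_eq_square)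
  qed
  note [derivative_intros] = pw r q N(1,2)
  show "((\<lambda>t. barr s a c \<epsilon> (V t) (N t)) has_real_derivative barr1 s a c \<epsilon> (V t) (V1 t) (N t) (N1 t)) (at t)"
  proof -
    have "((\<lambda>t. c * (V t powr (-s)) * radial s a (N t) - 1 - \<epsilon> * V t powr (1 - 2 * s)) has_real_derivative
      (c * (-s * V t powr (-s) * (V1 t / V t)) * radial s a (N t) + radial' s a (N t) * N1 t * (c * (V t powr (-s)))) - 0
       - \<epsilon> * ((1 - 2 * s) * V t powr (1 - 2 * s) * (V1 t / V t))) (at t)"
      by (intro DERIV_diff DERIV_mult DERIV_cmult DERIV_const pw r)
    then show ?thesis unfolding barr_def barr1_def by (simp add: algebra_simps)
  qed
  define X W q1 where "X t = V t powr (-s)" and "W t = V t powr (1 - 2 * s)" and "q1 t = V1 t / V t" for t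
  have dX: "(X has_real_derivative (-s) * X t * q1 t) (at t)" and dW: "(W has_real_derivative (1 - 2 * s) * W t * q1 t) (at t)"
    and dq: "(q1 has_real_derivative V2 / V t - (q1 t)\<^sup>2) (at t)"
    using pw[of "-s"] pw[of "1 - 2 * s"] q unfolding X_def W_def q1_def by auto
  show "((\<lambda>t. barr1 s a c \<epsilon> (V t) (V1 t) (N t) (N1 t)) has_real_derivative
       barr2 s a c \<epsilon> (V t) (V1 t) V2 (N t) (N1 t) N2) (at t)"
  proof -
    have "((\<lambda>t. c * X t * (radial' s a (N t) * N1 t - s * radial s a (N t) * q1 t) - \<epsilon> * (1 - 2 * s) * W t * q1 t) has_real_derivative
      ((c * ((-s) * X t * q1 t)) * (radial' s a (N t) * N1 t - s * radial s a (N t) * q1 t)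
        + ((radial'' s a (N t) * N1 t * N1 t + N2 * radial' s a (N t))
           - ((s * (radial' s a (N t) * N1 t)) * q1 t + (V2 / V t - (q1 t)\<^sup>2) * (s * radial s a (N t)))) * (c * X t))
      - ((\<epsilon> * (1 - 2 * s) * ((1 - 2 * s) * W t * q1 t)) * q1 t + (V2 / V t - (q1 t)\<^sup>2) * (\<epsilon> * (1 - 2 * s) * W t))) (at t)"
      by (intro DERIV_diff DERIV_mult DERIV_cmult dX dW dq r N(2))
    moreover have "(\<lambda>t. barr1 s a c \<epsilon> (V t) (V1 t) (N t) (N1 t))
       = (\<lambda>t. c * X t * (radial' s a (N t) * N1 t - s * radial s a (N t) * q1 t) - \<epsilon> * (1 - 2 * s) * W t * q1 t)"
      unfolding barr1_def X_def W_def q1_def ..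
    moreover have "barr2 s a c \<epsilon> (V t) (V1 t) V2 (N t) (N1 t) N2 =
      ((c * ((-s) * X t * q1 t)) * (radial' s a (N t) * N1 t - s * radial s a (N t) * q1 t)
        + ((radial'' s a (N t) * N1 t * N1 t + N2 * radial' s a (N t))
           - ((s * (radial' s a (N t) * N1 t)) * q1 t + (V2 / V t - (q1 t)\<^sup>2) * (s * radial s a (N t)))) * (c * X t))
      - ((\<epsilon> * (1 - 2 * s) * ((1 - 2 * s) * W t * q1 t)) * q1 t + (V2 / V t - (q1 t)\<^sup>2) * (\<epsilon> * (1 - 2 * s) * W t))"
      unfolding barr2_def X_def[symmetric] W_def[symmetric] q1_def[symmetric]
      by (simp add: algebra_simps power2_eq_square)
    ultimately show ?thesis by simp
  qed
qed

text \<open>Put \<open>h = V^s\<close>, a solution of the eigenvalue equation. The operator on the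
  left is multiplication by h, then the Laplacian minus \<open>s (s - 1) / y^2\<close>, then
  division by h. It therefore kills 1 and V^(1-2s), which correspond to the solutions V^s and
  V^(1-s), and turns V^(-s) F(N) into the radial operator of F; the mixed terms in the gradients of
  V and N cancel.\<close>

lemma barr_operator:
  fixes V N y :: real
  assumes "V > 0" "V1\<^sup>2 + W1\<^sup>2 = V\<^sup>2 / y\<^sup>2" "V2 + W2 = 0" "N1\<^sup>2 + M1\<^sup>2 = (N\<^sup>2 - 1) / y\<^sup>2" "N2 + M2 = 2 * N / y\<^sup>2"
  shows "barr2 s a c \<epsilon> V V1 V2 N N1 N2 + barr2 s a c \<epsilon> V W1 W2 N M1 M2
      + 2 * s * (V1 / V * barr1 s a c \<epsilon> V V1 N N1 + W1 / V * barr1 s a c \<epsilon> V W1 N M1)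
    = c * (V powr (-s)) * ((N\<^sup>2 - 1) * radial'' s a N + 2 * N * radial' s a N - s * (s - 1) * radial s a N) / y\<^sup>2"
proof -
  define X W b b1 b2 where "X = c * (V powr (-s))" and "W = \<epsilon> * (1 - 2 * s) * V powr (1 - 2 * s)" and "b = radial s a N"
    and "b1 = radial' s a N" and "b2 = radial'' s a N"
  define p q where "p = V1 / V" and "q = W1 / V"
  have pq: "p\<^sup>2 + q\<^sup>2 = 1 / y\<^sup>2"
  proof -
    have "p\<^sup>2 + q\<^sup>2 = (V1\<^sup>2 + W1\<^sup>2) / V\<^sup>2" by (simp add: p_def q_def power_divide add_divide_distrib)
    then show ?thesis using assms(1,2) by simp
  qed
  have h: "V2 / V + W2 / V = 0" using assms(3) by (simp flip: add_divide_distrib)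
  have "barr2 s a c \<epsilon> V V1 V2 N N1 N2 + barr2 s a c \<epsilon> V W1 W2 N M1 M2
      + 2 * s * (V1 / V * barr1 s a c \<epsilon> V V1 N N1 + W1 / V * barr1 s a c \<epsilon> V W1 N M1)
    = X * ((s * (s+1) - 2 * s * s) * b * (p\<^sup>2 + q\<^sup>2) - s * b * (V2 / V + W2 / V) + b2 * (N1\<^sup>2 + M1\<^sup>2) + b1 * (N2 + M2))
      - W * (V2 / V + W2 / V)"
    unfolding barr2_def barr1_def X_def[symmetric] W_def[symmetric] b_def[symmetric] b1_def[symmetric] b2_def[symmetric]
      p_def[symmetric] q_def[symmetric]
    by (simp add: algebra_simps power2_eq_square)
  also have "\<dots> = X * ((N\<^sup>2 - 1) * b2 + 2 * N * b1 - s * (s - 1) * b) / y\<^sup>2"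
    unfolding pq h assms(4,5) by (simp add: algebra_simps add_divide_distrib diff_divide_distrib)
  finally show ?thesis unfolding X_def b_def b1_def b2_def .
qed

section \<open>Size, support and gradient of the barrier\<close>

lemma height_coshd_product:
  assumes "y > 0" "y0 > 0"
  shows "2 * height x0 y0 * height x y * coshd x0 y0 x y = ((x - x0)\<^sup>2 + y\<^sup>2 + y0\<^sup>2) / ((x\<^sup>2 + y\<^sup>2) * (x0\<^sup>2 + y0\<^sup>2))"
  using assms by (simp add: height_def coshd_def)

text \<open>In the coordinate \<open>w = -1/z\<close> the product equals
  \<open>(Re w - Re w0)^2 + (Im w)^2 + (Im w0)^2\<close>, which visibly dominates the squares of
  both heights. The sums of squares in the proof are this identity with cleared
  denominators.\<close>

lemma product_ge_height:
  assumes "y > 0" "y0 > 0"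
  shows "2 * height x0 y0 * height x y * coshd x0 y0 x y \<ge> (height x0 y0)\<^sup>2"
    "2 * height x0 y0 * height x y * coshd x0 y0 x y \<ge> (height x y)\<^sup>2"
proof -
  define r r0 where "r = x\<^sup>2 + y\<^sup>2" and "r0 = x0\<^sup>2 + y0\<^sup>2"
  have r: "r > 0" "r0 > 0" using assms norm2_pos by (auto simp: r_def r0_def)
  define Q where "Q = (x - x0)\<^sup>2 + y\<^sup>2 + y0\<^sup>2"
  have "Q * r0 - y0\<^sup>2 * r = ((x - x0) * x0 - y0\<^sup>2)\<^sup>2 + y\<^sup>2 * x0\<^sup>2"
    by (simp add: Q_def r_def r0_def power2_eq_square algebra_simps)
  then have 1: "y0\<^sup>2 * r \<le> Q * r0" by (metis add_nonneg_nonneg diff_ge_0_iff_ge zero_le_power2 mult_nonneg_nonneg)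
  have "Q * r - y\<^sup>2 * r0 = ((x0 - x) * x - y\<^sup>2)\<^sup>2 + y0\<^sup>2 * x\<^sup>2"
    by (simp add: Q_def r_def r0_def power2_eq_square algebra_simps)
  then have 2: "y\<^sup>2 * r0 \<le> Q * r" by (metis add_nonneg_nonneg diff_ge_0_iff_ge zero_le_power2 mult_nonneg_nonneg)
  have "(height x0 y0)\<^sup>2 = y0\<^sup>2 / r0\<^sup>2" by (simp add: height_def r0_def power_divide)
  also have "\<dots> = (y0\<^sup>2 * r) / (r * r0 * r0)" using r by (simp add: power2_eq_square)
  also have "\<dots> \<le> (Q * r0) / (r * r0 * r0)" using 1 r by (intro divide_right_mono) auto
  also have "\<dots> = Q / (r * r0)" using r by simp
  finally show "2 * height x0 y0 * height x y * coshd x0 y0 x y \<ge> (height x0 y0)\<^sup>2"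
    unfolding height_coshd_product[OF assms] by (simp add: Q_def r_def r0_def)
  have "(height x y)\<^sup>2 = y\<^sup>2 / r\<^sup>2" by (simp add: height_def r_def power_divide)
  also have "\<dots> = (y\<^sup>2 * r0) / (r * r0 * r)" using r by (simp add: power2_eq_square)
  also have "\<dots> \<le> (Q * r) / (r * r0 * r)" using 2 r by (intro divide_right_mono) auto
  also have "\<dots> = Q / (r * r0)" using r by simp
  finally show "2 * height x0 y0 * height x y * coshd x0 y0 x y \<ge> (height x y)\<^sup>2"
    unfolding height_coshd_product[OF assms] by (simp add: Q_def r_def r0_def)
qed

text \<open>From \<open>ln (1 + 1/r) \<le> 1/r\<close>. It is used with \<open>r \<ge> a\<close>
  everywhere and with \<open>r \<ge> 1\<close> away from the pole, where the bound does not depend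
  on \<open>a\<close>.\<close>

lemma radial_corr_le:
  assumes "N \<ge> 1" "a > 0" "s > 0"
  shows "radial_corr s a N \<le> 1 + radial_delta s / (N\<^sup>2 - 1 + a)"
proof -
  note p = radial_rho_pos[OF assms(1,2)]
  define r where "r = N\<^sup>2 - 1 + a"
  have r: "r > 0" "N\<^sup>2 + a = r + 1" using p by (auto simp: r_def)
  have "ln (N\<^sup>2 + a) - ln (N\<^sup>2 - 1 + a) = ln ((r + 1) / r)" unfolding r_def[symmetric] r(2) using r(1) by (simp add: ln_div)
  also have "(r + 1) / r = 1 + 1 / r" using r(1) by (simp add: field_simps)
  also have "ln (1 + 1 / r) \<le> 1 / r" using r(1) by (intro ln_add_one_self_le_self) simp
  finally have "ln (N\<^sup>2 + a) - ln (N\<^sup>2 - 1 + a) \<le> 1 / r" .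
  moreover have "radial_delta s \<ge> 0" using assms by (simp add: radial_delta_def)
  ultimately have "radial_delta s * (ln (N\<^sup>2 + a) - ln (N\<^sup>2 - 1 + a)) \<le> radial_delta s * (1 / r)" by (rule mult_left_mono)
  then show ?thesis by (simp add: radial_corr_def r_def)
qed

text \<open>The pole is \<open>(x0, y0)\<close>; \<open>a\<close> is the width on which the source
  at the pole is spread out, \<tau> scales the main part, and \<epsilon> weights the term that
  pushes the barrier below 0 at the real axis.\<close>

locale barrier =
  fixes s a \<epsilon> \<tau> x0 y0 :: real
  assumes s: "s > 1/2" and a: "0 < a" "a \<le> 1" and \<epsilon>: "\<epsilon> > 0" and \<tau>: "\<tau> > 0" and y0: "y0 > 0"
begin

abbreviation "V \<equiv> height"
abbreviation "N \<equiv> coshd x0 y0"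
definition "v0 = height x0 y0"
definition "\<delta> = radial_delta s"
definition "c = \<tau> * (2 * v0) powr (-s)"
definition "T x y = 2 * v0 * V x y * N x y"
definition "\<kappa> x y = \<tau> * T x y powr (-s)"
definition "e x y = \<epsilon> * V x y powr (1 - 2 * s)"
definition "B x y = radial_corr s a (N x y)"
definition "f x y = barr s a c \<epsilon> (V x y) (N x y)"
definition "fx x y = barr1 s a c \<epsilon> (V x y) (height_x x y) (N x y) (coshd_x x0 y0 x y)"
definition "fy x y = barr1 s a c \<epsilon> (V x y) (height_y x y) (N x y) (coshd_y x0 y0 x y)"
definition "fxx x y = barr2 s a c \<epsilon> (V x y) (height_x x y) (height_xx x y) (N x y) (coshd_x x0 y0 x y) (coshd_xx y0 y)"
definition "fyy x y = barr2 s a c \<epsilon> (V x y) (height_y x y) (height_yy x y) (N x y) (coshd_y x0 y0 x y) (coshd_yy x0 y0 x y)"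
definition "P x y = fxx x y + fyy x y + 2 * s * (height_x x y / V x y * fx x y + height_y x y / V x y * fy x y)"

lemma v0: "v0 > 0" using height_pos[OF y0] by (simp add: v0_def)
lemma \<delta>: "\<delta> > 0" using s by (simp add: \<delta>_def radial_delta_def)

lemma pos: assumes "y > 0"
  shows "V x y > 0" "N x y \<ge> 1" "T x y > 0" "\<kappa> x y > 0" "e x y > 0" "B x y \<ge> 1"
proof -
  show V: "V x y > 0" using height_pos[OF assms] .
  show N: "N x y \<ge> 1" using coshd_ge_1[OF assms y0] .
  show T: "T x y > 0" using V N v0 by (simp add: T_def)
  show "\<kappa> x y > 0" using T \<tau> by (simp add: \<kappa>_def)
  show "e x y > 0" using V \<epsilon> by (simp add: e_def)
  show "B x y \<ge> 1" using radial_corr_ge_1[OF N a(1)] s by (simp add: B_def)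
qed

lemma \<kappa>_eq: assumes "y > 0" shows "c * V x y powr (-s) * N x y powr (-s) = \<kappa> x y"
  using pos[OF assms, of x] v0 by (simp add: c_def \<kappa>_def T_def powr_mult mult_ac)

lemma f_eq: assumes "y > 0" shows "f x y = \<kappa> x y * B x y - 1 - e x y"
  unfolding f_def barr_def radial_def \<kappa>_eq[OF assms, symmetric] B_def e_def by simp

lemma T_ge: assumes "y > 0" shows "T x y \<ge> v0\<^sup>2" "T x y \<ge> (V x y)\<^sup>2"
  using product_ge_height[OF assms y0] by (simp_all add: T_def v0_def)

lemma \<kappa>_le: assumes "y > 0" shows "\<kappa> x y \<le> \<tau> * (v0\<^sup>2) powr (-s)"
  unfolding \<kappa>_def using T_ge[OF assms, of x] v0 \<tau> s by (intro mult_left_mono powr_mono2') auto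

lemma C2_f: "C2_on upper f fx fy fxx fyy"
  unfolding C2_on_def
proof (intro conjI)
  have c: "continuous_on upper (\<lambda>p. height (fst p) (snd p))" "continuous_on upper (\<lambda>p. height_x (fst p) (snd p))"
    "continuous_on upper (\<lambda>p. height_y (fst p) (snd p))" "continuous_on upper (\<lambda>p. height_xx (fst p) (snd p))"
    "continuous_on upper (\<lambda>p. height_yy (fst p) (snd p))"
    using C2_height unfolding C2_on_def case_prod_beta by auto
  have d: "continuous_on upper (\<lambda>p. N (fst p) (snd p))" "continuous_on upper (\<lambda>p. coshd_x x0 y0 (fst p) (snd p))"
    "continuous_on upper (\<lambda>p. coshd_y x0 y0 (fst p) (snd p))" "continuous_on upper (\<lambda>p. coshd_xx y0 (snd p))"
    "continuous_on upper (\<lambda>p. coshd_yy x0 y0 (fst p) (snd p))"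
    using C2_coshd[OF y0] unfolding C2_on_def case_prod_beta by auto
  have p: "height (fst p) (snd p) \<noteq> 0" if "p \<in> upper" for p using that height_pos[of "snd p" "fst p"] by simp
  have r: "continuous_on {1..} (radial s a)" "continuous_on {1..} (radial' s a)"
    using DERIV_radial[OF _ a(1)] by (auto intro!: continuous_at_imp_continuous_on DERIV_isCont)
  have rc: "continuous_on {1..} (radial_corr s a)" "continuous_on {1..} (radial_corr' s a)"
    using DERIV_radial_corr[OF _ a(1)] by (auto intro!: continuous_at_imp_continuous_on DERIV_isCont)
  have r'': "continuous_on {1..} (radial'' s a)"
  proof -
    have nz: "k \<noteq> 0" "k\<^sup>2 + a \<noteq> 0" "k\<^sup>2 - 1 + a \<noteq> 0" if "k \<in> {1..}" for k
      using radial_rho_pos[OF _ a(1), of k] that by auto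
    have "continuous_on {1..} (radial_corr'' s a)"
      unfolding radial_corr''_def by (intro continuous_intros ballI) (auto simp: nz)
    then show ?thesis unfolding radial''_def by (intro continuous_intros rc ballI) (auto simp: nz)
  qed
  have N1: "(\<lambda>p. N (fst p) (snd p)) ` upper \<subseteq> {1..}" using coshd_ge_1[OF _ y0] by auto
  have R: "continuous_on upper (\<lambda>p. radial s a (N (fst p) (snd p)))" "continuous_on upper (\<lambda>p. radial' s a (N (fst p) (snd p)))"
    "continuous_on upper (\<lambda>p. radial'' s a (N (fst p) (snd p)))"
    by (rule continuous_on_compose2[OF r(1) d(1) N1] continuous_on_compose2[OF r(2) d(1) N1] continuous_on_compose2[OF r'' d(1) N1])+
  show "continuous_on upper (case_prod f)" "continuous_on upper (case_prod fx)" "continuous_on upper (case_prod fy)"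
    "continuous_on upper (case_prod fxx)" "continuous_on upper (case_prod fyy)"
    unfolding case_prod_beta f_def fx_def fy_def fxx_def fyy_def barr_def barr1_def barr2_def
    by (intro continuous_intros c d R ballI p; assumption)+
  show "\<forall>(x, y)\<in>upper. ((\<lambda>t. f t y) has_real_derivative fx x y) (at x) \<and>
    ((\<lambda>t. f x t) has_real_derivative fy x y) (at y) \<and>
    ((\<lambda>t. fx t y) has_real_derivative fxx x y) (at x) \<and>
    ((\<lambda>t. fy x t) has_real_derivative fyy x y) (at y)"
  proof (intro ballI, clarsimp, intro conjI)
    fix x y :: real assume y: "0 < y"
    then have u: "(x,y) \<in> upper" by simp
    note h = C2_onD[OF C2_height u] and n = C2_onD[OF C2_coshd[OF y0] u] and q = pos(1,2)[OF y, of x]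
    show "((\<lambda>t. f t y) has_real_derivative fx x y) (at x)" "((\<lambda>t. fx t y) has_real_derivative fxx x y) (at x)"
      unfolding f_def fx_def fxx_def
      using DERIV_barr[of "\<lambda>t. height t y" "\<lambda>t. height_x t y" x _ "\<lambda>t. N t y" "\<lambda>t. coshd_x x0 y0 t y", OF h(1,3) q(1) n(1,3) q(2) a(1)]
      by blast+
    show "((\<lambda>t. f x t) has_real_derivative fy x y) (at y)" "((\<lambda>t. fy x t) has_real_derivative fyy x y) (at y)"
      unfolding f_def fy_def fyy_def
      using DERIV_barr[of "\<lambda>t. height x t" "\<lambda>t. height_y x t" y _ "\<lambda>t. N x t" "\<lambda>t. coshd_y x0 y0 x t", OF h(2,4) q(1) n(2,4) q(2) a(1)]
      by blast+
  qed
qed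

lemma P_le:
  assumes y: "y > 0"
  shows "P x y \<le> - (\<kappa> x y * (2 * \<delta> * a / ((N x y)\<^sup>2 - 1 + a)\<^sup>2)) / y\<^sup>2"
proof -
  have "P x y = c * (V x y powr (-s)) * (((N x y)\<^sup>2 - 1) * radial'' s a (N x y) + 2 * N x y * radial' s a (N x y) - s * (s - 1) * radial s a (N x y)) / y\<^sup>2"
    unfolding P_def fx_def fy_def fxx_def fyy_def
    by (rule barr_operator[OF pos(1)[OF y] height_sums[OF y] coshd_sums[OF y y0]])
  also have "\<dots> \<le> c * (V x y powr (-s)) * (- (N x y powr (-s) * (2 * radial_delta s * a / ((N x y)\<^sup>2 - 1 + a)\<^sup>2))) / y\<^sup>2"
    using radial_supersolution[OF pos(2)[OF y] a(1), of s] s \<tau> by (intro divide_right_mono mult_left_mono) (auto simp: c_def)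
  also have "\<dots> = - (\<kappa> x y * (2 * \<delta> * a / ((N x y)\<^sup>2 - 1 + a)\<^sup>2)) / y\<^sup>2"
    unfolding \<kappa>_eq[OF y, symmetric] \<delta>_def by simp
  finally show ?thesis .
qed

lemma P_nonpos: assumes y: "y > 0" shows "P x y \<le> 0"
proof -
  have "0 \<le> \<kappa> x y * (2 * \<delta> * a / ((N x y)\<^sup>2 - 1 + a)\<^sup>2)" using pos[OF y, of x] a \<delta> by (intro mult_nonneg_nonneg divide_nonneg_nonneg) auto
  then have "- (\<kappa> x y * (2 * \<delta> * a / ((N x y)\<^sup>2 - 1 + a)\<^sup>2)) / y\<^sup>2 \<le> 0" by (intro divide_nonpos_nonneg) auto
  then show ?thesis using P_le[OF y, of x] by linarith
qed

text \<open>What \<open>gradient_le\<close> collects: \<open>3 * 2 * (8 \<delta>^2 + 3 s^2)\<close>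
  from the terms comparable to \<open>\<kappa> B\<close>, and \<open>3 * 4 s^2\<close> from the
  \<epsilon> term.\<close>

definition "C3 = 48 * \<delta>\<^sup>2 + 30 * s\<^sup>2"

text \<open>Powers of V and of N have hyperbolic gradients comparable to their values, so it
  suffices to bound values: \<open>f < 2\<close> gives
  \<open>\<kappa> B = f + 1 + e < 3 + e\<close>. The condition on N stays away from the pole, where
  the logarithmic term becomes steep for small \<open>a\<close>.\<close>

lemma gradient_le:
  assumes y: "y > 0" and N2: "(N x y)\<^sup>2 \<ge> 2" and f: "f x y > 0" "f x y < 2"
  shows "y\<^sup>2 * ((fx x y)\<^sup>2 + (fy x y)\<^sup>2) \<le> C3 * (9 + (e x y)\<^sup>2)"
proof -
  define n k b E X where "n = N x y" and "k = \<kappa> x y" and "b = B x y" and "E = e x y" and "X = c * V x y powr (-s)"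
  define p q where "p = height_x x y / V x y" and "q = height_y x y / V x y"
  note ps = pos[OF y, of x]
  have kb: "k * b = f x y + 1 + E" using f_eq[OF y, of x] by (simp add: k_def b_def E_def)
  have kb3: "0 \<le> k * b" "k * b \<le> 3 + E" using kb f ps by (auto simp: E_def)
  have "(k * b)\<^sup>2 \<le> (3 + E)\<^sup>2" using kb3 by (intro power_mono) auto
  also have "\<dots> \<le> 2 * (9 + E\<^sup>2)" using zero_le_power2[of "3 - E"] by (simp add: power2_eq_square algebra_simps)
  finally have kb2: "(k * b)\<^sup>2 \<le> 2 * (9 + E\<^sup>2)" .
  have pq: "p\<^sup>2 + q\<^sup>2 = 1 / y\<^sup>2"
    using height_sums(1)[OF y, of x] ps(1) by (simp add: p_def q_def power_divide flip: add_divide_distrib)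
  have nn: "(coshd_x x0 y0 x y)\<^sup>2 + (coshd_y x0 y0 x y)\<^sup>2 = (n\<^sup>2 - 1) / y\<^sup>2" using coshd_sums(1)[OF y y0] by (simp add: n_def)
  have three: "(u + v + w)\<^sup>2 \<le> 3 * (u\<^sup>2 + v\<^sup>2 + w\<^sup>2)" for u v w :: real
  proof -
    have "3 * (u\<^sup>2 + v\<^sup>2 + w\<^sup>2) - (u + v + w)\<^sup>2 = (u - v)\<^sup>2 + (v - w)\<^sup>2 + (u - w)\<^sup>2"
      by (simp add: power2_eq_square algebra_simps)
    then show ?thesis by (smt (verit) zero_le_power2)
  qed
  define d where "d = radial' s a n"
  have Xb: "X * radial s a n = k * b"
    using \<kappa>_eq[OF y, of x] by (simp add: X_def n_def k_def b_def B_def radial_def mult.assoc)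
  have fx: "fx x y = X * d * coshd_x x0 y0 x y + (- s * (k * b)) * p + (2 * s - 1) * E * p"
    unfolding fx_def barr1_def X_def[symmetric] p_def[symmetric] n_def[symmetric] d_def[symmetric] E_def e_def Xb[symmetric]
    by (simp add: algebra_simps)
  have fy: "fy x y = X * d * coshd_y x0 y0 x y + (- s * (k * b)) * q + (2 * s - 1) * E * q"
    unfolding fy_def barr1_def X_def[symmetric] q_def[symmetric] n_def[symmetric] d_def[symmetric] E_def e_def Xb[symmetric]
    by (simp add: algebra_simps)
  have "(fx x y)\<^sup>2 + (fy x y)\<^sup>2 \<le> 3 * ((X * d * coshd_x x0 y0 x y)\<^sup>2 + ((- s * (k * b)) * p)\<^sup>2 + ((2 * s - 1) * E * p)\<^sup>2)
     + 3 * ((X * d * coshd_y x0 y0 x y)\<^sup>2 + ((- s * (k * b)) * q)\<^sup>2 + ((2 * s - 1) * E * q)\<^sup>2)"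
    unfolding fx fy by (intro add_mono three)
  also have "\<dots> = 3 * ((X * d)\<^sup>2 * ((coshd_x x0 y0 x y)\<^sup>2 + (coshd_y x0 y0 x y)\<^sup>2) + (s * (k * b))\<^sup>2 * (p\<^sup>2 + q\<^sup>2) + ((2 * s - 1) * E)\<^sup>2 * (p\<^sup>2 + q\<^sup>2))"
  proof -
    have "3 * ((\<alpha> * c1)\<^sup>2 + (- \<beta> * p)\<^sup>2 + (\<gamma> * p)\<^sup>2) + 3 * ((\<alpha> * c2)\<^sup>2 + (- \<beta> * q)\<^sup>2 + (\<gamma> * q)\<^sup>2)
      = 3 * (\<alpha>\<^sup>2 * (c1\<^sup>2 + c2\<^sup>2) + \<beta>\<^sup>2 * (p\<^sup>2 + q\<^sup>2) + \<gamma>\<^sup>2 * (p\<^sup>2 + q\<^sup>2))" for \<alpha> \<beta> \<gamma> c1 c2 :: real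
      by (simp add: power_mult_distrib algebra_simps)
    from this[of "X * d" "coshd_x x0 y0 x y" "s * (k * b)" "(2 * s - 1) * E" "coshd_y x0 y0 x y"]
    show ?thesis by simp
  qed
  also have "\<dots> = 3 * ((X * d)\<^sup>2 * (n\<^sup>2 - 1) + (s * (k * b))\<^sup>2 + ((2 * s - 1) * E)\<^sup>2) / y\<^sup>2"
    unfolding pq nn by (simp add: add_divide_distrib)
  finally have "y\<^sup>2 * ((fx x y)\<^sup>2 + (fy x y)\<^sup>2) \<le> y\<^sup>2 * (3 * ((X * d)\<^sup>2 * (n\<^sup>2 - 1) + (s * (k * b))\<^sup>2 + ((2 * s - 1) * E)\<^sup>2) / y\<^sup>2)"
    by (intro mult_left_mono) auto
  also have "\<dots> = 3 * ((X * d)\<^sup>2 * (n\<^sup>2 - 1) + (s * (k * b))\<^sup>2 + ((2 * s - 1) * E)\<^sup>2)" using y by simp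
  finally have 1: "y\<^sup>2 * ((fx x y)\<^sup>2 + (fy x y)\<^sup>2) \<le> 3 * ((X * d)\<^sup>2 * (n\<^sup>2 - 1) + (s * (k * b))\<^sup>2 + ((2 * s - 1) * E)\<^sup>2)" .
  have n: "n \<ge> 1" "n\<^sup>2 \<ge> 2" using ps(2) N2 by (auto simp: n_def)
  have 2: "(X * d)\<^sup>2 * (n\<^sup>2 - 1) \<le> 2 * (4 * \<delta>\<^sup>2 + s\<^sup>2) * (k * b)\<^sup>2"
  proof -
    define w where "w = n * radial_corr' s a n"
    have w: "\<bar>w\<bar> \<le> 2 * \<delta> * b"
    proof -
      define r where "r = n\<^sup>2 - 1 + a"
      have r: "r \<ge> 1" "n\<^sup>2 + a = r + 1" "n\<^sup>2 \<le> r + 1" using n(2) a by (auto simp: r_def)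
      have "w = \<delta> * (2 * n\<^sup>2 * (1 / (r+1) - 1 / r))"
        unfolding w_def radial_corr'_def \<delta>_def[symmetric] r(2) r_def[symmetric] by (simp add: algebra_simps power2_eq_square)
      also have "1 / (r+1) - 1 / r = - 1 / (r * (r+1))" using r(1) by (simp add: field_simps)
      finally have "\<bar>w\<bar> = 2 * \<delta> * (n\<^sup>2 / (r * (r+1)))" using r(1) \<delta> by (simp add: abs_mult)
      also have "\<dots> \<le> 2 * \<delta> * 1"
      proof (intro mult_left_mono)
        have "n\<^sup>2 \<le> 1 * (r+1)" using r by simp
        also have "\<dots> \<le> r * (r+1)" using r(1) by (intro mult_right_mono) auto
        finally show "n\<^sup>2 / (r * (r+1)) \<le> 1" using r(1) by (simp add: divide_le_eq)
      qed (use \<delta> in simp)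
      also have "\<dots> \<le> 2 * \<delta> * b" using ps(6) \<delta> by (intro mult_left_mono) (auto simp: b_def)
      finally show ?thesis .
    qed
    have bb: "radial_corr s a n = b" by (simp add: b_def B_def n_def)
    have "X * d * n = k * (w - s * b)"
      using \<kappa>_eq[OF y, of x] n unfolding d_def radial'_def bb w_def X_def k_def n_def[symmetric]
      by (simp add: algebra_simps)
    then have e1: "(X * d)\<^sup>2 * n\<^sup>2 = k\<^sup>2 * (w - s * b)\<^sup>2" by (metis power_mult_distrib)
    have "(X * d)\<^sup>2 * (n\<^sup>2 - 1) \<le> (X * d)\<^sup>2 * n\<^sup>2" by (intro mult_left_mono) auto
    also have "\<dots> \<le> k\<^sup>2 * (2 * (w\<^sup>2 + (s * b)\<^sup>2))"
      unfolding e1 using zero_le_power2[of "w + s * b"]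
      by (intro mult_left_mono) (auto simp: power2_eq_square algebra_simps)
    also have "\<dots> \<le> k\<^sup>2 * (2 * ((2 * \<delta> * b)\<^sup>2 + (s * b)\<^sup>2))"
      using power_mono[OF w, of 2] by (intro mult_left_mono add_right_mono) auto
    also have "\<dots> = 2 * (4 * \<delta>\<^sup>2 + s\<^sup>2) * (k * b)\<^sup>2" by (simp add: power_mult_distrib algebra_simps)
    finally show ?thesis .
  qed
  have 3: "((2 * s - 1) * E)\<^sup>2 \<le> 4 * s\<^sup>2 * (9 + E\<^sup>2)"
  proof -
    have "(2 * s - 1)\<^sup>2 \<le> (2 * s)\<^sup>2" using s by (intro power_mono) auto
    then have "(2 * s - 1)\<^sup>2 * E\<^sup>2 \<le> (4 * s\<^sup>2) * (9 + E\<^sup>2)" by (intro mult_mono) (auto simp: power_mult_distrib)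
    then show ?thesis by (simp add: power_mult_distrib)
  qed
  have "3 * ((X * d)\<^sup>2 * (n\<^sup>2 - 1) + (s * (k * b))\<^sup>2 + ((2 * s - 1) * E)\<^sup>2)
     \<le> 3 * ((8 * \<delta>\<^sup>2 + 3 * s\<^sup>2) * (k * b)\<^sup>2 + 4 * s\<^sup>2 * (9 + E\<^sup>2))"
    using 2 3 by (simp add: power_mult_distrib algebra_simps)
  also have "\<dots> \<le> 3 * ((8 * \<delta>\<^sup>2 + 3 * s\<^sup>2) * (2 * (9 + E\<^sup>2)) + 4 * s\<^sup>2 * (9 + E\<^sup>2))"
    using kb2 by (intro mult_left_mono add_right_mono) auto
  also have "\<dots> = C3 * (9 + E\<^sup>2)" by (simp add: C3_def algebra_simps)
  finally show ?thesis using 1 by (simp add: E_def)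
qed

text \<open>The exponent \<open>1 - 2 s\<close> is negative and \<open>\<kappa> B\<close> is
  bounded, so positivity of \<open>f\<close> bounds V from below. This confines z to a disc tangent
  to the real axis at 0, hence to bounded x and y. Positivity also bounds T from above, which keeps
  z away from 0, the only boundary point in the closure of that disc.\<close>

lemma support_bounded:
  shows "\<exists>M m. m > 0 \<and> (\<forall>x y. y > 0 \<longrightarrow> f x y > 0 \<longrightarrow> \<bar>x\<bar> < M \<and> m < y \<and> y < M)"
proof -
  define Bm where "Bm = 1 + \<delta> / a"
  have Bm: "Bm > 0" using \<delta> a by (simp add: Bm_def add_pos_nonneg)
  define K1 where "K1 = \<tau> * (v0\<^sup>2) powr (-s) * Bm"
  have K1: "K1 > 0" using \<tau> v0 Bm by (simp add: K1_def)
  define Vm where "Vm = (K1 / \<epsilon>) powr (1 / (1 - 2 * s))"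
  have Vm: "Vm > 0" using K1 \<epsilon> by (simp add: Vm_def)
  define t1 where "t1 = (\<tau> * Bm) powr (1 / s)"
  have t1: "t1 > 0" using \<tau> Bm by (simp add: t1_def)
  define r0 where "r0 = x0\<^sup>2 + y0\<^sup>2"
  have r0: "r0 > 0" using norm2_pos[OF y0] by (simp add: r0_def)
  define m where "m = Vm * (y0\<^sup>2 / (t1 * r0))"
  have m: "m > 0" using Vm t1 r0 y0 by (simp add: m_def)
  have "\<bar>x\<bar> < 1 / Vm \<and> m < y \<and> y < 1 / Vm" if y: "y > 0" and fp: "f x y > 0" for x y
  proof -
    note ps = pos[OF y, of x]
    have "B x y \<le> 1 + radial_delta s / ((N x y)\<^sup>2 - 1 + a)" unfolding B_def using ps(2) a s by (intro radial_corr_le) auto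
    also have "\<dots> \<le> Bm" unfolding Bm_def \<delta>_def[symmetric] using ps(2) a \<delta> radial_rho_pos[OF ps(2) a(1)]
      by (intro add_left_mono divide_left_mono) auto
    finally have B: "B x y \<le> Bm" .
    have kB: "\<kappa> x y * B x y > 1 + e x y" using f_eq[OF y, of x] fp by simp
    have "\<kappa> x y * B x y \<le> \<kappa> x y * Bm" using ps B by (intro mult_left_mono) auto
    then have kBm: "\<kappa> x y * Bm > 1 + e x y" using kB by simp
    have "\<kappa> x y * Bm \<le> K1" unfolding K1_def using \<kappa>_le[OF y, of x] Bm by (intro mult_right_mono) auto
    then have e1: "V x y powr (1 - 2 * s) < K1 / \<epsilon>"
      using kBm \<epsilon> by (simp add: e_def pos_less_divide_eq mult.commute)
    have VV: "Vm < V x y"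
    proof (rule ccontr)
      assume "\<not> Vm < V x y"
      then have "Vm powr (1 - 2 * s) \<le> V x y powr (1 - 2 * s)" using ps(1) s by (intro powr_mono2') auto
      moreover have "Vm powr (1 - 2 * s) = K1 / \<epsilon>" using s K1 \<epsilon> by (simp add: Vm_def powr_powr)
      ultimately show False using e1 by simp
    qed
    have T1: "T x y < t1"
    proof (rule ccontr)
      assume "\<not> T x y < t1"
      then have "T x y powr (-s) \<le> t1 powr (-s)" using t1 s by (intro powr_mono2') auto
      also have "t1 powr (-s) = 1 / (\<tau> * Bm)" using s \<tau> Bm by (simp add: t1_def powr_powr powr_minus_divide)
      finally have "\<kappa> x y * Bm \<le> \<tau> * (1 / (\<tau> * Bm)) * Bm" unfolding \<kappa>_def using \<tau> Bm by (intro mult_right_mono mult_left_mono) auto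
      also have "\<dots> = 1" using \<tau> Bm by simp
      finally show False using kBm ps(5) by simp
    qed
    define r where "r = x\<^sup>2 + y\<^sup>2"
    have r: "r > 0" "y\<^sup>2 \<le> r" "x\<^sup>2 \<le> r" using norm2_pos[OF y] by (auto simp: r_def)
    have yr: "Vm * r < y" using VV r(1) by (simp add: height_def r_def pos_less_divide_eq)
    have "(Vm * r)\<^sup>2 < y\<^sup>2" using yr Vm r(1) by (intro power_strict_mono) auto
    then have "Vm\<^sup>2 * r * r < 1 * r" using r(2) by (simp add: power2_eq_square mult_ac)
    then have "Vm\<^sup>2 * r < 1" using r(1) by (simp only: mult_less_cancel_right_pos)
    then have "r < (1 / Vm)\<^sup>2" using Vm by (simp add: power_divide pos_less_divide_eq mult.commute)
    then have xy: "\<bar>x\<bar> < 1 / Vm" "\<bar>y\<bar> < 1 / Vm"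
      using r(2,3) Vm by (auto intro!: power2_less_imp_less[of _ "1 / Vm"])
    have "y0\<^sup>2 / (r * r0) \<le> T x y"
    proof -
      have "y0\<^sup>2 / (r * r0) \<le> ((x - x0)\<^sup>2 + y\<^sup>2 + y0\<^sup>2) / (r * r0)" using r r0 by (intro divide_right_mono) auto
      then show ?thesis using height_coshd_product[OF y y0, of x0 x] by (simp add: T_def v0_def r_def r0_def)
    qed
    then have "y0\<^sup>2 / (r * r0) < t1" using T1 by simp
    then have "y0\<^sup>2 / (t1 * r0) < r" using r r0 t1 by (simp add: pos_divide_less_eq mult_ac)
    then have "m < Vm * r" unfolding m_def using Vm by (intro mult_strict_left_mono) auto
    then show ?thesis using xy yr by auto
  qed
  then show ?thesis using m by blast
qed

end

lemma C2_on_subset: "C2_on S f fx fy fxx fyy \<Longrightarrow> T \<subseteq> S \<Longrightarrow> C2_on T f fx fy fxx fyy"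
  unfolding C2_on_def by (blast intro: continuous_on_subset)

context barrier begin

text \<open>Here \<open>N < 3/2\<close>, so V and v0 differ at most by a factor 3; then \<kappa> is
  at least 4 and \<open>e\<close> at most 1, whence \<open>f \<ge> 4 - 1 - 1\<close>. The steep part
  of the barrier thus lies in the range where \<open>cutoff''\<close> is nonpositive.\<close>

lemma near_center:
  assumes y: "y > 0" and N: "(N x y)\<^sup>2 < 2"
    and big: "\<tau> * (9 * v0\<^sup>2) powr (-s) \<ge> 4" and small: "\<epsilon> * (v0 / 3) powr (1 - 2 * s) \<le> 1"
  shows "\<kappa> x y \<ge> \<tau> * (9 * v0\<^sup>2) powr (-s)" "f x y \<ge> 2"
proof -
  note ps = pos[OF y, of x]
  have "(N x y)\<^sup>2 < (3/2)\<^sup>2" using N by (simp add: power_divide)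
  then have N32: "N x y < 3/2" by (rule power2_less_imp_less) simp
  have "V x y * V x y \<le> V x y * (2 * v0 * N x y)" using T_ge(2)[OF y, of x] by (simp add: T_def power2_eq_square mult_ac)
  then have "V x y \<le> 2 * v0 * N x y" using ps(1) by (simp only: mult_le_cancel_left_pos)
  also have "\<dots> \<le> 2 * v0 * (3/2)" using N32 v0 by (intro mult_left_mono) auto
  finally have V3: "V x y \<le> 3 * v0" by simp
  have "T x y \<le> 2 * v0 * (3 * v0) * (3/2)" unfolding T_def using V3 N32 v0 ps by (intro mult_mono) auto
  then have "T x y \<le> 9 * v0\<^sup>2" by (simp add: power2_eq_square)
  then show k: "\<kappa> x y \<ge> \<tau> * (9 * v0\<^sup>2) powr (-s)"
    unfolding \<kappa>_def using ps \<tau> s by (intro mult_left_mono powr_mono2') auto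
  have "v0 * v0 \<le> v0 * (2 * V x y * N x y)" using T_ge(1)[OF y, of x] by (simp add: T_def power2_eq_square mult_ac)
  then have "v0 \<le> 2 * V x y * N x y" using v0 by (simp only: mult_le_cancel_left_pos)
  also have "\<dots> \<le> 2 * V x y * (3/2)" using N32 ps by (intro mult_left_mono) auto
  finally have "v0 / 3 \<le> V x y" by simp
  then have "V x y powr (1 - 2 * s) \<le> (v0 / 3) powr (1 - 2 * s)" using v0 s by (intro powr_mono2') auto
  then have "e x y \<le> \<epsilon> * (v0 / 3) powr (1 - 2 * s)" unfolding e_def using \<epsilon> by (intro mult_left_mono) auto
  then have e: "e x y \<le> 1" using small by simp
  have "\<kappa> x y * 1 \<le> \<kappa> x y * B x y" using ps by (intro mult_left_mono) auto
  then show "f x y \<ge> 2" using f_eq[OF y, of x] k big e by linarith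
qed

text \<open>With \<open>w = -1/z\<close>: positivity of \<open>f\<close> forces
  \<open>T < 1 / (16 R^2)\<close>, so \<open>|w - w0| < 1 / (4 R)\<close>; since
  \<open>|w0| \<le> 1 / (2 R)\<close>, this gives \<open>|w| < 1 / R\<close>. The second bound does
  not involve \<epsilon> and becomes the majorant when \<epsilon> tends to 0.\<close>

lemma far_from_center:
  assumes y: "y > 0" and N: "(N x y)\<^sup>2 \<ge> 2" and f: "f x y > 0"
    and R: "R > 0" "x0\<^sup>2 + y0\<^sup>2 \<ge> (2 * R)\<^sup>2" "\<tau> * (1 + \<delta>) \<le> (1 / (16 * R\<^sup>2)) powr s"
  shows "x\<^sup>2 + y\<^sup>2 > R\<^sup>2" "e x y \<le> \<tau> * (1 + \<delta>) * (v0\<^sup>2) powr (-s)"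
proof -
  note ps = pos[OF y, of x]
  have "B x y \<le> 1 + radial_delta s / ((N x y)\<^sup>2 - 1 + a)" unfolding B_def using ps(2) a s by (intro radial_corr_le) auto
  also have "\<dots> \<le> 1 + \<delta> / 1" unfolding \<delta>_def[symmetric] using N a \<delta> by (intro add_left_mono divide_left_mono) auto
  finally have B: "B x y \<le> 1 + \<delta>" by simp
  have "\<kappa> x y * B x y \<le> \<kappa> x y * (1 + \<delta>)" using ps B by (intro mult_left_mono) auto
  then have kd: "\<kappa> x y * (1 + \<delta>) > 1 + e x y" using f_eq[OF y, of x] f by simp
  have "\<kappa> x y * (1 + \<delta>) \<le> \<tau> * (v0\<^sup>2) powr (-s) * (1 + \<delta>)" using \<kappa>_le[OF y, of x] \<delta> by (intro mult_right_mono) auto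
  then show "e x y \<le> \<tau> * (1 + \<delta>) * (v0\<^sup>2) powr (-s)" using kd by (simp add: mult_ac)
  define t0 where "t0 = 1 / (16 * R\<^sup>2)"
  have t0: "t0 > 0" using R(1) by (simp add: t0_def)
  have T: "T x y < t0"
  proof (rule ccontr)
    assume "\<not> T x y < t0"
    then have "T x y powr (-s) \<le> t0 powr (-s)" using t0 s by (intro powr_mono2') auto
    then have "\<tau> * (1 + \<delta>) * T x y powr (-s) \<le> t0 powr s * t0 powr (-s)"
      using R(3) \<tau> \<delta> unfolding t0_def[symmetric] by (intro mult_mono) auto
    also have "\<dots> = 1" using t0 by (simp flip: powr_add)
    finally show False using kd ps(5) by (simp add: \<kappa>_def mult_ac)
  qed
  show "x\<^sup>2 + y\<^sup>2 > R\<^sup>2"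
  proof (rule ccontr)
    assume "\<not> ?thesis"
    then have r: "x\<^sup>2 + y\<^sup>2 \<le> R\<^sup>2" by simp
    define z z0 where "z = Complex x y" and "z0 = Complex x0 y0"
    have r0: "(cmod z0)\<^sup>2 = x0\<^sup>2 + y0\<^sup>2" "(cmod z)\<^sup>2 = x\<^sup>2 + y\<^sup>2" by (simp_all add: z0_def z_def cmod_power2)
    have "(x - x0)\<^sup>2 + y\<^sup>2 + y0\<^sup>2 < t0 * ((x\<^sup>2 + y\<^sup>2) * (x0\<^sup>2 + y0\<^sup>2))"
      using T height_coshd_product[OF y y0, of x0 x] norm2_pos[OF y, of x] norm2_pos[OF y0, of x0]
      by (simp add: T_def v0_def pos_divide_less_eq)
    also have "\<dots> \<le> t0 * (R\<^sup>2 * (x0\<^sup>2 + y0\<^sup>2))" using r t0 by (intro mult_left_mono mult_right_mono) auto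
    also have "\<dots> = (cmod z0)\<^sup>2 / 16" using R(1) by (simp add: t0_def r0)
    finally have "(x - x0)\<^sup>2 + y\<^sup>2 + y0\<^sup>2 < (cmod z0)\<^sup>2 / 16" .
    moreover have "(cmod (z - z0))\<^sup>2 \<le> (x - x0)\<^sup>2 + y\<^sup>2 + y0\<^sup>2"
      using y y0 by (simp add: z_def z0_def cmod_power2 power2_diff)
    ultimately have "(cmod (z - z0))\<^sup>2 < (cmod z0 / 4)\<^sup>2" by (simp add: power_divide)
    then have 1: "cmod (z - z0) < cmod z0 / 4" by (rule power2_less_imp_less) simp
    have "(2 * R)\<^sup>2 \<le> (cmod z0)\<^sup>2" using R(2) r0 by simp
    then have 2: "2 * R \<le> cmod z0" by (rule power2_le_imp_le) simp
    have "(cmod z)\<^sup>2 \<le> R\<^sup>2" unfolding r0(2) by (rule r)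
    then have 3: "cmod z \<le> R" by (rule power2_le_imp_le) (rule less_imp_le[OF R(1)])
    have "cmod z0 \<le> cmod z + cmod (z - z0)" using norm_triangle_ineq4[of z "z - z0"] by simp
    then show False using 1 2 3 R(1) by linarith
  qed
qed

section \<open>The weighted operator on the truncated barrier\<close>

definition "J x y = cutoff' (f x y) * P x y + cutoff'' (f x y) * ((fx x y)\<^sup>2 + (fy x y)\<^sup>2)"

text \<open>The expression vanishes for \<open>f \<le> 0\<close>, and both its terms are nonpositive
  for \<open>f \<ge> 2\<close>. In between only the gradient term can be positive;
  \<open>gradient_le\<close> compares it with the hyperbolic density and
  \<open>far_from_center\<close> locates it. The minimum equals \<open>e\<close> there and caps the
  bound uniformly in \<epsilon>.\<close>

lemma J_le:
  assumes y: "y > 0"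
    and big: "\<tau> * (9 * v0\<^sup>2) powr (-s) \<ge> 4" and small: "\<epsilon> * (v0 / 3) powr (1 - 2 * s) \<le> 1"
    and R: "R > 0" "x0\<^sup>2 + y0\<^sup>2 \<ge> (2 * R)\<^sup>2" "\<tau> * (1 + \<delta>) \<le> (1 / (16 * R\<^sup>2)) powr s"
  shows "J x y \<le> (if x\<^sup>2 + y\<^sup>2 > R\<^sup>2 then 6 * C3 * (9 + (min (e x y) (\<tau> * (1 + \<delta>) * (v0\<^sup>2) powr (-s)))\<^sup>2) / y\<^sup>2 else 0)" (is "_ \<le> ?rhs")
proof -
  have C3: "C3 \<ge> 0" by (simp add: C3_def)
  have rhs: "0 \<le> ?rhs" using C3 by simp
  have JP: "cutoff' (f x y) * P x y \<le> 0" using cutoff'_nonneg P_nonpos[OF y] by (simp add: mult_nonneg_nonpos)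
  consider "f x y \<le> 0" | "f x y \<ge> 2" | "0 < f x y" "f x y < 2" by linarith
  then show ?thesis
  proof cases
    case 1 then show ?thesis using rhs by (simp add: J_def cutoff_neg)
  next
    case 2
    then have "cutoff'' (f x y) * ((fx x y)\<^sup>2 + (fy x y)\<^sup>2) \<le> 0" using cutoff''_nonpos by (simp add: mult_nonpos_nonneg)
    then show ?thesis using JP rhs unfolding J_def by linarith
  next
    case 3
    then have N: "(N x y)\<^sup>2 \<ge> 2" using near_center(2)[OF y _ big small] by (meson not_le)
    note far = far_from_center[OF y N 3(1) R]
    have "cutoff'' (f x y) * ((fx x y)\<^sup>2 + (fy x y)\<^sup>2) \<le> 6 * ((fx x y)\<^sup>2 + (fy x y)\<^sup>2)"
      using cutoff''_le by (intro mult_right_mono) auto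
    also have "\<dots> = 6 * (y\<^sup>2 * ((fx x y)\<^sup>2 + (fy x y)\<^sup>2)) / y\<^sup>2" using y by simp
    also have "\<dots> \<le> 6 * (C3 * (9 + (e x y)\<^sup>2)) / y\<^sup>2"
      using gradient_le[OF y N 3] by (intro divide_right_mono mult_left_mono) auto
    also have "\<dots> = ?rhs" using far by (simp add: min_absorb1)
    finally show ?thesis using JP unfolding J_def by linarith
  qed
qed

text \<open>A square of side proportional to \<open>\<alpha> = sqrt a\<close> is the region on which
  the source lives: \<open>N - 1 \<le> a / 12\<close> there, so the denominator
  \<open>N^2 - 1 + a\<close> is at most \<open>2 a\<close>.\<close>

lemma J_le_center:
  assumes \<alpha>: "a = \<alpha>\<^sup>2" "0 < \<alpha>" and sq: "\<bar>x - x0\<bar> \<le> \<alpha> * y0 / 4" "\<bar>y - y0\<bar> \<le> \<alpha> * y0 / 4"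
    and big: "\<tau> * (9 * v0\<^sup>2) powr (-s) \<ge> 4" and small: "\<epsilon> * (v0 / 3) powr (1 - 2 * s) \<le> 1"
  shows "y > 0" "f x y \<ge> 2" "J x y \<le> - (\<tau> * (9 * v0\<^sup>2) powr (-s) * \<delta> / (4 * a * y0\<^sup>2))"
proof -
  have "\<alpha>\<^sup>2 \<le> 1\<^sup>2" using a \<alpha> by simp
  then have \<alpha>1: "\<alpha> \<le> 1" by (rule power2_le_imp_le) simp
  then have "\<alpha> * y0 \<le> y0" using y0 by simp
  then have yb: "3/4 * y0 \<le> y" "y \<le> 5/4 * y0" using sq(2) unfolding abs_le_iff by linarith+
  then show y: "y > 0" using y0 by simp
  have "N x y - 1 = ((x - x0)\<^sup>2 + (y - y0)\<^sup>2) / (2 * y * y0)"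
    using y y0 by (simp add: coshd_def field_simps power2_eq_square)
  also have "\<dots> \<le> ((\<alpha> * y0 / 4)\<^sup>2 + (\<alpha> * y0 / 4)\<^sup>2) / (2 * (3/4 * y0) * y0)"
  proof (rule frac_le)
    have "\<bar>x - x0\<bar>\<^sup>2 \<le> (\<alpha> * y0 / 4)\<^sup>2" "\<bar>y - y0\<bar>\<^sup>2 \<le> (\<alpha> * y0 / 4)\<^sup>2" by (rule power_mono[OF sq(1) abs_ge_zero] power_mono[OF sq(2) abs_ge_zero])+
    then show "(x - x0)\<^sup>2 + (y - y0)\<^sup>2 \<le> (\<alpha> * y0 / 4)\<^sup>2 + (\<alpha> * y0 / 4)\<^sup>2" by simp
    show "2 * (3/4 * y0) * y0 \<le> 2 * y * y0" using yb y0 by (intro mult_right_mono mult_left_mono) auto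
  qed (use y0 in auto)
  also have "\<dots> = a / 12" using y0 \<alpha>(1) by (simp add: power_divide power_mult_distrib power2_eq_square)
  finally have N1: "N x y - 1 \<le> a / 12" .
  note ps = pos[OF y, of x]
  have "(N x y)\<^sup>2 - 1 = (N x y - 1) * (N x y + 1)" by (simp add: power2_eq_square algebra_simps)
  also have "\<dots> \<le> a / 12 * (25 / 12)" using N1 ps a by (intro mult_mono) auto
  also have "\<dots> \<le> a" using a by simp
  finally have N2: "(N x y)\<^sup>2 - 1 \<le> a" .
  have "(N x y)\<^sup>2 < 2"
  proof -
    have "(N x y)\<^sup>2 \<le> (13/12)\<^sup>2" using N1 a ps by (intro power_mono) auto
    then show ?thesis by (simp add: power_divide)
  qed
  note nc = near_center[OF y this big small]
  show f: "f x y \<ge> 2" by (rule nc)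
  define k0 where "k0 = \<tau> * (9 * v0\<^sup>2) powr (-s)"
  have k0: "k0 \<ge> 0" using big by (simp add: k0_def)
  define \<rho> where "\<rho> = (N x y)\<^sup>2 - 1 + a"
  have \<rho>: "\<rho> > 0" "\<rho> \<le> 2 * a" using radial_rho_pos[OF ps(2) a(1)] N2 by (auto simp: \<rho>_def)
  have "J x y \<le> cutoff' (f x y) * P x y"
    using cutoff''_nonpos[OF f] by (simp add: J_def mult_nonpos_nonneg)
  also have "\<dots> \<le> 1 * P x y" using cutoff'_ge_1[of "f x y"] f P_nonpos[OF y, of x] by (intro mult_right_mono_neg) auto
  also have "\<dots> \<le> - (\<kappa> x y * (2 * \<delta> * a / \<rho>\<^sup>2)) / y\<^sup>2" using P_le[OF y, of x] by (simp add: \<rho>_def)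
  also have "\<dots> \<le> - (k0 * (2 * \<delta> * a / (2 * a)\<^sup>2)) / (2 * y0\<^sup>2)"
  proof -
    have "k0 * (2 * \<delta> * a / (2 * a)\<^sup>2) / (2 * y0\<^sup>2) \<le> \<kappa> x y * (2 * \<delta> * a / \<rho>\<^sup>2) / y\<^sup>2"
    proof (intro frac_le mult_mono)
      show "\<rho>\<^sup>2 \<le> (2 * a)\<^sup>2" using \<rho> by (intro power_mono) auto
      have "y\<^sup>2 \<le> (5/4 * y0)\<^sup>2" using yb y by (intro power_mono) auto
      also have "\<dots> \<le> 2 * y0\<^sup>2" by (simp add: power_mult_distrib power_divide)
      finally show "y\<^sup>2 \<le> 2 * y0\<^sup>2" .
    qed (use nc(1) k0 \<rho> a \<delta> y ps in \<open>auto simp: k0_def\<close>)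
    then show ?thesis by simp
  qed
  also have "\<dots> = - (k0 * \<delta> / (4 * a * y0\<^sup>2))" using a by (simp add: power2_eq_square)
  finally show "J x y \<le> - (\<tau> * (9 * v0\<^sup>2) powr (-s) * \<delta> / (4 * a * y0\<^sup>2))" by (simp add: k0_def)
qed

text \<open>The square has area \<open>a y0^2 / 4\<close> and the source on it has depth
  \<open>\<tau> (9 v0^2)^(-s) \<delta> / (4 a y0^2)\<close>. The width \<open>a\<close> cancels, so
  the square may be made as small as continuity of \<psi> demands without losing mass.\<close>

lemma mass_estimate:
  assumes \<psi>: "C2_on upper \<psi> \<psi>x \<psi>y \<psi>xx \<psi>yy"
    and eig: "\<And>x y. y > 0 \<Longrightarrow> \<psi>xx x y + \<psi>yy x y = s * (s - 1) / y\<^sup>2 * \<psi> x y"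
    and \<alpha>: "a = \<alpha>\<^sup>2" "0 < \<alpha>"
    and big: "\<tau> * (9 * v0\<^sup>2) powr (-s) \<ge> 4" and small: "\<epsilon> * (v0 / 3) powr (1 - 2 * s) \<le> 1"
    and R: "R > 0" "x0\<^sup>2 + y0\<^sup>2 \<ge> (2 * R)\<^sup>2" "\<tau> * (1 + \<delta>) \<le> (1 / (16 * R\<^sup>2)) powr s"
    and m: "m \<ge> 0" "\<And>x y. \<bar>x - x0\<bar> \<le> \<alpha> * y0 / 4 \<Longrightarrow> \<bar>y - y0\<bar> \<le> \<alpha> * y0 / 4 \<Longrightarrow> m \<le> (\<psi> x y)\<^sup>2"
    and H: "\<And>p. H p = indicator {p. snd p > 0 \<and> (fst p)\<^sup>2 + (snd p)\<^sup>2 > R\<^sup>2} p *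
       (6 * C3 * (9 + (min (e (fst p) (snd p)) (\<tau> * (1 + \<delta>) * (v0\<^sup>2) powr (-s)))\<^sup>2) * ((\<psi> (fst p) (snd p))\<^sup>2 / (snd p)\<^sup>2))"
    and Hint: "integrable lborel H"
  shows "m * (\<tau> * (9 * v0\<^sup>2) powr (-s)) * \<delta> / 16 \<le> (\<integral>p. H p \<partial>lborel)"
proof -
  obtain M q where Mq: "q > 0" "\<And>x y. y > 0 \<Longrightarrow> f x y > 0 \<Longrightarrow> \<bar>x\<bar> < M \<and> q < y \<and> y < M"
    using support_bounded by blast
  define sq where "sq = cbox (x0 - \<alpha> * y0 / 4, y0 - \<alpha> * y0 / 4) (x0 + \<alpha> * y0 / 4, y0 + \<alpha> * y0 / 4)"
  have sqI: "(x,y) \<in> sq \<longleftrightarrow> \<bar>x - x0\<bar> \<le> \<alpha> * y0 / 4 \<and> \<bar>y - y0\<bar> \<le> \<alpha> * y0 / 4" for x y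
    unfolding sq_def cbox_Pair_eq mem_Sigma_iff unfolding cbox_interval atLeastAtMost_iff abs_le_iff by (safe; linarith)
  note Jc = J_le_center[OF \<alpha> _ _ big small]
  define Rc where "Rc = cbox (-M, q) (M, M)"
  have RcI: "(x,y) \<in> Rc \<longleftrightarrow> \<bar>x\<bar> \<le> M \<and> q \<le> y \<and> y \<le> M" for x y
    unfolding Rc_def cbox_Pair_eq by (auto simp: abs_le_iff)
  have sq_Rc: "sq \<subseteq> Rc"
  proof
    fix p assume p: "p \<in> sq"
    obtain x y where xy: "p = (x,y)" by (cases p)
    have "y > 0" "f x y \<ge> 2" using Jc(1,2)[of x y] p sqI by (auto simp: xy)
    then show "p \<in> Rc" using Mq(2)[of y x] by (simp add: xy RcI)
  qed
  have "(x0,y0) \<in> sq" using \<alpha> y0 by (simp add: sqI)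
  then have "(x0,y0) \<in> Rc" using sq_Rc by blast
  then have le: "-M \<le> M" "q \<le> M" by (auto simp: RcI)
  have Rc_up: "Rc \<subseteq> upper" using Mq(1) by (auto simp: RcI)
  define I where "I = (\<lambda>(x,y). (\<psi> x y)\<^sup>2 * (cutoff' (f x y) * (fxx x y + fyy x y + 2 * s * (height_x x y / V x y * fx x y + height_y x y / V x y * fy x y))
             + cutoff'' (f x y) * ((fx x y)\<^sup>2 + (fy x y)\<^sup>2)))"
  have I_eq: "I (x,y) = (\<psi> x y)\<^sup>2 * J x y" for x y by (simp add: I_def J_def P_def)
  \<comment> \<open>The function V^s solves the same eigenvalue equation as \<psi>; this is that
    equation for its logarithm.\<close>
  have hL: "s * ((height_xx x y / V x y - (height_x x y / V x y)\<^sup>2) + (height_yy x y / V x y - (height_y x y / V x y)\<^sup>2))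
      + s\<^sup>2 * ((height_x x y / V x y)\<^sup>2 + (height_y x y / V x y)\<^sup>2) = s * (s - 1) / y\<^sup>2" if y: "y > 0" for x y
  proof -
    have p1: "(height_x x y / V x y)\<^sup>2 + (height_y x y / V x y)\<^sup>2 = 1 / y\<^sup>2"
      using height_sums(1)[OF y, of x] pos(1)[OF y, of x] by (simp add: power_divide flip: add_divide_distrib)
    have p2: "height_xx x y / V x y + height_yy x y / V x y = 0"
      using height_sums(2)[OF y, of x] by (simp flip: add_divide_distrib)
    have "s * ((height_xx x y / V x y - (height_x x y / V x y)\<^sup>2) + (height_yy x y / V x y - (height_y x y / V x y)\<^sup>2))
      + s\<^sup>2 * ((height_x x y / V x y)\<^sup>2 + (height_y x y / V x y)\<^sup>2)
      = s * (height_xx x y / V x y + height_yy x y / V x y) + (s\<^sup>2 - s) * ((height_x x y / V x y)\<^sup>2 + (height_y x y / V x y)\<^sup>2)"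
      by (simp add: algebra_simps)
    then show ?thesis unfolding p1 p2 by (simp add: power2_eq_square algebra_simps)
  qed
  have bd: "f x y \<le> 0" if "(x,y) \<in> Rc" "x = -M \<or> x = M \<or> y = q \<or> y = M" for x y
  proof (rule ccontr)
    assume "\<not> f x y \<le> 0"
    moreover have "y > 0" using that(1) Rc_up by auto
    ultimately have "\<bar>x\<bar> < M \<and> q < y \<and> y < M" using Mq(2)[of y x] by simp
    then show False using that(2) by auto
  qed
  have "I integrable_on Rc \<and> integral Rc I \<ge> 0"
    unfolding I_def Rc_def
  proof (intro conjI)
    note A = cutoff_integral_nonneg[OF le C2_on_subset[OF \<psi>] C2_on_subset[OF C2_f] C2_on_subset[OF C2_log_height],
        where c = "\<lambda>x y. s * (s - 1) / y\<^sup>2" and s = s]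
    have up: "cbox (-M, q) (M, M) \<subseteq> upper" using Rc_up by (simp add: Rc_def)
    have y: "y > 0" if "(x,y) \<in> cbox (-M, q) (M, M)" for x y using subsetD[OF up that] by simp
    show "(\<lambda>(x,y). (\<psi> x y)\<^sup>2 * (cutoff' (f x y) * (fxx x y + fyy x y + 2 * s * (height_x x y / V x y * fx x y + height_y x y / V x y * fy x y))
             + cutoff'' (f x y) * ((fx x y)\<^sup>2 + (fy x y)\<^sup>2))) integrable_on cbox (-M, q) (M, M)"
      by (rule A(1)[OF up up up]) (use y eig hL bd in \<open>auto simp: Rc_def\<close>)
    show "0 \<le> integral (cbox (-M, q) (M, M)) (\<lambda>(x,y). (\<psi> x y)\<^sup>2 * (cutoff' (f x y) * (fxx x y + fyy x y + 2 * s * (height_x x y / V x y * fx x y + height_y x y / V x y * fy x y))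
             + cutoff'' (f x y) * ((fx x y)\<^sup>2 + (fy x y)\<^sup>2)))"
      by (rule A(2)[OF up up up]) (use y eig hL bd in \<open>auto simp: Rc_def\<close>)
  qed
  then have I: "I integrable_on Rc" "integral Rc I \<ge> 0" by auto
  define K0 where "K0 = \<tau> * (9 * v0\<^sup>2) powr (-s) * \<delta> / (4 * a * y0\<^sup>2)"
  have K0: "K0 \<ge> 0" using \<tau> \<delta> a by (simp add: K0_def)
  have Hnn: "H p \<ge> 0" for p unfolding H by (auto simp: C3_def)
  have HUNIV: "H integrable_on UNIV" "integral UNIV H = (\<integral>p. H p \<partial>lborel)"
    using Hint by (auto intro: integrable_on_lborel integral_lborel)
  have HRc: "H integrable_on Rc" unfolding Rc_def using HUNIV(1) by (rule integrable_on_subcbox) simp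
  have HRc_le: "integral Rc H \<le> (\<integral>p. H p \<partial>lborel)"
    unfolding HUNIV(2)[symmetric] using HRc HUNIV(1) Hnn by (intro integral_subset_le) auto
  have sq_int: "((\<lambda>p. if p \<in> sq then m * K0 else 0) has_integral (\<alpha> * y0 / 2)\<^sup>2 * (m * K0)) Rc"
  proof -
    have "((\<lambda>p. m * K0) has_integral measure lborel sq *\<^sub>R (m * K0)) sq"
      unfolding sq_def by (rule has_integral_const)
    moreover have "measure lborel sq = (\<alpha> * y0 / 2)\<^sup>2"
      using \<alpha> y0 unfolding sq_def content_Pair by (simp add: power2_eq_square)
    ultimately show ?thesis using has_integral_restrict[OF sq_Rc, of "\<lambda>p. m * K0"] by simp
  qed
  have pw: "I p + (if p \<in> sq then m * K0 else 0) \<le> H p" if p: "p \<in> Rc" for p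
  proof -
    obtain x y where xy: "p = (x,y)" by (cases p)
    have y: "y > 0" using p Rc_up by (auto simp: xy)
    show ?thesis
    proof (cases "p \<in> sq")
      case True
      then have sqq: "\<bar>x - x0\<bar> \<le> \<alpha> * y0 / 4" "\<bar>y - y0\<bar> \<le> \<alpha> * y0 / 4" by (auto simp: xy sqI)
      have "I p \<le> (\<psi> x y)\<^sup>2 * (- K0)" unfolding xy I_eq using Jc(3)[OF sqq] by (intro mult_left_mono) (auto simp: K0_def)
      also have "\<dots> \<le> m * (- K0)" using m(2)[OF sqq] K0 by (intro mult_right_mono_neg) auto
      finally show ?thesis using True Hnn[of p] by simp
    next
      case False
      have "I p \<le> (\<psi> x y)\<^sup>2 * (if x\<^sup>2 + y\<^sup>2 > R\<^sup>2 then 6 * C3 * (9 + (min (e x y) (\<tau> * (1 + \<delta>) * (v0\<^sup>2) powr (-s)))\<^sup>2) / y\<^sup>2 else 0)"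
        unfolding xy I_eq using J_le[OF y big small R, of x] by (intro mult_left_mono) auto
      also have "\<dots> = H p" unfolding H xy using y by (simp add: indicator_def)
      finally show ?thesis using False by simp
    qed
  qed
  have "(\<alpha> * y0 / 2)\<^sup>2 * (m * K0) \<le> integral Rc I + (\<alpha> * y0 / 2)\<^sup>2 * (m * K0)" using I by simp
  also have "\<dots> = integral Rc (\<lambda>p. I p + (if p \<in> sq then m * K0 else 0))"
    using I(1) sq_int by (simp add: integral_add integral_unique has_integral_integrable)
  also have "\<dots> \<le> integral Rc H"
    using I(1) sq_int HRc pw by (intro integral_le integrable_add) (auto intro: has_integral_integrable)
  also have "\<dots> \<le> (\<integral>p. H p \<partial>lborel)" by (rule HRc_le)
  finally have "(\<alpha> * y0 / 2)\<^sup>2 * (m * K0) \<le> (\<integral>p. H p \<partial>lborel)" .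
  moreover have "(\<alpha> * y0 / 2)\<^sup>2 * (m * K0) = m * (\<tau> * (9 * v0\<^sup>2) powr (-s)) * \<delta> / 16"
    using \<alpha> y0 by (simp add: K0_def power_divide power_mult_distrib)
  ultimately show ?thesis by simp
qed

end

section \<open>Decay of eigenfunctions near infinity\<close>

lemma height_sq_le: assumes "y > 0" shows "(height x y)\<^sup>2 \<le> 1 / (x\<^sup>2 + y\<^sup>2)"
proof -
  define r where "r = x\<^sup>2 + y\<^sup>2"
  have r: "r > 0" "y\<^sup>2 \<le> r" using norm2_pos[OF assms] by (auto simp: r_def)
  have "(height x y)\<^sup>2 = y\<^sup>2 / r\<^sup>2" by (simp add: height_def r_def power_divide)
  also have "\<dots> \<le> r / r\<^sup>2" using r by (intro divide_right_mono) auto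
  also have "\<dots> = 1 / r" using r(1) by (simp add: power2_eq_square)
  finally show ?thesis by (simp add: r_def)
qed

text \<open>Here \<open>\<kappa>0\<close> has the size of \<open>height x0 y0\<close> to the power
  \<open>-2 s\<close>, while the right side does not depend on the point: this is already the
  decay.\<close>

lemma eigenfunction_pointwise:
  fixes s R \<tau> x0 y0 :: real and \<psi> :: "real \<Rightarrow> real \<Rightarrow> real"
  defines "q \<equiv> (\<lambda>p. indicator {p. snd p > 0 \<and> (fst p)\<^sup>2 + (snd p)\<^sup>2 > R\<^sup>2} p * ((\<psi> (fst p) (snd p))\<^sup>2 / (snd p)\<^sup>2))"
    and "\<delta> \<equiv> radial_delta s"
    and "\<kappa>0 \<equiv> \<tau> * (9 * (height x0 y0)\<^sup>2) powr (-s)"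
  assumes s: "s > 1/2" and R: "R > 0"
    and \<psi>: "C2_on upper \<psi> \<psi>x \<psi>y \<psi>xx \<psi>yy"
    and eig: "\<And>x y. y > 0 \<Longrightarrow> \<psi>xx x y + \<psi>yy x y = s * (s - 1) / y\<^sup>2 * \<psi> x y"
    and q: "integrable lborel q"
    and \<tau>: "\<tau> > 0" "\<tau> * (1 + \<delta>) \<le> (1 / (16 * R\<^sup>2)) powr s"
    and y0: "y0 > 0" and r0: "x0\<^sup>2 + y0\<^sup>2 \<ge> (2 * R)\<^sup>2" and big: "\<kappa>0 \<ge> 4"
  shows "(\<psi> x0 y0)\<^sup>2 * (\<kappa>0 * \<delta> / 16) \<le> 54 * (48 * \<delta>\<^sup>2 + 30 * s\<^sup>2) * (\<integral>p. q p \<partial>lborel)"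
proof (rule ccontr)
  assume neg: "\<not> ?thesis"
  define C3 where "C3 = 48 * \<delta>\<^sup>2 + 30 * s\<^sup>2"
  have C3: "C3 \<ge> 0" by (simp add: C3_def)
  define I where "I = (\<integral>p. q p \<partial>lborel)"
  have qnn: "q p \<ge> 0" for p by (simp add: q_def)
  have I: "I \<ge> 0" unfolding I_def using qnn by simp
  have \<delta>: "\<delta> > 0" using s by (simp add: \<delta>_def radial_delta_def)
  define k where "k = \<kappa>0 * \<delta> / 16"
  have k: "k > 0" using big \<delta> by (simp add: k_def)
  \<comment> \<open>The midpoint between the claimed bound and \<open>\<psi>^2\<close> at the pole:
    below the latter, so continuity gives a square on which \<open>\<psi>^2 \<ge> m\<close>, and
    above the former, for the contradiction.\<close>
  define m where "m = (54 * C3 * I / k + (\<psi> x0 y0)\<^sup>2) / 2"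
  have lt: "54 * C3 * I / k < (\<psi> x0 y0)\<^sup>2" using neg k by (simp add: k_def C3_def I_def pos_divide_less_eq)
  have m0: "m \<ge> 0" using C3 I k by (simp add: m_def)
  have m1: "m < (\<psi> x0 y0)\<^sup>2" using lt by (simp add: m_def)
  have m2: "54 * C3 * I < m * k"
  proof -
    have "54 * C3 * I / k < m" using lt by (simp add: m_def)
    then show ?thesis using k by (simp add: pos_divide_less_eq)
  qed
  have "continuous_on upper (\<lambda>p. (\<psi> (fst p) (snd p))\<^sup>2)"
    using \<psi> unfolding C2_on_def case_prod_beta by (intro continuous_intros) auto
  then obtain d where d: "d > 0" "\<And>p. p \<in> upper \<Longrightarrow> dist p (x0,y0) < d \<Longrightarrow>
      dist ((\<psi> (fst p) (snd p))\<^sup>2) ((\<psi> x0 y0)\<^sup>2) < (\<psi> x0 y0)\<^sup>2 - m"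
    unfolding continuous_on_iff using y0 m1 by (metis (no_types, lifting) diff_gt_0_iff_gt fst_conv mem_Collect_eq snd_conv)
  define \<alpha> where "\<alpha> = min 1 (d / y0)"
  have \<alpha>: "\<alpha> > 0" "\<alpha> \<le> 1" "\<alpha> * y0 \<le> d"
  proof -
    show "\<alpha> > 0" "\<alpha> \<le> 1" using d(1) y0 by (simp_all add: \<alpha>_def)
    have "\<alpha> * y0 \<le> d / y0 * y0" using y0 by (intro mult_right_mono) (simp_all add: \<alpha>_def)
    then show "\<alpha> * y0 \<le> d" using y0 by simp
  qed
  have sq: "m \<le> (\<psi> x y)\<^sup>2" if xy: "\<bar>x - x0\<bar> \<le> \<alpha> * y0 / 4" "\<bar>y - y0\<bar> \<le> \<alpha> * y0 / 4" for x y
  proof -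
    have "\<alpha> * y0 \<le> 1 * y0" using \<alpha> y0 by (intro mult_right_mono) auto
    then have "y > 0" using xy(2) y0 unfolding abs_le_iff by linarith
    moreover have "dist (x,y) (x0,y0) < d"
    proof -
      have "dist (x,y) (x0,y0) \<le> \<bar>x - x0\<bar> + \<bar>y - y0\<bar>"
        using norm_Pair_le[of "x - x0" "y - y0"] by (simp add: dist_norm)
      also have "\<dots> \<le> \<alpha> * y0 / 4 + \<alpha> * y0 / 4" using xy by (rule add_mono)
      also have "\<dots> < d" using \<alpha>(3) d(1) by linarith
      finally show ?thesis .
    qed
    ultimately have "dist ((\<psi> x y)\<^sup>2) ((\<psi> x0 y0)\<^sup>2) < (\<psi> x0 y0)\<^sup>2 - m" using d(2)[of "(x,y)"] by simp
    then show ?thesis unfolding dist_real_def by linarith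
  qed
  define a where "a = \<alpha>\<^sup>2"
  have a: "0 < a" "a \<le> 1" using \<alpha> power_mono[of \<alpha> 1 2] by (auto simp: a_def)
  define v0 where "v0 = height x0 y0"
  have v0: "v0 > 0" using height_pos[OF y0] by (simp add: v0_def)
  define E0 where "E0 = \<tau> * (1 + \<delta>) * (v0\<^sup>2) powr (-s)"
  \<comment> \<open>Scaled so that the smallness condition of the barrier holds for every n.\<close>
  define \<epsilon> where "\<epsilon> n = (v0 / 3) powr (2 * s - 1) / real (Suc n)" for n
  have \<epsilon>: "\<epsilon> n > 0" "\<epsilon> n * (v0 / 3) powr (1 - 2 * s) \<le> 1" for n
  proof -
    show "\<epsilon> n > 0" using v0 by (simp add: \<epsilon>_def)
    have "\<epsilon> n * (v0 / 3) powr (1 - 2 * s) = ((v0 / 3) powr (2 * s - 1) * (v0 / 3) powr (1 - 2 * s)) / real (Suc n)"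
      by (simp add: \<epsilon>_def)
    also have "(v0 / 3) powr (2 * s - 1) * (v0 / 3) powr (1 - 2 * s) = 1" using v0 by (simp flip: powr_add)
    finally show "\<epsilon> n * (v0 / 3) powr (1 - 2 * s) \<le> 1" by simp
  qed
  define w where "w n p = 6 * C3 * (9 + (min (\<epsilon> n * height (fst p) (snd p) powr (1 - 2 * s)) E0)\<^sup>2)" for n and p :: "real \<times> real"
  define H where "H n p = w n p * q p" for n p
  have q_meas [measurable]: "q \<in> borel_measurable borel" using q by (auto dest: borel_measurable_integrable)
  have w_meas [measurable]: "w n \<in> borel_measurable borel" for n
    unfolding w_def[abs_def] height_def borel_prod[symmetric] by measurable
  have E0: "E0 \<ge> 0" using \<tau> \<delta> by (simp add: E0_def)
  have wb: "0 \<le> w n p" "w n p \<le> 6 * C3 * (9 + E0\<^sup>2)" for n p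
  proof -
    show "0 \<le> w n p" using C3 by (simp add: w_def)
    have "0 \<le> \<epsilon> n * height (fst p) (snd p) powr (1 - 2 * s)" using \<epsilon>(1)[of n] by simp
    then have "(min (\<epsilon> n * height (fst p) (snd p) powr (1 - 2 * s)) E0)\<^sup>2 \<le> E0\<^sup>2" using E0 by (intro power_mono) auto
    then show "w n p \<le> 6 * C3 * (9 + E0\<^sup>2)" unfolding w_def using C3 by (intro mult_left_mono) auto
  qed
  have Hb: "norm (H n p) \<le> 6 * C3 * (9 + E0\<^sup>2) * q p" for n p
    using wb qnn[of p] by (simp add: H_def abs_mult mult_right_mono)
  have qint: "integrable lborel (\<lambda>p. 6 * C3 * (9 + E0\<^sup>2) * q p)" using q by simp
  have Hint: "integrable lborel (H n)" for n
  proof (rule Bochner_Integration.integrable_bound[OF qint])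
    show "H n \<in> borel_measurable lborel" unfolding H_def[abs_def] by measurable
    show "AE p in lborel. norm (H n p) \<le> norm (6 * C3 * (9 + E0\<^sup>2) * q p)"
      using Hb by (intro AE_I2) (metis abs_ge_self order_trans real_norm_def)
  qed
  have ineq: "m * k \<le> (\<integral>p. H n p \<partial>lborel)" for n
  proof -
    interpret b: barrier s a "\<epsilon> n" \<tau> x0 y0
      by unfold_locales (use s a \<epsilon> \<tau> y0 in auto)
    have defs: "b.v0 = v0" "b.\<delta> = \<delta>" "b.C3 = C3"
      by (simp_all add: b.v0_def v0_def b.\<delta>_def \<delta>_def b.C3_def C3_def)
    have "m * (\<tau> * (9 * b.v0\<^sup>2) powr (-s)) * b.\<delta> / 16 \<le> (\<integral>p. H n p \<partial>lborel)"
    proof (rule b.mass_estimate[OF \<psi> eig a_def \<alpha>(1)])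
      show "4 \<le> \<tau> * (9 * b.v0\<^sup>2) powr - s" using big by (simp add: defs \<kappa>0_def v0_def)
      show "\<epsilon> n * (b.v0 / 3) powr (1 - 2 * s) \<le> 1" using \<epsilon>(2)[of n] by (simp add: defs)
      show "\<tau> * (1 + b.\<delta>) \<le> (1 / (16 * R\<^sup>2)) powr s" using \<tau>(2) by (simp add: defs)
      show "H n p = indicator {p. snd p > 0 \<and> (fst p)\<^sup>2 + (snd p)\<^sup>2 > R\<^sup>2} p *
       (6 * b.C3 * (9 + (min (b.e (fst p) (snd p)) (\<tau> * (1 + b.\<delta>) * (b.v0\<^sup>2) powr (-s)))\<^sup>2) * ((\<psi> (fst p) (snd p))\<^sup>2 / (snd p)\<^sup>2))" for p
        by (simp add: H_def w_def q_def defs b.e_def E0_def)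
    qed (use R r0 m0 sq Hint in auto)
    then show ?thesis by (simp add: defs k_def \<kappa>0_def v0_def)
  qed
  \<comment> \<open>The minimum with \<open>E0\<close> provides a majorant independent of n. In the
    limit the weight \<open>6 C3 (9 + e^2)\<close> becomes \<open>54 C3\<close>.\<close>
  have "(\<lambda>n. \<integral>p. H n p \<partial>lborel) \<longlonglongrightarrow> (\<integral>p. 54 * C3 * q p \<partial>lborel)"
  proof (rule integral_dominated_convergence[OF _ _ qint])
    show "AE p in lborel. (\<lambda>n. H n p) \<longlonglongrightarrow> 54 * C3 * q p"
    proof (rule AE_I2)
      fix p :: "real \<times> real"
      have "(\<lambda>n. \<epsilon> n) \<longlonglongrightarrow> 0"
        unfolding \<epsilon>_def by (rule LIMSEQ_Suc[OF lim_const_over_n])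
      then have "(\<lambda>n. \<epsilon> n * height (fst p) (snd p) powr (1 - 2 * s)) \<longlonglongrightarrow> 0 * height (fst p) (snd p) powr (1 - 2 * s)"
        by (intro tendsto_intros)
      then have lim: "(\<lambda>n. min (\<epsilon> n * height (fst p) (snd p) powr (1 - 2 * s)) E0) \<longlonglongrightarrow> min 0 E0"
        by (intro tendsto_min tendsto_const) simp
      have "(\<lambda>n. w n p) \<longlonglongrightarrow> 6 * C3 * (9 + (min 0 E0)\<^sup>2)"
        unfolding w_def by (intro tendsto_mult tendsto_add tendsto_power tendsto_const lim)
      then have "(\<lambda>n. H n p) \<longlonglongrightarrow> 6 * C3 * (9 + (min 0 E0)\<^sup>2) * q p"
        unfolding H_def by (intro tendsto_intros)
      then show "(\<lambda>n. H n p) \<longlonglongrightarrow> 54 * C3 * q p" using E0 by (simp add: min_absorb1)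
    qed
    show "AE p in lborel. norm (H n p) \<le> 6 * C3 * (9 + E0\<^sup>2) * q p" for n using Hb by (intro AE_I2)
    show "(\<lambda>p. 54 * C3 * q p) \<in> borel_measurable lborel" by measurable
    show "H n \<in> borel_measurable lborel" for n unfolding H_def[abs_def] by measurable
  qed
  then have "m * k \<le> (\<integral>p. 54 * C3 * q p \<partial>lborel)" using ineq by (intro LIMSEQ_le_const) auto
  then have "m * k \<le> 54 * C3 * I" by (simp add: I_def)
  then show False using m2 by simp
qed

lemma eigenfunction_decay:
  fixes s R :: real and \<psi> :: "real \<Rightarrow> real \<Rightarrow> real"
  defines "q \<equiv> (\<lambda>p. indicator {p. snd p > 0 \<and> (fst p)\<^sup>2 + (snd p)\<^sup>2 > R\<^sup>2} p * ((\<psi> (fst p) (snd p))\<^sup>2 / (snd p)\<^sup>2))"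
  assumes s: "s > 1/2" and R: "R > 0"
    and \<psi>: "C2_on upper \<psi> \<psi>x \<psi>y \<psi>xx \<psi>yy"
    and eig: "\<And>x y. y > 0 \<Longrightarrow> \<psi>xx x y + \<psi>yy x y = s * (s - 1) / y\<^sup>2 * \<psi> x y"
    and q: "integrable lborel q"
  shows "\<exists>C K. \<forall>x y. y > 0 \<longrightarrow> x\<^sup>2 + y\<^sup>2 \<ge> K \<longrightarrow> \<bar>\<psi> x y\<bar> \<le> C * height x y powr s"
proof -
  define \<delta> where "\<delta> = radial_delta s"
  have \<delta>: "\<delta> > 0" using s by (simp add: \<delta>_def radial_delta_def)
  define t where "t = (1 / (16 * R\<^sup>2)) powr s"
  have t: "t > 0" using R by (simp add: t_def)
  \<comment> \<open>The largest value that \<open>far_from_center\<close> permits.\<close>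
  define \<tau> where "\<tau> = t / (1 + \<delta>)"
  have \<tau>: "\<tau> > 0" "\<tau> * (1 + \<delta>) = t" using t \<delta> by (simp_all add: \<tau>_def)
  \<comment> \<open>For \<open>9 v^2 \<le> g\<close> the value \<open>\<tau> (9 v^2)^(-s)\<close> is
    at least 4. Since \<open>v^2 \<le> 1 / (x^2 + y^2)\<close>, the condition
    \<open>x^2 + y^2 \<ge> 9 / g\<close> suffices.\<close>
  define g where "g = (\<tau> / 4) powr (1 / s)"
  have g: "g > 0" using \<tau> by (simp add: g_def)
  define A where "A = 54 * (48 * \<delta>\<^sup>2 + 30 * s\<^sup>2) * (\<integral>p. q p \<partial>lborel)"
  have A: "A \<ge> 0" unfolding A_def q_def by (intro mult_nonneg_nonneg integral_nonneg_AE AE_I2) auto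
  define C where "C = sqrt (A * 16 * 9 powr s / (\<tau> * \<delta>))"
  have "\<bar>\<psi> x y\<bar> \<le> C * height x y powr s" if y: "y > 0" and K: "x\<^sup>2 + y\<^sup>2 \<ge> max ((2 * R)\<^sup>2) (9 / g)" for x y
  proof -
    define v where "v = height x y"
    have v: "v > 0" using height_pos[OF y] by (simp add: v_def)
    have r: "x\<^sup>2 + y\<^sup>2 > 0" using norm2_pos[OF y] .
    have "9 / g \<le> x\<^sup>2 + y\<^sup>2" using K by simp
    then have "9 * (1 / (x\<^sup>2 + y\<^sup>2)) \<le> g" using g r by (simp add: divide_le_eq le_divide_eq mult.commute)
    moreover have "9 * v\<^sup>2 \<le> 9 * (1 / (x\<^sup>2 + y\<^sup>2))" using height_sq_le[OF y, of x] unfolding v_def by (rule mult_left_mono) simp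
    ultimately have vg: "9 * v\<^sup>2 \<le> g" by linarith
    have "g powr (-s) \<le> (9 * v\<^sup>2) powr (-s)" using vg v s by (intro powr_mono2') auto
    moreover have "g powr (-s) = 4 / \<tau>" using s \<tau> by (simp add: g_def powr_powr powr_minus_divide)
    ultimately have "\<tau> * (4 / \<tau>) \<le> \<tau> * (9 * v\<^sup>2) powr (-s)" using \<tau> by (intro mult_left_mono) auto
    then have big: "\<tau> * (9 * (height x y)\<^sup>2) powr (-s) \<ge> 4" using \<tau> by (simp add: v_def)
    have "(\<psi> x y)\<^sup>2 * (\<tau> * (9 * (height x y)\<^sup>2) powr (-s) * radial_delta s / 16) \<le> A"
      unfolding A_def \<delta>_def q_def
      by (rule eigenfunction_pointwise[OF s R \<psi> eig q[unfolded q_def] \<tau>(1) _ y _ big])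
        (use \<tau>(2) K in \<open>auto simp: \<delta>_def t_def\<close>)
    then have 1: "(\<psi> x y)\<^sup>2 * (\<tau> * (9 * v\<^sup>2) powr (-s) * \<delta> / 16) \<le> A" by (simp add: v_def \<delta>_def)
    define z where "z = (9 * v\<^sup>2) powr s"
    have z: "z > 0" using v by (simp add: z_def)
    have "(\<psi> x y)\<^sup>2 * (\<tau> * \<delta>) \<le> A * 16 * z"
      using 1 z by (simp add: powr_minus_divide z_def[symmetric] pos_divide_le_eq)
    then have "(\<psi> x y)\<^sup>2 \<le> A * 16 * z / (\<tau> * \<delta>)" using \<tau> \<delta> by (simp add: pos_le_divide_eq)
    also have "z = 9 powr s * (v powr s)\<^sup>2" using v by (simp add: z_def powr_mult power2_eq_square)
    also have "A * 16 * (9 powr s * (v powr s)\<^sup>2) / (\<tau> * \<delta>) = (C * v powr s)\<^sup>2"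
      using A \<tau> \<delta> by (simp add: C_def power_mult_distrib)
    finally have "\<bar>\<psi> x y\<bar>\<^sup>2 \<le> (C * v powr s)\<^sup>2" by simp
    moreover have "C * v powr s \<ge> 0" using A \<tau> \<delta> by (simp add: C_def)
    ultimately show ?thesis unfolding v_def by (rule power2_le_imp_le)
  qed
  then show ?thesis by blast
qed

section \<open>The action on the upper half plane\<close>

lemma SL2_iff: "(a,b,c,d) \<in> SL2 \<longleftrightarrow> a*d - b*c = 1"
  by (simp add: SL2_def)

lemma SL2_minv: "g \<in> SL2 \<Longrightarrow> minv g \<in> SL2"
  by (cases g) (simp add: SL2_def algebra_simps)

lemma mmul_assoc: "mmul (mmul f g) h = mmul f (mmul g h)"
  by (cases f; cases g; cases h) (simp add: algebra_simps)

lemma mmul_mid [simp]: "mmul mid g = g" "mmul g mid = g"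
  by (cases g; simp add: mid_def)+

lemma mmul_minv [simp]:
  assumes "g \<in> SL2" shows "mmul g (minv g) = mid" "mmul (minv g) g = mid"
  using assms by (cases g; simp add: SL2_def mid_def algebra_simps)+

lemma minv_minv [simp]: "minv (minv g) = g"
  by (cases g) simp

lemma norm_minv [simp]: "norm (minv g) = norm g"
  by (cases g) (simp add: norm_Pair algebra_simps)

lemma mmul_cancel_left: "g \<in> SL2 \<Longrightarrow> mmul (minv g) (mmul g h) = h"
  "g \<in> SL2 \<Longrightarrow> mmul g (mmul (minv g) h) = h"
  by (simp_all flip: mmul_assoc)

lemma mmul_cancel_right: "g \<in> SL2 \<Longrightarrow> mmul (mmul h g) (minv g) = h"
  "g \<in> SL2 \<Longrightarrow> mmul (mmul h (minv g)) g = h"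
  by (simp_all add: mmul_assoc)

lemma mob_denom_nonzero:
  assumes "(a,b,c,d) \<in> SL2" "Im z > 0"
  shows "complex_of_real c * z + of_real d \<noteq> 0"
proof
  assume "complex_of_real c * z + of_real d = 0"
  then have "c * Im z = 0" "c * Re z + d = 0" by (auto simp: complex_eq_iff)
  with assms show False by (auto simp: SL2_def)
qed

lemma mob_diff:
  assumes "(a,b,c,d) \<in> SL2" "Im z > 0" "Im w > 0"
  shows "mob (a,b,c,d) z - mob (a,b,c,d) w =
    (z - w) / ((of_real c * z + of_real d) * (of_real c * w + of_real d))"
proof -
  have "complex_of_real a * of_real d - of_real b * of_real c = 1"
    using assms(1) by (simp add: SL2_iff flip: of_real_mult of_real_diff)
  moreover have "(of_real a * z + of_real b) * (of_real c * w + of_real d)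
      - (of_real a * w + of_real b) * (of_real c * z + of_real d)
      = (complex_of_real a * of_real d - of_real b * of_real c) * (z - w)"
    by (simp add: algebra_simps)
  ultimately have "(of_real a * z + of_real b) * (of_real c * w + of_real d)
      - (of_real a * w + of_real b) * (of_real c * z + of_real d) = z - w"
    by simp
  then show ?thesis
    using mob_denom_nonzero[OF assms(1,2)] mob_denom_nonzero[OF assms(1,3)]
    by (simp add: diff_frac_eq mult.commute)
qed

lemma Im_mob:
  assumes "(a,b,c,d) \<in> SL2"
  shows "Im (mob (a,b,c,d) z) = Im z / (cmod (of_real c * z + of_real d))\<^sup>2"
proof -
  have "(a * Im z) * (c * Re z + d) - (a * Re z + b) * (c * Im z) = Im z * (a*d - b*c)"
    by (simp add: algebra_simps)
  then show ?thesis using assms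
    by (simp add: Im_divide SL2_iff cmod_power2)
qed

lemma mob_in_Hplane [intro]:
  assumes "g \<in> SL2" "z \<in> Hplane" shows "mob g z \<in> Hplane"
proof -
  obtain a b c d where g: "g = (a,b,c,d)" by (cases g)
  show ?thesis using assms mob_denom_nonzero[of a b c d z]
    by (simp add: g Im_mob Hplane_def del: mob.simps)
qed

lemma Im_mob_pos: "g \<in> SL2 \<Longrightarrow> Im z > 0 \<Longrightarrow> Im (mob g z) > 0"
  using mob_in_Hplane by (auto simp: Hplane_def)

lemma mob_mid [simp]: "mob mid z = z"
  by (simp add: mid_def)

lemma mob_mmul:
  assumes "g \<in> SL2" "h \<in> SL2" "Im z > 0"
  shows "mob (mmul g h) z = mob g (mob h z)"
proof -
  obtain a b c d where g: "g = (a,b,c,d)" by (cases g)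
  obtain e f k l where h: "h = (e,f,k,l)" by (cases h)
  have nz: "of_real k * z + complex_of_real l \<noteq> 0"
    using mob_denom_nonzero assms(2,3) h by blast
  define D where "D = of_real k * z + complex_of_real l"
  have D: "D \<noteq> 0" using nz by (simp add: D_def)
  have hz: "mob h z * D = of_real e * z + of_real f" using D by (simp add: h D_def)
  have "mob (mmul g h) z = (of_real a * (mob h z * D) + of_real b * D) / (of_real c * (mob h z * D) + of_real d * D)"
    unfolding hz by (simp add: g h D_def algebra_simps)
  also have "\<dots> = ((of_real a * mob h z + of_real b) * D) / ((of_real c * mob h z + of_real d) * D)"
    by (simp add: algebra_simps)
  also have "\<dots> = mob g (mob h z)" using D by (simp add: g)
  finally show ?thesis .
qed

lemma mob_minv [simp]:
  assumes "g \<in> SL2" "Im z > 0"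
  shows "mob (minv g) (mob g z) = z" "mob g (mob (minv g) z) = z"
  using assms by (simp_all add: SL2_minv flip: mob_mmul)

text \<open>This is \<open>2 (cosh d - 1)\<close> for the hyperbolic distance d: an algebraic
  substitute for d with the same balls.\<close>

definition ptd :: "complex \<Rightarrow> complex \<Rightarrow> real" where
  "ptd z w = (cmod (z - w))\<^sup>2 / (Im z * Im w)"

lemma ptd_mob:
  assumes "g \<in> SL2" "Im z > 0" "Im w > 0"
  shows "ptd (mob g z) (mob g w) = ptd z w"
proof -
  obtain a b c d where g: "g = (a,b,c,d)" by (cases g)
  show ?thesis
    using assms mob_denom_nonzero[of a b c d z] mob_denom_nonzero[of a b c d w]
    unfolding ptd_def g
    by (simp add: mob_diff Im_mob norm_divide norm_mult power_mult_distrib power_divide del: mob.simps)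
qed

lemma ptd_commute: "ptd z w = ptd w z"
  by (simp add: ptd_def norm_minus_commute mult.commute)

lemma ptd_self [simp]: "ptd z z = 0"
  by (simp add: ptd_def)

text \<open>Translates between norms of matrices and displacement of \<open>\<i>\<close>, so that
  discreteness of the group controls its orbit.\<close>

lemma ptd_mob_ii:
  assumes "(a,b,c,d) \<in> SL2"
  shows "ptd (mob (a,b,c,d) \<i>) \<i> + 2 = (norm (a,b,c,d))\<^sup>2"
proof -
  have nz: "c^2 + d^2 \<noteq> 0" using assms by (auto simp: SL2_iff)
  have nz': "of_real c * \<i> + complex_of_real d \<noteq> 0"
    using mob_denom_nonzero[OF assms] by auto
  have "mob (a,b,c,d) \<i> - \<i> = (of_real a * \<i> + of_real b - \<i> * (of_real c * \<i> + of_real d)) / (of_real c * \<i> + of_real d)"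
    using nz' by (simp add: field_simps)
  also have "of_real a * \<i> + of_real b - \<i> * (of_real c * \<i> + of_real d) = Complex (b + c) (a - d)"
    by (simp add: complex_eq_iff)
  finally have "(cmod (mob (a,b,c,d) \<i> - \<i>))\<^sup>2 = ((b+c)^2 + (a-d)^2) / (c^2+d^2)"
    by (simp add: norm_divide power_divide cmod_power2)
  moreover have "Im (mob (a,b,c,d) \<i>) = 1 / (c^2+d^2)"
    using assms by (simp add: Im_mob cmod_power2 del: mob.simps)
  ultimately have "ptd (mob (a,b,c,d) \<i>) \<i> = (b+c)^2 + (a-d)^2"
    using nz by (simp add: ptd_def)
  also have "\<dots> = a^2 + b^2 + c^2 + d^2 - 2 * (a*d - b*c)"
    by (simp add: power2_eq_square algebra_simps)
  finally show ?thesis using assms by (simp add: SL2_iff norm_Pair)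
qed

text \<open>Heights at distance d differ at most by the factor exp d, and exp d is at most 2 cosh d,
  which is \<open>ptd z w + 2\<close>.\<close>

lemma ptd_Im_le:
  assumes "Im z > 0" "Im w > 0" "ptd z w \<le> r" shows "Im z \<le> (r + 2) * Im w"
proof (rule ccontr)
  assume *: "\<not> ?thesis"
  have "(Im z - Im w)\<^sup>2 \<le> (cmod (z - w))\<^sup>2" by (simp add: cmod_power2)
  also have "\<dots> \<le> r * (Im z * Im w)"
    using assms by (simp add: ptd_def divide_simps)
  finally have 1: "(Im z)^2 + (Im w)^2 \<le> (r + 2) * Im w * Im z"
    by (simp add: power2_eq_square algebra_simps)
  have "(r + 2) * Im w * Im z < Im z * Im z" using * assms by (intro mult_strict_right_mono) auto
  moreover have "(Im w)^2 > 0" using assms by simp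
  ultimately show False using 1 by (simp add: power2_eq_square)
qed

lemma ptd_Im_ge:
  assumes "Im z > 0" "Im w > 0" "ptd z w \<le> r" shows "Im w / (r + 2) \<le> Im z"
proof -
  have "r \<ge> 0" using assms unfolding ptd_def
    by (smt (verit, best) divide_nonneg_pos mult_pos_pos zero_le_power2)
  then show ?thesis
  using ptd_Im_le[of w z r] assms by (simp add: ptd_commute divide_simps mult.commute)
qed

lemma ptd_dist_le:
  assumes "Im z > 0" "Im w > 0" "ptd z w \<le> r" shows "(cmod (z - w))\<^sup>2 \<le> r * (Im z * Im w)"
  using assms by (simp add: ptd_def divide_simps)

section \<open>Discrete groups with a closed horocycle\<close>

declare split_paired_All [simp del] split_paired_Ex [simp del]

lemma mmul_expand: "mmul g h =
  (fst g * fst h + fst (snd g) * fst (snd (snd h)),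
   fst g * fst (snd h) + fst (snd g) * snd (snd (snd h)),
   fst (snd (snd g)) * fst h + snd (snd (snd g)) * fst (snd (snd h)),
   fst (snd (snd g)) * fst (snd h) + snd (snd (snd g)) * snd (snd (snd h)))"
  by (cases g; cases h) simp

lemma tendsto_mmul [tendsto_intros]:
  "(f \<longlongrightarrow> a) F \<Longrightarrow> (g \<longlongrightarrow> b) F \<Longrightarrow> ((\<lambda>x. mmul (f x) (g x)) \<longlongrightarrow> mmul a b) F"
  unfolding mmul_expand by (intro tendsto_intros)

lemma minv_expand: "minv g = (snd (snd (snd g)), - fst (snd g), - fst (snd (snd g)), fst g)"
  by (cases g) simp

lemma tendsto_minv [tendsto_intros]:
  "(f \<longlongrightarrow> a) F \<Longrightarrow> ((\<lambda>x. minv (f x)) \<longlongrightarrow> minv a) F"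
  unfolding minv_expand by (intro tendsto_intros)

lemma mdet_expand: "mdet g = fst g * snd (snd (snd g)) - fst (snd g) * fst (snd (snd g))"
  by (cases g) simp

lemma SL2_tendsto:
  assumes "(f \<longlongrightarrow> a) F" "\<And>x. f x \<in> SL2" "F \<noteq> bot" shows "a \<in> SL2"
proof -
  have "((\<lambda>x. mdet (f x)) \<longlongrightarrow> mdet a) F"
    unfolding mdet_expand using assms(1) by (intro tendsto_intros)
  moreover have "(\<lambda>x. mdet (f x)) = (\<lambda>x. 1)" using assms(2) by (auto simp: SL2_def)
  ultimately show ?thesis using assms(3) tendsto_const_iff[of F 1 "mdet a"] by (simp add: SL2_def)
qed

lemma closed_Nsub: "closed Nsub"
proof -
  have "Nsub = {g. fst g = 1 \<and> fst (snd (snd g)) = 0 \<and> snd (snd (snd g)) = 1}"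
    by (auto simp: Nsub_def nx_def)
  also have "closed \<dots>"
    by (intro closed_Collect_conj closed_Collect_eq continuous_intros)
  finally show ?thesis .
qed

lemma nx_SL2: "n \<in> Nsub \<Longrightarrow> n \<in> SL2"
  by (auto simp: Nsub_def nx_def SL2_def)

lemma Nsub_mmul: "n \<in> Nsub \<Longrightarrow> m \<in> Nsub \<Longrightarrow> mmul n m \<in> Nsub"
  by (auto simp: Nsub_def nx_def)

lemma Nsub_minv: "n \<in> Nsub \<Longrightarrow> minv n \<in> Nsub"
  by (auto simp: Nsub_def nx_def)

lemma mid_Nsub: "mid \<in> Nsub"
  unfolding Nsub_def nx_def mid_def by blast

locale discrete_SL2 =
  fixes G :: "mat2 set"
  assumes subgroup: "is_subgroup_SL2 G" and discrete: "discrete_set G"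
begin

lemma in_SL2: "g \<in> G \<Longrightarrow> g \<in> SL2" using subgroup by (auto simp: is_subgroup_SL2_def)
lemma mid_in: "mid \<in> G" using subgroup by (auto simp: is_subgroup_SL2_def)
lemma mmul_in: "g \<in> G \<Longrightarrow> h \<in> G \<Longrightarrow> mmul g h \<in> G"
  using subgroup by (auto simp: is_subgroup_SL2_def)
lemma minv_in: "g \<in> G \<Longrightarrow> minv g \<in> G" using subgroup by (auto simp: is_subgroup_SL2_def)

text \<open>Pointwise discreteness gives no uniform gap, but the group structure does: in a
  convergent sequence of distinct elements the quotients of neighbours tend to \<open>mid\<close>,
  where discreteness forces them to be trivial.\<close>

lemma finite_of_bounded:
  assumes "A \<subseteq> G" "bounded A" shows "finite A"
proof (rule ccontr)
  assume "infinite A"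
  then obtain f :: "nat \<Rightarrow> mat2" where f: "inj f" "range f \<subseteq> A"
    by (metis infinite_countable_subset)
  have "bounded (range f)" using f(2) assms(2) bounded_subset by blast
  then obtain l r where r: "strict_mono (r :: nat \<Rightarrow> nat)" "(f \<circ> r) \<longlonglongrightarrow> l"
    using bounded_imp_convergent_subsequence by blast
  have fG: "f k \<in> G" for k using f(2) assms(1) by auto
  have "l \<in> SL2" by (rule SL2_tendsto[OF r(2)]) (auto simp: fG in_SL2)
  have "(\<lambda>n. (f \<circ> r) (Suc n)) \<longlonglongrightarrow> l" using r(2) by (rule LIMSEQ_Suc)
  then have "(\<lambda>n. mmul (minv ((f \<circ> r) n)) ((f \<circ> r) (Suc n))) \<longlonglongrightarrow> mmul (minv l) l"
    by (intro tendsto_intros r(2))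
  then have lim: "(\<lambda>n. mmul (minv (f (r n))) (f (r (Suc n)))) \<longlonglongrightarrow> mid"
    using \<open>l \<in> SL2\<close> by simp
  obtain e where "e > 0" and e: "\<And>h. h \<in> G \<Longrightarrow> dist h mid < e \<Longrightarrow> h = mid"
    using discrete mid_in unfolding discrete_set_def by blast
  from tendstoD[OF lim \<open>e > 0\<close>] obtain n where
    "dist (mmul (minv (f (r n))) (f (r (Suc n)))) mid < e"
    by (meson eventually_sequentially order_refl)
  then have eq: "mmul (minv (f (r n))) (f (r (Suc n))) = mid"
    by (intro e mmul_in minv_in fG)
  then have "mmul (f (r n)) (mmul (minv (f (r n))) (f (r (Suc n)))) = f (r n)"
    by simp
  then have "f (r (Suc n)) = f (r n)"
    by (simp add: mmul_cancel_left in_SL2 fG)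
  then have "r (Suc n) = r n" using f(1) by (simp add: inj_eq)
  then show False using r(1) by (metis lessI less_irrefl strict_mono_less)
qed

lemma countable_G: "countable G"
proof -
  have eq: "G = (\<Union>n::nat. {g \<in> G. norm g \<le> real n})"
    by (auto simp: real_arch_simple)
  have "finite {g \<in> G. norm g \<le> real n}" for n
    by (rule finite_of_bounded) (auto simp: bounded_iff)
  then have "countable (\<Union>n::nat. {g \<in> G. norm g \<le> real n})"
    by (intro countable_UN) (auto intro: countable_finite)
  with eq show ?thesis by simp
qed

end

fun row2 :: "mat2 \<Rightarrow> real \<times> real" where "row2 (a,b,c,d) = (c,d)"

locale horocycle_closed = discrete_SL2 +
  assumes closedGN: "closed {mmul g n | g n. g \<in> G \<and> n \<in> Nsub}"
    and trivGN: "G \<inter> Nsub = {mid}"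
begin

definition "GN = {mmul g n | g n. g \<in> G \<and> n \<in> Nsub}"

text \<open>The left coset g N, written as a preimage of \<open>Nsub\<close> so that its closedness
  is immediate.\<close>

definition "cosetN g = {h. mmul (minv g) h \<in> Nsub}"

lemma GN_I: "g \<in> G \<Longrightarrow> n \<in> Nsub \<Longrightarrow> mmul g n \<in> GN"
  unfolding GN_def by blast

lemma GN_E: "h \<in> GN \<Longrightarrow> (\<And>g n. h = mmul g n \<Longrightarrow> g \<in> G \<Longrightarrow> n \<in> Nsub \<Longrightarrow> P) \<Longrightarrow> P"
  unfolding GN_def by blast

lemma closed_GN: "closed GN"
  using closedGN unfolding GN_def .

text \<open>By Baire's theorem one coset is open in the closed set of all cosets, and then all are by
  homogeneity.\<close>

lemma coset_isolated:
  assumes "g \<in> G" "n \<in> Nsub" "\<And>k. y k \<in> GN" "y \<longlonglongrightarrow> mmul g n"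
  shows "eventually (\<lambda>k. y k \<in> cosetN g) sequentially"
proof -
  have "\<exists>g0\<in>G. \<not> GN \<subseteq> closure (GN - cosetN g0)"
  proof (rule ccontr)
    assume "\<not> ?thesis"
    then have dense: "GN \<subseteq> closure (GN - cosetN g)" if "g \<in> G" for g using that by blast
    have "closed (cosetN g)" for g
    proof -
      have "continuous_on UNIV (mmul (minv g))"
        unfolding mmul_expand by (intro continuous_intros)
      then show ?thesis
        using closed_vimage[OF closed_Nsub] by (simp add: vimage_def cosetN_def)
    qed
    then have op: "openin (top_of_set GN) (GN - cosetN g)" for g
      by (metis (no_types, lifting) Diff_eq open_Compl openin_open_Int)
    have "GN \<subseteq> closure (\<Inter>((\<lambda>g. GN - cosetN g) ` G))"
    proof (rule Baire[OF closed_GN])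
      show "countable ((\<lambda>g. GN - cosetN g) ` G)" using countable_G by (rule countable_image)
      show "openin (top_of_set GN) T \<and> GN \<subseteq> closure T" if "T \<in> (\<lambda>g. GN - cosetN g) ` G" for T
        using that dense op by blast
    qed
    moreover have "\<Inter>((\<lambda>g. GN - cosetN g) ` G) = {}"
    proof -
      have "h \<notin> \<Inter>((\<lambda>g. GN - cosetN g) ` G)" for h
      proof
        assume h: "h \<in> \<Inter>((\<lambda>g. GN - cosetN g) ` G)"
        then obtain g n where "h = mmul g n" "g \<in> G" "n \<in> Nsub" using mid_in by (blast elim: GN_E)
        then have "h \<in> cosetN g" by (simp add: mmul_cancel_left in_SL2 cosetN_def)
        with h \<open>g \<in> G\<close> show False by blast
      qed
      then show ?thesis by blast
    qed
    moreover have "mid \<in> GN" using mid_in mid_Nsub by (metis GN_I mmul_mid(1))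
    ultimately show False by auto
  qed
  then obtain g0 p where g0: "g0 \<in> G" "p \<in> GN" "p \<notin> closure (GN - cosetN g0)" by blast
  then obtain e where "e > 0" and e: "\<And>x. dist x p < e \<Longrightarrow> x \<notin> GN - cosetN g0"
    by (meson closure_approachable)
  have pc: "p \<in> cosetN g0" using e[of p] \<open>e > 0\<close> g0(2) by (metis DiffI dist_self)
  define n0 where "n0 = mmul (minv g0) p"
  have n0: "n0 \<in> Nsub" "p = mmul g0 n0" using pc g0 by (simp_all add: n0_def mmul_cancel_left in_SL2 cosetN_def)
  \<comment> \<open>Left translation by \<open>g0\<close> times the inverse of \<open>g\<close> and
    right translation by an element of N both preserve \<open>GN\<close>; together they carry the
    given limit point to \<open>p\<close>, near which \<open>GN\<close> lies in a single
    coset.\<close>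
  define x where "x k = mmul g0 (mmul (minv g) (mmul (y k) (mmul (minv n) n0)))" for k
  have S: "g \<in> SL2" "g0 \<in> SL2" "n \<in> SL2" "n0 \<in> SL2"
    using assms g0 n0 in_SL2 nx_SL2 by auto
  have "x \<longlonglongrightarrow> mmul g0 (mmul (minv g) (mmul (mmul g n) (mmul (minv n) n0)))"
    unfolding x_def by (intro tendsto_intros assms)
  also have "mmul g0 (mmul (minv g) (mmul (mmul g n) (mmul (minv n) n0))) = p"
    using S n0 by (simp add: mmul_assoc mmul_cancel_left)
  finally have "eventually (\<lambda>k. dist (x k) p < e) sequentially"
    using \<open>e > 0\<close> tendstoD by blast
  then show ?thesis
  proof eventually_elim
    case (elim k)
    obtain h m where hm: "y k = mmul h m" "h \<in> G" "m \<in> Nsub" using assms(3)[of k] by (blast elim: GN_E)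
    have "x k = mmul (mmul g0 (mmul (minv g) h)) (mmul m (mmul (minv n) n0))"
      by (simp add: x_def hm mmul_assoc)
    then have "x k \<in> GN" using hm g0(1) assms(1,2) n0(1) by (simp add: GN_I mmul_in minv_in Nsub_mmul Nsub_minv)
    then have "x k \<in> cosetN g0" using e elim by blast
    then have "mmul (mmul (minv g) (y k)) (mmul (minv n) n0) \<in> Nsub" (is "?u \<in> _")
      using S by (simp add: x_def mmul_cancel_left mmul_assoc cosetN_def)
    then have "mmul ?u (mmul (minv n0) n) \<in> Nsub"
      by (rule Nsub_mmul[OF _ Nsub_mmul[OF Nsub_minv[OF n0(1)] assms(2)]])
    then show ?case using S by (simp add: mmul_assoc mmul_cancel_left cosetN_def)
  qed
qed

text \<open>The bottom row of g is, up to order and sign, the first column of its inverse, and this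
  column determines the coset of the inverse modulo N. Distinct rows accumulating away from 0 would
  be distinct cosets accumulating at a point of the closed set \<open>GN\<close>, against
  \<open>coset_isolated\<close>.\<close>

lemma rows_locally_finite:
  assumes "e > 0" shows "finite {v \<in> row2 ` G. e \<le> norm v \<and> norm v \<le> R}"
proof (rule ccontr)
  assume inf: "infinite {v \<in> row2 ` G. e \<le> norm v \<and> norm v \<le> R}"
  obtain f :: "nat \<Rightarrow> real \<times> real" where f: "inj f"
    "range f \<subseteq> {v \<in> row2 ` G. e \<le> norm v \<and> norm v \<le> R}"
    using infinite_countable_subset[OF inf] by blast
  have fk: "f k \<in> row2 ` G" "e \<le> norm (f k)" "norm (f k) \<le> R" for k
    using f(2) by blast+
  then have "bounded (range f)" unfolding bounded_iff by blast
  then obtain l r where r: "strict_mono (r :: nat \<Rightarrow> nat)" "(f \<circ> r) \<longlonglongrightarrow> l"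
    using bounded_imp_convergent_subsequence by blast
  have "e \<le> norm l"
    by (rule tendsto_lowerbound[OF tendsto_norm[OF r(2)]]) (auto simp: fk)
  then have "l \<noteq> 0" using assms by auto
  \<comment> \<open>The representative, with orthogonal columns, of the coset whose first column is
    \<open>(snd v, - fst v)\<close>; it is continuous away from 0.\<close>
  define m where "m v = (snd v, fst v / ((snd v)\<^sup>2 + (fst v)\<^sup>2), - fst v, snd v / ((snd v)\<^sup>2 + (fst v)\<^sup>2))"
    for v :: "real \<times> real"
  have l0: "(snd l)\<^sup>2 + (fst l)\<^sup>2 \<noteq> 0" using \<open>l \<noteq> 0\<close> by (metis prod.collapse sum_power2_eq_zero_iff zero_prod_def)
  have lim: "(\<lambda>k. m ((f \<circ> r) k)) \<longlonglongrightarrow> m l"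
    unfolding m_def by (intro tendsto_intros r(2) l0)
  have mem: "m ((f \<circ> r) k) \<in> GN" for k
  proof -
    obtain g where g: "g \<in> G" "f (r k) = row2 g" using fk(1) by blast
    obtain a b c d where abcd: "minv g = (a,b,c,d)" by (cases "minv g")
    have gm: "(a,b,c,d) \<in> G" using minv_in[OF g(1)] abcd by simp
    then have det: "a*d - b*c = 1" using in_SL2 SL2_iff by blast
    then have nz: "a^2 + c^2 \<noteq> 0" by (auto simp: sum_power2_eq_zero_iff)
    have fr: "f (r k) = (-c, a)" using g abcd by (cases g) auto
    have 1: "a * - ((a*b + c*d)) + b * (a^2 + c^2) = - c * (a*d - b*c)"
      "c * - ((a*b + c*d)) + d * (a^2 + c^2) = a * (a*d - b*c)"
      by (simp_all add: power2_eq_square algebra_simps)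
    define S where "S = a^2 + c^2"
    have S: "S \<noteq> 0" using nz by (simp add: S_def)
    define t where "t = a*b + c*d"
    have "b * S = a * t - c" "d * S = c * t + a"
      using 1 unfolding det S_def[symmetric] t_def[symmetric] by simp_all
    then have "b = (a * t - c) / S" "d = (c * t + a) / S"
      using S by (simp_all add: eq_divide_eq)
    then have "a * - (t / S) + b = - c / S" "c * - (t / S) + d = a / S"
      by (simp_all add: diff_divide_distrib add_divide_distrib)
    \<comment> \<open>The shift subtracts from the second column its projection onto the
      first.\<close>
    then have "mmul (a,b,c,d) (nx (- ((a*b + c*d) / (a^2 + c^2)))) = m (f (r k))"
      by (simp add: nx_def m_def fr S_def t_def)
    then show ?thesis using GN_I[OF gm, of "nx (- ((a*b + c*d) / (a^2 + c^2)))"]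
      by (simp add: Nsub_def)
  qed
  have "m l \<in> GN" by (rule closed_sequentially[OF closed_GN mem lim])
  then obtain g n where gn: "m l = mmul g n" "g \<in> G" "n \<in> Nsub" by (blast elim: GN_E)
  have "eventually (\<lambda>k. m ((f \<circ> r) k) \<in> cosetN g) sequentially"
    by (rule coset_isolated[OF gn(2,3) mem lim[unfolded gn(1)]])
  then obtain K where K: "\<And>k. k \<ge> K \<Longrightarrow> m ((f \<circ> r) k) \<in> cosetN g"
    unfolding eventually_sequentially by blast
  have "f (r k) = row2 (minv g)" if "k \<ge> K" for k
  proof -
    have "mmul (minv g) (m (f (r k))) \<in> Nsub" using K[OF that] by (simp add: cosetN_def)
    then obtain t where t: "mmul (minv g) (m (f (r k))) = nx t" by (auto simp: Nsub_def)
    have "m (f (r k)) = mmul g (nx t)" using t gn(2) by (metis in_SL2 mmul_cancel_left(2))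
    then show ?thesis by (cases g; cases "f (r k)") (auto simp: m_def nx_def)
  qed
  from this[of K] this[of "Suc K"] have "f (r K) = f (r (Suc K))" by simp
  then show False using f(1) r(1) by (metis injD lessI less_irrefl strict_mono_less)
qed

end

section \<open>Short row vectors\<close>

lemma norm_mat2_entries:
  "\<bar>a\<bar> \<le> norm (a,b,c,d::real)" "\<bar>b\<bar> \<le> norm (a::real,b,c,d::real)"
  "\<bar>c\<bar> \<le> norm (a::real,b::real,c,d::real)" "\<bar>d\<bar> \<le> norm (a::real,b::real,c::real,d)"
proof -
  show "\<bar>a\<bar> \<le> norm (a,b,c,d)" using norm_fst_le[of a "(b,c,d)"] by simp
  show "\<bar>b\<bar> \<le> norm (a,b,c,d)" using norm_fst_le[of b "(c,d)"] norm_snd_le[of "(b,c,d)" a] by simp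
  show "\<bar>c\<bar> \<le> norm (a,b,c,d)"
    using norm_fst_le[of c "d"] norm_snd_le[of "(c,d)" b] norm_snd_le[of "(b,c,d)" a] by simp
  show "\<bar>d\<bar> \<le> norm (a,b,c,d)"
    using norm_snd_le[of "d" c] norm_snd_le[of "(c,d)" b] norm_snd_le[of "(b,c,d)" a] by simp
qed

lemma norm_mat2_le: "norm (a,b,c,d) \<le> \<bar>a\<bar> + \<bar>b\<bar> + \<bar>c\<bar> + \<bar>d::real\<bar>"
  using norm_Pair_le[of a "(b,c,d)"] norm_Pair_le[of b "(c,d)"] norm_Pair_le[of c d] by simp

lemma norm_mmul_le: "norm (mmul g h) \<le> 8 * (norm g * norm h)"
proof -
  obtain a b c d where g: "g = (a,b,c,d)" by (cases g)
  obtain e f k l where h: "h = (e,f,k,l)" by (cases h)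
  have m: "\<bar>x * y + z * w\<bar> \<le> 2 * (norm g * norm h)"
    if "\<bar>x\<bar> \<le> norm g" "\<bar>z\<bar> \<le> norm g" "\<bar>y\<bar> \<le> norm h" "\<bar>w\<bar> \<le> norm h" for x y z w :: real
  proof -
    have "\<bar>x * y\<bar> \<le> norm g * norm h" "\<bar>z * w\<bar> \<le> norm g * norm h"
      using that by (simp_all add: abs_mult mult_mono)
    then show ?thesis by linarith
  qed
  have ge: "\<bar>a\<bar> \<le> norm g" "\<bar>b\<bar> \<le> norm g" "\<bar>c\<bar> \<le> norm g" "\<bar>d\<bar> \<le> norm g"
    "\<bar>e\<bar> \<le> norm h" "\<bar>f\<bar> \<le> norm h" "\<bar>k\<bar> \<le> norm h" "\<bar>l\<bar> \<le> norm h"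
    unfolding g h by (rule norm_mat2_entries)+
  have "norm (mmul g h) \<le> \<bar>a*e+b*k\<bar> + \<bar>a*f+b*l\<bar> + \<bar>c*e+d*k\<bar> + \<bar>c*f+d*l\<bar>"
    unfolding g h mmul.simps by (rule norm_mat2_le)
  also have "\<dots> \<le> 2 * (norm g * norm h) + 2 * (norm g * norm h) + 2 * (norm g * norm h) + 2 * (norm g * norm h)"
    by (intro add_mono m ge)
  finally show ?thesis by simp
qed

lemma norm_SL2_ge_1: assumes "g \<in> SL2" shows "norm g \<ge> 1"
proof -
  obtain a b c d where g: "g = (a,b,c,d)" by (cases g)
  have "2 \<le> 2 * (a*d - b*c)" using assms by (simp add: g SL2_iff)
  also have "\<dots> \<le> a^2 + d^2 + b^2 + c^2"
    using sum_squares_bound[of a d] sum_squares_bound[of b "-c"] by simp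
  finally have "(norm g)^2 \<ge> 1" by (simp add: g norm_Pair)
  then show ?thesis using power2_le_imp_le[of 1 "norm g"] by simp
qed

fun ract :: "real \<times> real \<Rightarrow> mat2 \<Rightarrow> real \<times> real" where
  "ract (p,q) (a,b,c,d) = (p*a + q*c, p*b + q*d)"

definition wedge :: "real \<times> real \<Rightarrow> real \<times> real \<Rightarrow> real" where
  "wedge u v = fst u * snd v - snd u * fst v"

fun mtrace :: "mat2 \<Rightarrow> real" where "mtrace (a,b,c,d) = a + d"

lemma row2_mmul: "row2 (mmul g h) = ract (row2 g) h"
  by (cases g; cases h) simp

lemma ract_Cayley:
  assumes "h \<in> SL2" shows "ract (ract v h) h = mtrace h *\<^sub>R ract v h - v"
proof -
  obtain a b c d where h: "h = (a,b,c,d)" by (cases h)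
  obtain p q where v: "v = (p,q)" by (cases v)
  have bc: "b * c = a * d - 1" using assms by (simp add: h SL2_iff)
  have "(p*a + q*c)*a + (p*b + q*d)*c = (a+d)*(p*a+q*c) - p * (a*d - b*c)"
    "(p*a + q*c)*b + (p*b + q*d)*d = (a+d)*(p*b+q*d) - q * (a*d - b*c)"
    by (simp_all add: algebra_simps)
  then show ?thesis using bc by (simp add: h v)
qed

lemma wedge_ract: assumes "h \<in> SL2" shows "wedge (ract u h) (ract v h) = wedge u v"
proof -
  obtain a b c d where h: "h = (a,b,c,d)" by (cases h)
  obtain p q where v: "v = (p,q)" by (cases v)
  obtain p' q' where u: "u = (p',q')" by (cases u)
  have "wedge (ract u h) (ract v h) = (a*d - b*c) * wedge u v"
    by (simp add: h v u wedge_def algebra_simps)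
  then show ?thesis using assms by (simp add: h SL2_iff)
qed

lemma norm_ract_le: "norm (ract v h) \<le> 4 * norm h * norm v"
proof -
  obtain a b c d where h: "h = (a,b,c,d)" by (cases h)
  obtain p q where v: "v = (p,q)" by (cases v)
  have m: "\<bar>x * y + z * w\<bar> \<le> 2 * (norm h * norm v)"
    if "\<bar>x\<bar> \<le> norm v" "\<bar>z\<bar> \<le> norm v" "\<bar>y\<bar> \<le> norm h" "\<bar>w\<bar> \<le> norm h" for x y z w :: real
  proof -
    have "\<bar>x * y\<bar> \<le> norm v * norm h" "\<bar>z * w\<bar> \<le> norm v * norm h"
      using that by (simp_all add: abs_mult mult_mono)
    then show ?thesis by (simp add: mult.commute)
  qed
  have ge: "\<bar>a\<bar> \<le> norm h" "\<bar>b\<bar> \<le> norm h" "\<bar>c\<bar> \<le> norm h" "\<bar>d\<bar> \<le> norm h"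
    unfolding h by (rule norm_mat2_entries)+
  have gv: "\<bar>p\<bar> \<le> norm v" "\<bar>q\<bar> \<le> norm v"
    using norm_fst_le[of p q] norm_snd_le[of q p] by (simp_all add: v)
  have "norm (ract v h) \<le> \<bar>p*a+q*c\<bar> + \<bar>p*b+q*d\<bar>"
    unfolding h v ract.simps using norm_Pair_le[of "p*a+q*c" "p*b+q*d"] by simp
  also have "\<dots> \<le> 2 * (norm h * norm v) + 2 * (norm h * norm v)"
    by (intro add_mono m ge gv)
  finally show ?thesis by (simp add: mult.commute mult.left_commute)
qed

lemma abs_wedge_le: "\<bar>wedge u v\<bar> \<le> 2 * (norm u * norm v)"
proof -
  obtain p q where v: "v = (p,q)" by (cases v)
  obtain p' q' where u: "u = (p',q')" by (cases u)
  have "\<bar>p' * q\<bar> \<le> norm u * norm v" "\<bar>q' * p\<bar> \<le> norm u * norm v"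
    using norm_fst_le[of p' q'] norm_snd_le[of q' p'] norm_fst_le[of p q] norm_snd_le[of q p]
    by (simp_all add: u v abs_mult mult_mono)
  then show ?thesis by (simp add: wedge_def u v)
qed

lemma hyperbolic_contracting_root:
  fixes t :: real assumes "\<bar>t\<bar> > 2" obtains m where "m * m = t * m - 1" "\<bar>m\<bar> < 1" "m \<noteq> 0"
proof -
  define e where "e = sgn t"
  have e: "\<bar>e\<bar> = 1" "e * t = \<bar>t\<bar>" "e * e = 1" using assms by (auto simp: e_def sgn_if)
  have "\<exists>x\<ge>0. x \<le> 1 \<and> - (x * x - \<bar>t\<bar> * x + 1) = 0"
    by (rule IVT') (use assms in \<open>auto intro!: continuous_intros\<close>)
  then obtain x where x: "0 \<le> x" "x \<le> 1" "x * x - \<bar>t\<bar> * x + 1 = 0" by auto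
  have "x \<noteq> 1" "x \<noteq> 0" using x assms by auto
  show thesis
  proof (rule that[of "e * x"])
    show "e * x * (e * x) = t * (e * x) - 1"
    proof -
      have "e * x * (e * x) = (e * e) * (x * x)" "t * (e * x) = (e * t) * x"
        by (simp_all only: mult_ac)
      then have "e * x * (e * x) = x * x" "t * (e * x) = \<bar>t\<bar> * x" unfolding e by simp_all
      then show ?thesis using x(3) by linarith
    qed
    show "\<bar>e * x\<bar> < 1" "e * x \<noteq> 0" using x e \<open>x \<noteq> 1\<close> \<open>x \<noteq> 0\<close> by (auto simp: abs_mult)
  qed
qed

text \<open>A bounded orbit has no component in the expanding eigendirection. \<open>W k\<close>
  isolates this component: each step multiplies it by \<open>1 / m\<close>, so
  \<open>W 0 = m^k W k\<close> tends to 0. Then v is an eigenvector and the wedge vanishes.\<close>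

lemma hyperbolic_orbit_unbounded:
  assumes "h \<in> SL2" "\<bar>mtrace h\<bar> > 2" "wedge v (ract v h) \<noteq> 0"
  shows "\<exists>k. norm (((\<lambda>v. ract v h) ^^ k) v) \<ge> 1"
proof (rule ccontr)
  assume "\<not> ?thesis"
  then have lt: "norm (((\<lambda>v. ract v h) ^^ k) v) < 1" for k by (simp add: not_le)
  define V where "V k = ((\<lambda>v. ract v h) ^^ k) v" for k
  obtain m where m: "m * m = mtrace h * m - 1" "\<bar>m\<bar> < 1" "m \<noteq> 0"
    using hyperbolic_contracting_root assms(2) by blast
  have V: "V (Suc k) = ract (V k) h" "V (Suc (Suc k)) = mtrace h *\<^sub>R V (Suc k) - V k" for k
    using assms(1) by (simp_all add: V_def ract_Cayley)
  define W where "W k = V (Suc k) - m *\<^sub>R V k" for k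
  have "m *\<^sub>R W (Suc k) = W k" for k
  proof -
    have "m *\<^sub>R W (Suc k) = (mtrace h * m - m * m) *\<^sub>R V (Suc k) - m *\<^sub>R V k"
      by (simp add: W_def V(2) algebra_simps)
    then show ?thesis by (simp add: m(1) W_def)
  qed
  then have W: "W 0 = (m ^ k) *\<^sub>R W k" for k
    by (induction k) (simp, metis power_Suc2 scaleR_scaleR)
  have "norm (W 0) \<le> \<bar>m\<bar> ^ k * 2" for k
  proof -
    have "norm (W k) \<le> norm (V (Suc k)) + \<bar>m\<bar> * norm (V k)"
      unfolding W_def using norm_triangle_ineq4[of "V (Suc k)" "m *\<^sub>R V k"] by simp
    also have "\<dots> \<le> 1 + 1 * 1" using lt[of k] lt[of "Suc k"] m(2)
      unfolding V_def by (intro add_mono mult_mono) (auto simp del: funpow.simps)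
    finally show ?thesis by (subst W[of k]) (simp add: power_abs mult_left_mono)
  qed
  moreover have "(\<lambda>k. \<bar>m\<bar> ^ k * 2) \<longlonglongrightarrow> 0 * 2"
    using m(2) by (intro tendsto_intros LIMSEQ_power_zero) auto
  ultimately have "norm (W 0) \<le> 0" using LIMSEQ_le_const by fastforce
  then have "ract v h = m *\<^sub>R v" by (simp add: W_def V_def)
  then have "wedge v (ract v h) = 0" by (simp add: wedge_def)
  with assms(3) show False by simp
qed

context horocycle_closed begin

text \<open>A short row vector that is not an eigenvector of a hyperbolic \<open>h\<close> grows under powers of \<open>h\<close>
  until its length is of order one, while its value under the \<open>h\<close>-invariant quadratic form
  \<open>v \<and> vh\<close> stays small; local finiteness leaves only finitely many such values.\<close>

lemma short_rows_eigenvectors: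
  assumes "h \<in> G" "\<bar>mtrace h\<bar> > 2"
  shows "\<exists>e>0. \<forall>g\<in>G. norm (row2 g) < e \<longrightarrow> wedge (row2 g) (ract (row2 g) h) = 0"
proof -
  define q where "q v = wedge v (ract v h)" for v
  define K where "K = 4 * norm h + 1"
  have K: "K \<ge> 1" by (simp add: K_def)
  have nK: "norm (ract v h) \<le> K * norm v" for v
  proof -
    have "norm (ract v h) \<le> 4 * norm h * norm v" by (rule norm_ract_le)
    also have "\<dots> \<le> K * norm v" by (intro mult_right_mono) (auto simp: K_def)
    finally show ?thesis .
  qed
  define Q where "Q = (\<lambda>v. \<bar>q v\<bar>) ` {v \<in> row2 ` G. 1 \<le> norm v \<and> norm v \<le> K} - {0}"
  have finQ: "finite Q" unfolding Q_def using rows_locally_finite[of 1 K] by simp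
  define m where "m = Min (insert 1 Q)"
  have "m > 0" using finQ by (auto simp: m_def Q_def)
  \<comment> \<open>For \<open>norm v < e\<close> the form is at most \<open>2 K (norm v)^2\<close>,
    which is less than m.\<close>
  define e where "e = min 1 (m / (2 * K))"
  have "e > 0" using \<open>m > 0\<close> K by (simp add: e_def)
  moreover have "q (row2 g) = 0" if g: "g \<in> G" "norm (row2 g) < e" for g
  proof (rule ccontr)
    assume nz: "q (row2 g) \<noteq> 0"
    define V where "V k = ((\<lambda>v. ract v h) ^^ k) (row2 g)" for k
    have ex: "\<exists>k. norm (V k) \<ge> 1"
      unfolding V_def using nz assms in_SL2 by (intro hyperbolic_orbit_unbounded) (auto simp: q_def)
    \<comment> \<open>One step stretches by at most K, so the first vector of norm at least 1 has
      norm at most K and its form lies in the finite set \<open>Q\<close>.\<close>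
    define k where "k = (LEAST k. norm (V k) \<ge> 1)"
    have k: "norm (V k) \<ge> 1" unfolding k_def using ex by (rule LeastI_ex)
    have "k \<noteq> 0"
    proof
      assume "k = 0"
      then have "norm (row2 g) \<ge> 1" using k by (simp add: V_def)
      then show False using g(2) by (simp add: e_def)
    qed
    then obtain j where j: "k = Suc j" by (cases k) auto
    have "norm (V j) < 1" using not_less_Least[of j "\<lambda>k. norm (V k) \<ge> 1"] j k_def by (metis lessI not_le)
    then have "K * norm (V j) \<le> K * 1" using K by (intro mult_left_mono) auto
    then have "norm (V k) \<le> K" using nK[of "V j"] by (simp add: j V_def)
    have VG: "V i \<in> row2 ` G \<and> q (V i) = q (row2 g)" for i
    proof (induction i)
      case 0 then show ?case using g by (auto simp: V_def)
    next
      case (Suc i)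
      then obtain g' where "g' \<in> G" "V i = row2 g'" by blast
      then have "V (Suc i) = row2 (mmul g' h)" by (simp add: V_def row2_mmul)
      moreover have "q (V (Suc i)) = q (V i)"
        using assms in_SL2 by (simp add: q_def V_def wedge_ract)
      ultimately show ?case using Suc \<open>g' \<in> G\<close> assms mmul_in by auto
    qed
    have "\<bar>q (row2 g)\<bar> \<in> Q"
      unfolding Q_def using VG[of k] k \<open>norm (V k) \<le> K\<close> nz
      by (metis (mono_tags, lifting) DiffI abs_0_eq image_eqI mem_Collect_eq singletonD)
    then have "m \<le> \<bar>q (row2 g)\<bar>" using finQ by (simp add: m_def)
    also have "\<dots> \<le> 2 * (norm (row2 g) * (K * norm (row2 g)))"
      unfolding q_def using abs_wedge_le[of "row2 g" "ract (row2 g) h"] nK[of "row2 g"]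
      by (meson mult_left_mono norm_ge_zero order_trans zero_le_numeral)
    also have "\<dots> \<le> 2 * (norm (row2 g) * (K * 1))"
      using g(2) K by (intro mult_left_mono) (auto simp: e_def)
    also have "\<dots> < m" using g(2) K by (simp add: e_def field_simps)
    finally show False by simp
  qed
  ultimately show ?thesis unfolding q_def by blast
qed

text \<open>If all traces are at most 2 in absolute value, then for g with a short bottom row the
  trace of g bounds a, and the trace of g \<delta> for one fixed \<delta> moving infinity bounds b;
  such g are finite in number. If everything fixes infinity, a short row \<open>(0, d)\<close>
  itself makes the trace \<open>1/d + d\<close> large.\<close>

lemma exists_hyperbolic:
  assumes "\<not> (\<exists>e>0. \<forall>g\<in>G. e \<le> norm (row2 g))"
  shows "\<exists>h\<in>G. \<bar>mtrace h\<bar> > 2"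
proof (rule ccontr)
  assume no: "\<not> ?thesis"
  then have tr: "\<bar>mtrace g\<bar> \<le> 2" if "g \<in> G" for g using that by force
  have "\<exists>e>0. \<forall>g\<in>G. e \<le> norm (row2 g)"
  proof (cases "\<forall>\<delta>\<in>G. fst (row2 \<delta>) = 0")
    case True
    have "1/3 \<le> norm (row2 g)" if "g \<in> G" for g
    proof (rule ccontr)
      assume lt: "\<not> ?thesis"
      obtain a b c d where g: "g = (a,b,c,d)" by (cases g)
      have c: "c = 0" using True that g by force
      then have ad: "a * d = 1" using in_SL2[OF that] by (simp add: g SL2_iff)
      have "\<bar>d\<bar> < 1/3" using lt c by (simp add: g norm_Pair)
      moreover have "\<bar>a\<bar> * \<bar>d\<bar> = 1" using ad by (simp flip: abs_mult)
      ultimately have "\<bar>a\<bar> > 3"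
        using mult_mono[of "\<bar>a\<bar>" 3 "\<bar>d\<bar>" "\<bar>d\<bar>"] by (cases "\<bar>a\<bar> \<le> 3") auto
      then have "\<bar>a + d\<bar> > 2" using \<open>\<bar>d\<bar> < 1/3\<close> by linarith
      then show False using tr[OF that] g by simp
    qed
    then show ?thesis by (intro exI[of _ "1/3"]) auto
  next
    case False
    then obtain \<delta> where d1: "\<delta> \<in> G" "fst (row2 \<delta>) \<noteq> 0" by blast
    obtain e f k l where \<delta>: "\<delta> = (e,f,k,l)" by (cases \<delta>)
    have k: "k \<noteq> 0" using d1 \<delta> by simp
    define B where "B = (2 + 3*\<bar>e\<bar> + \<bar>f\<bar> + \<bar>l\<bar>) / \<bar>k\<bar>"
    define F where "F = {g \<in> G. norm (row2 g) < 1}"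
    have "norm g \<le> 3 + B + 1 + 1" if "g \<in> F" for g
    proof -
      obtain a b c d where g: "g = (a,b,c,d)" by (cases g)
      have gG: "g \<in> G" "norm (c,d) < 1" using that by (auto simp: F_def g)
      have cd: "\<bar>c\<bar> \<le> 1" "\<bar>d\<bar> \<le> 1" using gG(2) norm_fst_le[of c d] norm_snd_le[of d c] by auto
      have a: "\<bar>a\<bar> \<le> 3" using tr[OF gG(1)] cd by (simp add: g)
      have "\<bar>a*e + b*k + (c*f + d*l)\<bar> \<le> 2" using tr[OF mmul_in[OF gG(1) d1(1)]] by (simp add: g \<delta>)
      moreover have "\<bar>a*e\<bar> \<le> 3*\<bar>e\<bar>" "\<bar>c*f\<bar> \<le> 1 * \<bar>f\<bar>" "\<bar>d*l\<bar> \<le> 1 * \<bar>l\<bar>"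
        using a cd unfolding abs_mult by (intro mult_right_mono; simp)+
      ultimately have "\<bar>b*k\<bar> \<le> 2 + 3*\<bar>e\<bar> + \<bar>f\<bar> + \<bar>l\<bar>" by linarith
      then have "\<bar>b\<bar> \<le> B" using k by (simp add: B_def abs_mult pos_le_divide_eq)
      then show ?thesis using norm_mat2_le[of a b c d] a cd by (simp add: g)
    qed
    then have "bounded F" unfolding bounded_iff by blast
    then have fin: "finite F" by (intro finite_of_bounded) (auto simp: F_def)
    define m where "m = Min (insert 1 ((\<lambda>g. norm (row2 g)) ` F))"
    have "row2 g \<noteq> 0" if "g \<in> G" for g
      using in_SL2[OF that] by (cases g) (auto simp: SL2_iff zero_prod_def)
    then have "m > 0" using fin by (auto simp: m_def F_def)
    moreover have "m \<le> norm (row2 g)" if "g \<in> G" for g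
    proof (cases "norm (row2 g) < 1")
      case True then show ?thesis using that fin by (auto simp: m_def F_def intro!: Min_le)
    next
      case False
      have "m \<le> 1" using fin by (auto simp: m_def intro: Min_le)
      then show ?thesis using False by simp
    qed
    ultimately show ?thesis by blast
  qed
  then show False using assms by blast
qed

end

section \<open>Elementary groups and the critical exponent\<close>

lemma summable_on_int_geometric:
  fixes r :: real assumes "0 \<le> r" "r < 1"
  shows "(\<lambda>k::int. r ^ nat \<bar>k\<bar>) summable_on UNIV"
proof -
  have s: "(\<lambda>n. r ^ n) summable_on (UNIV :: nat set)"
    using assms by (subst summable_on_UNIV_nonneg_real_iff) auto
  have 1: "(\<lambda>k::int. r ^ nat \<bar>k\<bar>) summable_on range int"
    using s by (subst summable_on_reindex) (auto simp: o_def)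
  have 2: "(\<lambda>k::int. r ^ nat \<bar>k\<bar>) summable_on range (\<lambda>n. - int n)"
    using s by (subst summable_on_reindex) (auto simp: o_def inj_on_def)
  have "(UNIV :: int set) = range int \<union> range (\<lambda>n. - int n)"
  proof -
    have "k \<in> range int \<union> range (\<lambda>n. - int n)" for k :: int
      by (cases k rule: int_cases2) auto
    then show ?thesis by blast
  qed
  then show ?thesis using summable_on_union[OF 1 2] by simp
qed

lemma summable_on_ge_1_finite:
  fixes f :: "'a \<Rightarrow> real"
  assumes "f summable_on A" "\<And>x. x \<in> A \<Longrightarrow> f x \<ge> 1" shows "finite A"
proof (rule ccontr)
  assume "infinite A"
  then obtain h :: "nat \<Rightarrow> 'a" where h: "inj h" "range h \<subseteq> A"
    using infinite_countable_subset by blast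
  have "f summable_on range h" using assms(1) h(2) summable_on_subset by blast
  then have "(f \<circ> h) summable_on UNIV" using h(1) by (simp add: summable_on_reindex)
  then have "summable (f \<circ> h)" by (rule summable_on_imp_summable)
  then have "(f \<circ> h) \<longlonglongrightarrow> 0" by (rule summable_LIMSEQ_zero)
  moreover have "(f \<circ> h) n \<ge> 1" for n using assms(2) h(2) by auto
  ultimately have "1 \<le> (0::real)" using LIMSEQ_le_const by blast
  then show False by simp
qed

context horocycle_closed begin

text \<open>The infimum is meaningful only for a set bounded below: in an infinite group every term
  with a negative exponent is at least 1, so such exponents are excluded.\<close>

lemma critical_exponent_le:
  assumes "infinite G" "(\<lambda>g. norm g powr (-s)) summable_on G"
  shows "critical_exponent G \<le> s"
  unfolding critical_exponent_def
proof (rule cInf_lower)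
  show "bdd_below {s. (\<lambda>g. norm g powr - s) summable_on G}"
  proof (rule bdd_belowI[of _ 0])
    fix t assume t: "t \<in> {s. (\<lambda>g. norm g powr - s) summable_on G}"
    show "0 \<le> t"
    proof (rule ccontr)
      assume "\<not> 0 \<le> t"
      then have "norm g powr - t \<ge> 1" if "g \<in> G" for g
        using norm_SL2_ge_1[OF in_SL2[OF that]] ge_one_powr_ge_zero by simp
      with t summable_on_ge_1_finite[of "\<lambda>g. norm g powr - t" G] assms(1) show False by simp
    qed
  qed
qed (use assms in simp)

text \<open>If short rows exist, then \<open>G\<close> contains a hyperbolic element fixing infinity, all its hyperbolic
  elements fix infinity, and up to index two so does \<open>G\<close>; the diagonal entry is then injective
  with discrete image, so the Poincare series is dominated by a geometric series.\<close>

lemma upper_triangular_hyperbolic: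
  assumes "\<not> (\<exists>e>0. \<forall>g\<in>G. e \<le> norm (row2 g))"
  obtains \<alpha> \<beta> l where "(\<alpha>,\<beta>,0,l) \<in> G" "\<alpha> * l = 1" "\<bar>l\<bar> < 1" "\<bar>\<alpha> + l\<bar> > 2"
proof -
  obtain h where h: "h \<in> G" "\<bar>mtrace h\<bar> > 2" using exists_hyperbolic[OF assms] by blast
  obtain e where e: "e > 0" "\<And>g. g \<in> G \<Longrightarrow> norm (row2 g) < e \<Longrightarrow> wedge (row2 g) (ract (row2 g) h) = 0"
    using short_rows_eigenvectors[OF h] by blast
  obtain g where g: "g \<in> G" "norm (row2 g) < e" using assms e(1) by (meson not_le)
  obtain a b c d where gg: "g = (a,b,c,d)" by (cases g)
  obtain p q r t where hh: "h = (p,q,r,t)" by (cases h)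
  obtain \<alpha> \<beta> \<gamma> l where H: "mmul (mmul g h) (minv g) = (\<alpha>,\<beta>,\<gamma>,l)" by (cases "mmul (mmul g h) (minv g)")
  have HG: "(\<alpha>,\<beta>,\<gamma>,l) \<in> G" unfolding H[symmetric] using g h by (intro mmul_in minv_in)
  \<comment> \<open>Conjugating by an element with a short row: that the row is an eigenvector of h
    says that the conjugate of h fixes infinity.\<close>
  have "\<gamma> = - wedge (row2 g) (ract (row2 g) h)"
    using H by (simp add: gg hh wedge_def algebra_simps)
  then have \<gamma>: "\<gamma> = 0" using e(2) g by simp
  have "\<alpha> + l = (a*d - b*c) * (p + t)" using H by (simp add: gg hh algebra_simps)
  then have tr: "\<bar>\<alpha> + l\<bar> > 2" using h(2) in_SL2[OF g(1)] by (simp add: gg hh SL2_iff)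
  have det: "\<alpha> * l = 1" using in_SL2[OF HG] \<gamma> by (simp add: SL2_iff)
  have "\<bar>l\<bar> \<noteq> 1"
  proof
    assume "\<bar>l\<bar> = 1"
    then have "l = 1 \<or> l = -1" by auto
    then show False using det tr by auto
  qed
  show thesis
  proof (cases "\<bar>l\<bar> < 1")
    case True then show ?thesis using that[of \<alpha> \<beta> l] HG \<gamma> det tr by simp
  next
    case False
    have "(l, -\<beta>, 0, \<alpha>) \<in> G" using minv_in[OF HG] \<gamma> by simp
    moreover have "\<bar>\<alpha>\<bar> < 1"
    proof -
      have "\<bar>l\<bar> > 1" "\<bar>\<alpha>\<bar> * \<bar>l\<bar> = 1" using False \<open>\<bar>l\<bar> \<noteq> 1\<close> det by (auto simp flip: abs_mult)
      then show ?thesis using mult_mono[of 1 "\<bar>\<alpha>\<bar>" 1 "\<bar>l\<bar>"] by (smt (verit) mult_cancel_right2 mult_less_cancel_left1 mult.commute)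
    qed
    ultimately show ?thesis using that[of l "-\<beta>" \<alpha>] det tr by (simp add: mult.commute add.commute)
  qed
qed

lemma rows_bounded_below:
  assumes crit: "critical_exponent G > 1/2"
  shows "\<exists>e>0. \<forall>g\<in>G. e \<le> norm (row2 g)"
proof (rule ccontr)
  assume no: "\<not> ?thesis"
  obtain \<alpha> \<beta> l where h: "(\<alpha>,\<beta>,0,l) \<in> G" "\<alpha> * l = 1" "\<bar>l\<bar> < 1" "\<bar>\<alpha> + l\<bar> > 2"
    using upper_triangular_hyperbolic[OF no] by blast
  define V0 where "V0 = {d. (0,d) \<in> row2 ` G}"
  have l0: "l \<noteq> 0" "\<alpha> = 1 / l"
  proof -
    show "l \<noteq> 0" using h(2) by auto
    then show "\<alpha> = 1 / l" using h(2) by (simp add: eq_divide_eq)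
  qed
  have V0mult: "d * l \<in> V0" "d / l \<in> V0" if dV: "d \<in> V0" for d
  proof -
    obtain g where g: "g \<in> G" "row2 g = (0,d)" using dV unfolding V0_def by (metis (mono_tags, lifting) imageE mem_Collect_eq)
    have "row2 (mmul g (\<alpha>,\<beta>,0,l)) = (0, d*l)" "row2 (mmul g (minv (\<alpha>,\<beta>,0,l))) = (0, d/l)"
      by (simp_all add: row2_mmul g l0)
    then show "d * l \<in> V0" "d / l \<in> V0" unfolding V0_def using g h mmul_in minv_in
      by (metis (mono_tags, lifting) imageI mem_Collect_eq)+
  qed
  have one: "1 \<in> V0" unfolding V0_def using mid_in by (force simp: mid_def image_iff)
  have V0pow: "d * l powi k \<in> V0" if dV: "d \<in> V0" for d k
  proof -
    have "d * l ^ n \<in> V0 \<and> d / l ^ n \<in> V0" for n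
    proof (induction n)
      case 0 then show ?case using dV by simp
    next
      case (Suc n)
      then have "(d * l ^ n) * l \<in> V0" "(d / l ^ n) / l \<in> V0" using V0mult by blast+
      then show ?case by (simp add: mult.commute mult.left_commute)
    qed
    then show ?thesis
      by (cases "k \<ge> 0") (auto simp: power_int_def field_simps power_inverse)
  qed
  \<comment> \<open>The rows \<open>(0, l^n)\<close> become arbitrarily short, so
    \<open>(0, 1)\<close> is an eigenvector of every hyperbolic element.\<close>
  have upper: "c = 0" if gG: "(a,b,c,d) \<in> G" "\<bar>a + d\<bar> > 2" for a b c d
  proof -
    obtain e where e: "e > 0" "\<And>g. g \<in> G \<Longrightarrow> norm (row2 g) < e \<Longrightarrow> wedge (row2 g) (ract (row2 g) (a,b,c,d)) = 0"
      using short_rows_eigenvectors[of "(a,b,c,d)"] gG by auto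
    obtain n where n: "\<bar>l\<bar> ^ n < e" using real_arch_pow_inv[OF e(1) h(3)] by blast
    have "l ^ n \<in> V0" using V0pow[OF one, of "int n"] by simp
    then obtain g where g: "g \<in> G" "row2 g = (0, l^n)" unfolding V0_def by (metis (mono_tags, lifting) imageE mem_Collect_eq)
    have "wedge (0, l^n) (ract (0, l^n) (a,b,c,d)) = 0"
      using e(2)[OF g(1)] n by (simp add: g(2) norm_Pair power_abs)
    then show ?thesis using l0 by (simp add: wedge_def)
  qed
  \<comment> \<open>The second fixed point of the hyperbolic element is \<open>-\<kappa>\<close>. An
    element g conjugates it to a hyperbolic element, which again fixes infinity, so g maps infinity
    or \<open>-\<kappa>\<close> to infinity; the latter means \<open>d = \<kappa> c\<close>.\<close>
  define \<kappa> where "\<kappa> = \<beta> / (\<alpha> - l)"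
  have "\<alpha> \<noteq> l"
  proof
    assume "\<alpha> = l"
    then have "\<bar>l\<bar> * \<bar>l\<bar> = 1" using h(2) by (simp flip: abs_mult)
    moreover have "\<bar>l\<bar> * \<bar>l\<bar> \<le> \<bar>l\<bar> * 1" using h(3) by (intro mult_left_mono) auto
    ultimately show False using h(3) by simp
  qed
  have flip: "c = 0 \<or> d = \<kappa> * c" if gG: "(a,b,c,d) \<in> G" for a b c d
  proof -
    have ad: "a*d - b*c = 1" using in_SL2[OF gG] SL2_iff by blast
    have "mmul (mmul (a,b,c,d) (\<alpha>,\<beta>,0,l)) (minv (a,b,c,d)) =
       (a*\<alpha>*d - (a*\<beta>+b*l)*c, (a*\<beta>+b*l)*a - a*\<alpha>*b, c*\<alpha>*d - (c*\<beta>+d*l)*c, (c*\<beta>+d*l)*a - c*\<alpha>*b)" (is "_ = (?A,?B,?C,?D)")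
      by (simp add: algebra_simps)
    then have "(?A,?B,?C,?D) \<in> G" using gG h(1) mmul_in minv_in by metis
    moreover have "?A + ?D = (a*d - b*c) * (\<alpha> + l)" by (simp add: algebra_simps)
    ultimately have "?C = 0" using upper[of ?A ?B ?C ?D] h(4) ad by simp
    then have "c * (d * (\<alpha> - l) - c * \<beta>) = 0" by (simp add: algebra_simps)
    then have "c = 0 \<or> d * (\<alpha> - l) = \<beta> * c" by (simp add: mult.commute)
    then show ?thesis using \<open>\<alpha> \<noteq> l\<close> unfolding \<kappa>_def times_divide_eq_left by (metis eq_divide_eq right_minus_eq)
  qed
  define G0 where "G0 = {g \<in> G. fst (row2 g) = 0}"
  define dd where "dd g = snd (row2 g)" for g
  have G0D: "g \<in> G" "row2 g = (0, dd g)" "dd g \<in> V0" "dd g \<noteq> 0" "norm g \<ge> \<bar>dd g\<bar>" "norm g \<ge> 1 / \<bar>dd g\<bar>"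
    if g0: "g \<in> G0" for g
  proof -
    obtain a b c d where g: "g = (a,b,c,d)" by (cases g)
    have 1: "g \<in> G" "c = 0" using g0 by (auto simp: G0_def g)
    then have ad: "a * d = 1" using in_SL2[OF 1(1)] by (simp add: g SL2_iff)
    then have "d \<noteq> 0" by auto
    then have "a = 1 / d" using ad by (simp add: eq_divide_eq)
    then show "g \<in> G" "row2 g = (0, dd g)" "dd g \<in> V0" "dd g \<noteq> 0" "norm g \<ge> \<bar>dd g\<bar>" "norm g \<ge> 1 / \<bar>dd g\<bar>"
      using 1 \<open>d \<noteq> 0\<close> norm_mat2_entries(1)[of a b c d] norm_mat2_entries(4)[of d a b c]
      by (force simp: dd_def V0_def g image_iff)+
  qed
  \<comment> \<open>Two upper triangular elements with the same diagonal differ by a unipotent one,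
    which is trivial by \<open>trivGN\<close>.\<close>
  have dd_inj: "inj_on dd G0"
  proof (rule inj_onI)
    fix x y assume xy: "x \<in> G0" "y \<in> G0" "dd x = dd y"
    obtain a b c d where x: "x = (a,b,c,d)" by (cases x)
    obtain a' b' c' d' where y: "y = (a',b',c',d')" by (cases y)
    have e: "c = 0" "c' = 0" "d = d'" using G0D(2)[OF xy(1)] G0D(2)[OF xy(2)] xy(3) by (auto simp: x y dd_def)
    have det: "a * d = 1" "a' * d = 1"
      using in_SL2[OF G0D(1)[OF xy(1)]] in_SL2[OF G0D(1)[OF xy(2)]] e by (auto simp: x y SL2_iff)
    then have "a = a'" by (metis mult_right_cancel mult_zero_right zero_neq_one)
    have "mmul x (minv y) = nx (a * (-b') + b * a)" using e det \<open>a = a'\<close> by (simp add: x y nx_def mult.commute)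
    moreover have "mmul x (minv y) \<in> G" using xy G0D by (intro mmul_in minv_in) auto
    ultimately have "mmul x (minv y) = mid" using trivGN by (auto simp: Nsub_def)
    then have "mmul (mmul x (minv y)) y = y" by simp
    then show "x = y" using in_SL2[OF G0D(1)[OF xy(2)]] by (simp add: mmul_cancel_right)
  qed
  define L where "L = - ln \<bar>l\<bar>"
  have L: "L > 0" using h(3) l0 by (simp add: L_def)
  \<comment> \<open>A fundamental annulus for multiplication by \<open>l\<close>; local finiteness
    of the rows leaves finitely many diagonal entries in it.\<close>
  define D0 where "D0 = V0 \<inter> {d. \<bar>l\<bar> \<le> \<bar>d\<bar> \<and> \<bar>d\<bar> \<le> 1}"
  have "finite D0"
  proof (rule finite_subset)
    show "finite (snd ` {v \<in> row2 ` G. \<bar>l\<bar> \<le> norm v \<and> norm v \<le> 1})"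
      using rows_locally_finite[of "\<bar>l\<bar>" 1] l0 by simp
    show "D0 \<subseteq> snd ` {v \<in> row2 ` G. \<bar>l\<bar> \<le> norm v \<and> norm v \<le> 1}"
    proof
      fix d assume "d \<in> D0"
      then have "(0,d) \<in> {v \<in> row2 ` G. \<bar>l\<bar> \<le> norm v \<and> norm v \<le> 1}"
        unfolding D0_def V0_def mem_Collect_eq Int_iff by (simp only: norm_Pair) simp
      then show "d \<in> snd ` {v \<in> row2 ` G. \<bar>l\<bar> \<le> norm v \<and> norm v \<le> 1}" using imageI[of "(0,d)" _ snd] by (simp only: snd_conv)
    qed
  qed
  define k where "k d = \<lfloor>- ln \<bar>d\<bar> / L\<rfloor>" for d
  define idx where "idx d = (k d, d * l powi (- k d))" for d
  have abs_powi: "\<bar>l powi j\<bar> = exp (- L * of_int j)" for j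
  proof -
    have "\<bar>l powi j\<bar> = \<bar>l\<bar> powi j" by (simp add: power_int_abs)
    also have "\<bar>l\<bar> = exp (- L)" using l0 by (simp add: L_def)
    finally show ?thesis by (simp add: exp_power_int mult.commute)
  qed
  have kbound: "of_int (k d) * L \<le> - ln \<bar>d\<bar>" "- ln \<bar>d\<bar> \<le> (of_int (k d) + 1) * L" for d
  proof -
    define u where "u = - ln \<bar>d\<bar> / L"
    have "u * L = - ln \<bar>d\<bar>" using L by (simp add: u_def)
    moreover have "of_int \<lfloor>u\<rfloor> * L \<le> u * L" "u * L \<le> (of_int \<lfloor>u\<rfloor> + 1) * L"
      using L by (intro mult_right_mono; linarith)+
    ultimately show "of_int (k d) * L \<le> - ln \<bar>d\<bar>" "- ln \<bar>d\<bar> \<le> (of_int (k d) + 1) * L"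
      unfolding k_def u_def[symmetric] by simp_all
  qed
  have idx_in: "idx d \<in> UNIV \<times> D0" if "d \<in> V0" "d \<noteq> 0" for d
  proof -
    have "\<bar>d * l powi (- k d)\<bar> = exp (ln \<bar>d\<bar> + L * of_int (k d))"
      using that by (simp add: abs_mult abs_powi exp_add)
    moreover have "\<bar>l\<bar> = exp (- L)" using l0 by (simp add: L_def)
    ultimately have "\<bar>l\<bar> \<le> \<bar>d * l powi (- k d)\<bar>" "\<bar>d * l powi (- k d)\<bar> \<le> 1"
      using kbound[of d] by (simp_all add: algebra_simps)
    then show ?thesis using V0pow[OF that(1)] by (simp add: idx_def D0_def)
  qed
  have idx_inj: "inj_on idx UNIV"
    by (rule inj_onI) (use l0 in \<open>auto simp: idx_def power_int_eq_0_iff\<close>)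
  \<comment> \<open>Any exponent in (0, 1/2] would serve, since the geometric series converges for
    every positive one.\<close>
  define s :: real where "s = 1/4"
  define r where "r = exp (- (s * L))"
  have r: "0 \<le> r" "r < 1" using L by (auto simp: r_def s_def)
  \<comment> \<open>The factor \<open>exp (s * L)\<close> makes up for rounding in \<open>k\<close>,
    which may cost one step of length L.\<close>
  define w where "w = (\<lambda>(j::int, d::real). exp (s * L) * r ^ nat \<bar>j\<bar>)"
  have wsum: "w summable_on UNIV \<times> D0"
  proof (rule summable_on_SigmaI)
    show "((\<lambda>y. w (x, y)) has_sum (real (card D0) * exp (s*L)) * r ^ nat \<bar>x\<bar>) D0" for x
      using has_sum_finite[OF \<open>finite D0\<close>, of "\<lambda>y. w (x,y)"] by (simp add: w_def mult.assoc)
    show "(\<lambda>x::int. (real (card D0) * exp (s*L)) * r ^ nat \<bar>x\<bar>) summable_on UNIV"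
      by (intro summable_on_cmult_right summable_on_int_geometric r)
  qed (use r in \<open>auto simp: w_def\<close>)
  have inj': "inj_on (\<lambda>g. idx (dd g)) G0"
    using comp_inj_on[OF dd_inj inj_on_subset[OF idx_inj]] by (simp add: o_def)
  have "w summable_on (\<lambda>g. idx (dd g)) ` G0"
    by (rule summable_on_subset[OF wsum]) (use idx_in G0D in \<open>blast\<close>)
  then have w1: "(\<lambda>g. w (idx (dd g))) summable_on G0"
    using inj' by (simp add: summable_on_reindex o_def)
  have sum0: "(\<lambda>g. norm g powr - s) summable_on G0"
  proof (rule summable_on_comparison_test[OF w1])
    fix g assume g: "g \<in> G0"
    define d where "d = dd g"
    have d: "d \<noteq> 0" "norm g \<ge> \<bar>d\<bar>" "norm g \<ge> 1 / \<bar>d\<bar>" using G0D[OF g] by (auto simp: d_def)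
    have "exp \<bar>ln \<bar>d\<bar>\<bar> \<le> norm g"
    proof (cases "ln \<bar>d\<bar> \<ge> 0")
      case True then show ?thesis using d by simp
    next
      case False then show ?thesis using d by (simp add: exp_minus field_simps)
    qed
    moreover have "real (nat \<bar>k d\<bar>) * L - L \<le> \<bar>ln \<bar>d\<bar>\<bar>"
      using kbound[of d] L by (cases "k d \<ge> 0") (auto simp: algebra_simps abs_if)
    ultimately have "exp (real (nat \<bar>k d\<bar>) * L - L) \<le> norm g" by (meson exp_le_cancel_iff order_trans)
    then have "norm g powr - s \<le> exp (real (nat \<bar>k d\<bar>) * L - L) powr - s"
      by (intro powr_mono2') (auto simp: s_def)
    also have "\<dots> = exp (- s * (real (nat \<bar>k d\<bar>) * L - L))" by (simp add: powr_def)
    also have "\<dots> = w (idx d)"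
      by (simp add: w_def idx_def r_def exp_of_nat_mult[symmetric] algebra_simps flip: exp_add)
    finally show "norm g powr - s \<le> w (idx (dd g))" by (simp add: d_def)
  qed simp
  have sum1: "(\<lambda>g. norm g powr - s) summable_on (G - G0)"
  proof (cases "G - G0 = {}")
    case True
    show ?thesis unfolding True by simp
  next
    case False
    then obtain u where u: "u \<in> G" "u \<notin> G0" by blast
    \<comment> \<open>Elements outside \<open>G0\<close> have bottom rows proportional to
      \<open>(1, \<kappa>)\<close>, so they form a single right coset \<open>G0 u\<close>, on which
      norms change by a bounded factor.\<close>
    define m where "m g = mmul g (minv u)" for g
    have uS: "u \<in> SL2" using u in_SL2 by blast
    have m: "m g \<in> G0" if "g \<in> G - G0" for g
    proof -
      obtain a b c d where g: "g = (a,b,c,d)" by (cases g)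
      obtain a' b' c' d' where u': "u = (a',b',c',d')" by (cases u)
      have "c \<noteq> 0" "c' \<noteq> 0" using that u by (auto simp: G0_def g u')
      then have "d = \<kappa> * c" "d' = \<kappa> * c'" using flip that u g u' by auto
      then have "fst (row2 (m g)) = 0" by (simp add: m_def g u')
      then show ?thesis using that u by (auto simp: G0_def m_def intro: mmul_in minv_in)
    qed
    have minj: "inj_on m (G - G0)"
      by (rule inj_onI) (metis m_def mmul_cancel_right(2) uS)
    have "(\<lambda>g. norm g powr - s) summable_on m ` (G - G0)"
      by (rule summable_on_subset[OF sum0]) (use m in blast)
    then have "(\<lambda>g. norm (m g) powr - s) summable_on (G - G0)"
      using minj by (simp add: summable_on_reindex o_def)
    then have "(\<lambda>g. (8 * norm u) powr s * norm (m g) powr - s) summable_on (G - G0)"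
      by (rule summable_on_cmult_right)
    then show ?thesis
    proof (rule summable_on_comparison_test)
      fix g assume g: "g \<in> G - G0"
      have mS: "m g \<in> SL2" using m[OF g] G0D(1) in_SL2 by blast
      have n1: "norm (m g) \<ge> 1" "norm u \<ge> 1" using norm_SL2_ge_1 mS uS by auto
      have "norm (m g) \<le> 8 * norm u * norm g" using norm_mmul_le[of g "minv u"] by (simp add: m_def mult.commute mult.left_commute)
      then have "norm (m g) / (8 * norm u) \<le> norm g" using n1
        by (subst pos_divide_le_eq) (auto simp: mult.commute)
      then have "norm g powr - s \<le> (norm (m g) / (8 * norm u)) powr - s"
        using n1 by (intro powr_mono2' divide_pos_pos) (auto simp: s_def simp del: zero_less_norm_iff)
      also have "\<dots> = (8 * norm u) powr s * norm (m g) powr - s"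
        using n1 by (simp add: powr_divide powr_minus field_simps)
      finally show "norm g powr - s \<le> (8 * norm u) powr s * norm (m g) powr - s" .
    qed simp
  qed
  have "infinite G"
  proof
    assume fin: "finite G"
    define m where "m = Min ((\<lambda>g. norm (row2 g)) ` G)"
    have "row2 g \<noteq> 0" if "g \<in> G" for g
      using in_SL2[OF that] by (cases g) (auto simp: SL2_iff zero_prod_def)
    then have "m > 0" using fin mid_in by (subst m_def, subst Min_gr_iff) auto
    moreover have "m \<le> norm (row2 g)" if "g \<in> G" for g using that fin by (simp add: m_def)
    ultimately show False using no by blast
  qed
  have "G0 \<subseteq> G" by (auto simp: G0_def)
  then have "(\<lambda>g. norm g powr - s) summable_on G"
    using summable_on_union[OF sum0 sum1] by (simp add: Un_absorb1)
  then have "critical_exponent G \<le> s" using critical_exponent_le \<open>infinite G\<close> by blast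
  then show False using crit by (simp add: s_def)
qed

end

section \<open>Boundedness of the orbit\<close>

lemma path_component_convex:
  fixes T :: "'a::real_normed_vector set"
  assumes "convex T" "T \<subseteq> S" "a \<in> T" "b \<in> T" shows "path_component S a b"
proof -
  have "path_connected T" using assms(1) by (rule convex_imp_path_connected)
  then have "path_component T a b" using assms(3,4) path_connected_component by blast
  then show ?thesis using assms(2) path_component_of_subset by blast
qed

lemma path_component_continuous_image:
  assumes "path_component S x y" "continuous_on S f" "f ` S \<subseteq> T"
  shows "path_component T (f x) (f y)"
proof -
  obtain g where g: "path g" "path_image g \<subseteq> S" "pathstart g = x" "pathfinish g = y"
    using assms(1) by (auto simp: path_component_def)
  have "path (f \<circ> g)" using g assms(2) by (intro path_continuous_image) (auto intro: continuous_on_subset)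
  moreover have "path_image (f \<circ> g) \<subseteq> T" using g(2) assms(3) by (auto simp: path_image_compose)
  ultimately show ?thesis using g unfolding path_component_def
    by (intro exI[of _ "f \<circ> g"]) (auto simp: pathstart_compose pathfinish_compose)
qed

lemma path_component_compact:
  assumes "path_component S x y"
  obtains A where "A \<subseteq> S" "compact A" "path_component A x y"
  using assms unfolding path_component_def by (metis compact_path_image order_refl)

text \<open>The two paths lie in a rectangle with its lower edge on the real axis, and their four
  endpoints alternate along that edge: this is the Fashoda theorem, transported to
  \<open>real^2\<close> by \<open>J\<close>.\<close>

lemma interlaced_paths_meet:
  fixes x1 x2 x3 x4 :: real
  assumes A: "path_component A (of_real x1) (of_real x3)" and B: "path_component B (of_real x2) (of_real x4)"
    and A0: "A \<subseteq> {z. Im z \<ge> 0}" and B0: "B \<subseteq> {z. Im z \<ge> 0}"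
    and ord: "x1 < x2" "x2 < x3" "x3 < x4"
  shows "A \<inter> B \<noteq> {}"
proof -
  define J :: "complex \<Rightarrow> real^2" where "J z = vector [Re z, Im z]" for z
  have J: "J z $ 1 = Re z" "J z $ 2 = Im z" for z by (simp_all add: J_def vector_2)
  have Jinj: "J z = J w \<Longrightarrow> z = w" for z w by (metis J complex_eqI)
  have Jc: "continuous_on S J" for S
  proof -
    have "J = (\<lambda>z. \<chi> i. if i = 1 then Re z else Im z)"
      by (auto simp: fun_eq_iff vec_eq_iff forall_2 J)
    moreover have "continuous_on S (\<lambda>z. \<chi> i. if i = (1::2) then Re z else Im z)"
    proof (rule continuous_on_vec_lambda)
      show "continuous_on S (\<lambda>z. if i = (1::2) then Re z else Im z)" for i
        by (cases "i = 1") (auto intro!: continuous_intros)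
    qed
    ultimately show ?thesis by simp
  qed
  obtain f where f: "path f" "path_image f \<subseteq> A" "pathstart f = of_real x1" "pathfinish f = of_real x3"
    using A by (auto simp: path_component_def)
  obtain g where g: "path g" "path_image g \<subseteq> B" "pathstart g = of_real x2" "pathfinish g = of_real x4"
    using B by (auto simp: path_component_def)
  have "bounded (path_image f \<union> path_image g)"
    using f(1) g(1) by (simp add: bounded_path_image)
  then obtain M where M: "\<And>z. z \<in> path_image f \<union> path_image g \<Longrightarrow> norm z \<le> M" by (auto simp: bounded_iff)
  have box: "J z \<in> cbox (vector [-M, 0]) (vector [M, M])" if "z \<in> path_image f \<union> path_image g" for z
  proof -
    have "0 \<le> Im z" using that f(2) g(2) A0 B0 by blast
    then show ?thesis using M[OF that] abs_Re_le_cmod[of z] abs_Im_le_cmod[of z]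
      by (auto simp: mem_box_cart forall_2 J vector_2)
  qed
  obtain z where z: "z \<in> path_image (J \<circ> f)" "z \<in> path_image (J \<circ> g)"
  proof (rule fashoda_interlace[of "J \<circ> f" "J \<circ> g" "vector [-M, 0]" "vector [M, M]"])
    show "path (J \<circ> f)" "path (J \<circ> g)" using f(1) g(1) Jc by (auto intro: path_continuous_image)
    show "path_image (J \<circ> f) \<subseteq> cbox (vector [-M, 0]) (vector [M, M])"
      "path_image (J \<circ> g) \<subseteq> cbox (vector [-M, 0]) (vector [M, M])"
      using box by (auto simp: path_image_compose)
  qed (use f g ord in \<open>auto simp: pathstart_compose pathfinish_compose J vector_2\<close>)
  then obtain a b where ab: "a \<in> path_image f" "b \<in> path_image g" "J a = J b"
    by (auto simp: path_image_compose)
  then show ?thesis using Jinj f(2) g(2) by blast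
qed

lemma interlaced_paths_meet_sgn:
  fixes x1 x2 x3 x4 \<sigma> :: real
  assumes A: "path_component A (of_real x1) (of_real x3)" and B: "path_component B (of_real x2) (of_real x4)"
    and A0: "A \<subseteq> {z. Im z \<ge> 0}" and B0: "B \<subseteq> {z. Im z \<ge> 0}"
    and \<sigma>: "\<sigma> = 1 \<or> \<sigma> = -1"
    and ord: "\<sigma> * x1 < \<sigma> * x2" "\<sigma> * x2 < \<sigma> * x3" "\<sigma> * x3 < \<sigma> * x4"
  shows "A \<inter> B \<noteq> {}"
  using \<sigma>
proof
  assume "\<sigma> = 1" then show ?thesis using interlaced_paths_meet[OF A B A0 B0] ord by simp
next
  assume s: "\<sigma> = -1"
  define R where "R z = - cnj z" for z
  have R: "continuous_on S R" for S unfolding R_def by (intro continuous_intros)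
  have "path_component (R ` A) (of_real (-x1)) (of_real (-x3))"
    using path_component_continuous_image[OF A R order_refl] by (simp add: R_def)
  moreover have "path_component (R ` B) (of_real (-x2)) (of_real (-x4))"
    using path_component_continuous_image[OF B R order_refl] by (simp add: R_def)
  ultimately have "R ` A \<inter> R ` B \<noteq> {}"
    by (rule interlaced_paths_meet) (use A0 B0 ord s in \<open>auto simp: R_def\<close>)
  then obtain a b where "a \<in> A" "b \<in> B" "R a = R b" by blast
  then have "a = b" by (simp add: R_def)
  then show ?thesis using \<open>a \<in> A\<close> \<open>b \<in> B\<close> by blast
qed

lemma continuous_on_mob: assumes "g \<in> SL2" shows "continuous_on Hplane (mob g)"
proof -
  obtain a b c d where g: "g = (a,b,c,d)" by (cases g)
  have "continuous_on Hplane (\<lambda>z. (of_real a * z + of_real b) / (of_real c * z + of_real d))"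
    using mob_denom_nonzero assms unfolding g Hplane_def by (intro continuous_intros) auto
  then show ?thesis by (simp add: g)
qed

lemma continuous_on_ptd: "Im w > 0 \<Longrightarrow> continuous_on Hplane (\<lambda>z. ptd z w)"
  unfolding ptd_def Hplane_def by (intro continuous_intros) auto

text \<open>The points \<open>a / c\<close> and \<open>- d / c\<close> are the images of infinity
  under g and its inverse. In coordinates centred there, g is negative inversion scaled by
  \<open>1 / c^2\<close>.\<close>

lemma mob_minus_pole:
  assumes "(a,b,c,d) \<in> SL2" "c \<noteq> 0" "Im w > 0"
  shows "mob (a,b,c,d) w - of_real (a / c) = - 1 / (of_real (c^2) * (w - of_real (- d / c)))"
proof -
  have nz: "of_real c * w + complex_of_real d \<noteq> 0" using mob_denom_nonzero assms by blast
  have ad: "complex_of_real a * of_real d - of_real b * of_real c = 1"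
    using assms(1) by (simp add: SL2_iff flip: of_real_mult of_real_diff)
  have c: "complex_of_real c \<noteq> 0" using assms(2) by simp
  have "of_real (c^2) * (w - of_real (- d / c)) = of_real c * (of_real c * w + complex_of_real d)"
    using c by (simp add: power2_eq_square field_simps)
  moreover have "mob (a,b,c,d) w - of_real (a / c) =
     ((of_real a * w + of_real b) * of_real c - of_real a * (of_real c * w + of_real d)) / (of_real c * (of_real c * w + of_real d))"
    using nz c by (simp add: field_simps)
  moreover have "(of_real a * w + of_real b) * of_real c - of_real a * (of_real c * w + of_real d)
     = - (complex_of_real a * of_real d - of_real b * of_real c)" by (simp add: algebra_simps)
  ultimately show ?thesis using ad by simp
qed

section \<open>Neighbourhoods of the orbit\<close>

context discrete_SL2 begin

definition thick :: "real \<Rightarrow> complex set" where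
  "thick r = {z. Im z > 0 \<and> (\<exists>g\<in>G. ptd z (mob g \<i>) \<le> r)}"

lemma Im_orbit_pos: "g \<in> G \<Longrightarrow> Im (mob g \<i>) > 0"
  using Im_mob_pos[OF in_SL2, of g \<i>] by simp

lemma thick_mob: assumes "g \<in> G" "z \<in> thick r" shows "mob g z \<in> thick r"
proof -
  obtain h where h: "h \<in> G" "ptd z (mob h \<i>) \<le> r" and z: "Im z > 0" using assms(2) by (auto simp: thick_def)
  have "ptd (mob g z) (mob (mmul g h) \<i>) \<le> r"
    using h z assms(1) Im_orbit_pos in_SL2 by (simp add: mob_mmul ptd_mob)
  moreover have "Im (mob g z) > 0" using z assms(1) in_SL2 Im_mob_pos by blast
  moreover have "mmul g h \<in> G" using assms(1) h(1) mmul_in by blast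
  ultimately show ?thesis unfolding thick_def by blast
qed

text \<open>A bounded \<open>ptd\<close> to a point of K confines the height of the orbit point to a
  compact interval and its distance from \<open>\<i>\<close> to a bound; together they bound
  \<open>ptd\<close> to \<open>\<i>\<close>, that is, the norm of g. \<open>E\<close> records these
  bounds.\<close>

lemma finite_near_compact:
  assumes "compact K" "K \<subseteq> Hplane"
  shows "finite {g \<in> G. \<exists>z\<in>K. ptd z (mob g \<i>) \<le> r}" (is "finite ?F")
proof (cases "K = {}")
  case False
  obtain z0 where z0: "z0 \<in> K" "\<And>z. z \<in> K \<Longrightarrow> Im z0 \<le> Im z"
    using continuous_attains_inf[OF assms(1) False, of Im] continuous_on_Im[OF continuous_on_id] by blast
  define m where "m = Im z0"
  have m: "m > 0" using z0(1) assms(2) by (auto simp: m_def Hplane_def)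
  obtain B where B: "\<And>z. z \<in> K \<Longrightarrow> norm z \<le> B" using assms(1) compact_imp_bounded bounded_iff by metis
  have B0: "B \<ge> 0" using B[OF z0(1)] norm_ge_zero order_trans by blast
  define R where "R = max r 0"
  define E where "E = (B + sqrt (R * (B * ((R + 2) * B))) + 1)\<^sup>2 / (m / (R + 2)) + 2"
  have "norm g \<le> sqrt E" if gF: "g \<in> ?F" for g
  proof -
    obtain z where z: "z \<in> K" "ptd z (mob g \<i>) \<le> R" and gG: "g \<in> G"
      using gF max.coboundedI1 unfolding R_def mem_Collect_eq by metis
    define w where "w = mob g \<i>"
    have Iz: "Im z > 0" "Im w > 0" using z(1) assms(2) gG Im_orbit_pos by (auto simp: Hplane_def w_def)
    have zB: "Im z \<le> B" "m \<le> Im z" using B[OF z(1)] abs_Im_le_cmod[of z] z0(2)[OF z(1)] by (auto simp: m_def)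
    have R0: "R \<ge> 0" by (simp add: R_def)
    have w1: "Im w \<le> (R + 2) * Im z" using ptd_Im_le[of w z R] Iz z(2) by (simp add: ptd_commute w_def)
    also have "\<dots> \<le> (R + 2) * B" using zB R0 by (intro mult_left_mono) auto
    finally have wB: "Im w \<le> (R + 2) * B" .
    have "Im z / (R + 2) \<le> Im w" using ptd_Im_ge[of w z R] Iz z(2) by (simp add: ptd_commute w_def)
    moreover have "m / (R + 2) \<le> Im z / (R + 2)" using zB R0 by (intro divide_right_mono) auto
    ultimately have wm: "m / (R + 2) \<le> Im w" by simp
    have "(cmod (z - w))\<^sup>2 \<le> R * (Im z * Im w)" using ptd_dist_le[of z w R] Iz z(2) by (simp add: w_def)
    also have "\<dots> \<le> R * (B * ((R + 2) * B))" using R0 zB wB Iz B0 by (intro mult_left_mono mult_mono) auto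
    finally have "cmod (z - w) \<le> sqrt (R * (B * ((R + 2) * B)))" by (rule real_le_rsqrt)
    moreover have "cmod (w - \<i>) \<le> cmod (z - w) + cmod z + 1"
      using norm_triangle_ineq4[of w \<i>] norm_triangle_ineq4[of z "z - w"] by simp
    ultimately have "cmod (w - \<i>) \<le> B + sqrt (R * (B * ((R + 2) * B))) + 1" using B[OF z(1)] by linarith
    then have "(cmod (w - \<i>))\<^sup>2 \<le> (B + sqrt (R * (B * ((R + 2) * B))) + 1)\<^sup>2" by (intro power_mono) auto
    then have "ptd w \<i> \<le> (B + sqrt (R * (B * ((R + 2) * B))) + 1)\<^sup>2 / (m / (R + 2))"
      unfolding ptd_def using wm m R0 by (intro frac_le) auto
    moreover have "ptd w \<i> + 2 = (norm g)\<^sup>2"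
      unfolding w_def by (cases g) (use ptd_mob_ii in_SL2[OF gG] in blast)
    ultimately have "(norm g)\<^sup>2 \<le> E" by (simp add: E_def)
    then show ?thesis by (rule real_le_rsqrt)
  qed
  then have "bounded ?F" unfolding bounded_iff by blast
  then show ?thesis by (intro finite_of_bounded) auto
qed simp

lemma closed_ptd_le:
  assumes "compact K" "K \<subseteq> Hplane" "Im w > 0" shows "closed {z \<in> K. ptd z w \<le> r}"
proof -
  have "continuous_on K (\<lambda>z. ptd z w)" using continuous_on_ptd assms continuous_on_subset by blast
  then show ?thesis using continuous_on_closed_Collect_le[of K "\<lambda>z. ptd z w" "\<lambda>_. r"] compact_imp_closed assms(1)
    by auto
qed

lemma thick_inter_compact:
  assumes "compact K" "K \<subseteq> Hplane" shows "compact (thick r \<inter> K)"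
proof -
  have "thick r \<inter> K = (\<Union>g\<in>{g \<in> G. \<exists>z\<in>K. ptd z (mob g \<i>) \<le> r}. {z \<in> K. ptd z (mob g \<i>) \<le> r})"
    using assms(2) by (auto simp: thick_def Hplane_def)
  also have "closed \<dots>"
    by (intro closed_UN finite_near_compact assms ballI closed_ptd_le) (simp add: Im_orbit_pos)
  finally show ?thesis using assms(1) by (metis Int_lower2 compact_Int_closed inf.absorb_iff2 inf_commute)
qed

lemma ball_avoiding_thick:
  assumes "Im z > 0" "z \<notin> thick r"
  obtains e where "e > 0" "cball z e \<subseteq> Hplane" "cball z e \<inter> thick r = {}"
proof -
  have K: "cball z (Im z / 2) \<subseteq> Hplane"
  proof
    fix w assume "w \<in> cball z (Im z / 2)"
    then have "\<bar>Im (z - w)\<bar> \<le> Im z / 2" using abs_Im_le_cmod[of "z - w"] by (simp add: dist_norm del: divide_le_eq_numeral1 le_divide_eq_numeral1)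
    then have "Im z - Im w \<le> Im z / 2" unfolding minus_complex.sel by linarith
    then show "w \<in> Hplane" using assms(1) by (simp add: Hplane_def)
  qed
  have "open (- (thick r \<inter> cball z (Im z / 2)))"
    using thick_inter_compact[OF compact_cball K] compact_imp_closed by blast
  then obtain e where e: "e > 0" "cball z e \<subseteq> - (thick r \<inter> cball z (Im z / 2))"
    using assms(2) open_contains_cball by (metis ComplI IntD1)
  show thesis
    using that[of "min e (Im z / 2)"] e K assms(1) by fastforce
qed

end

context discrete_SL2 begin

lemma thick_path_component:
  assumes "\<And>x. x \<in> S \<Longrightarrow> ptd (mob x \<i>) \<i> \<le> r" "S \<subseteq> G" "r \<ge> 0" "g \<in> gen_group S"
  shows "g \<in> G \<and> path_component (thick r) \<i> (mob g \<i>)"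
  using assms(4)
proof (induction rule: gen_group.induct)
  case gen_id
  have "\<i> \<in> thick r" using mid_in assms(3) unfolding thick_def by (force simp del: split_paired_Ex)
  then show ?case using mid_in by (simp add: path_component_refl)
next
  case (gen_gen s)
  have s: "s \<in> G" "ptd (mob s \<i>) \<i> \<le> r" using gen_gen assms by auto
  \<comment> \<open>A hyperbolic ball about \<open>\<i>\<close> is a Euclidean disc, so a segment
    joins \<open>\<i>\<close> to its image under a generator inside the neighbourhood.\<close>
  define T where "T = {z. (cmod (z - \<i>))\<^sup>2 \<le> r * Im z \<and> Im z > 0}"
  have "convex T"
  proof (rule convexI)
    fix x y u v assume xy: "x \<in> T" "y \<in> T" and uv: "0 \<le> u" "0 \<le> v" "u + v = (1::real)"
    have "u *\<^sub>R x + v *\<^sub>R y - \<i> = u *\<^sub>R (x - \<i>) + v *\<^sub>R (y - \<i>)"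
      using uv(3) by (simp add: algebra_simps flip: scaleR_add_left)
    then have "cmod (u *\<^sub>R x + v *\<^sub>R y - \<i>) \<le> u * cmod (x - \<i>) + v * cmod (y - \<i>)"
      using uv norm_triangle_ineq[of "u *\<^sub>R (x - \<i>)" "v *\<^sub>R (y - \<i>)"] by simp
    then have "(cmod (u *\<^sub>R x + v *\<^sub>R y - \<i>))\<^sup>2 \<le> (u * cmod (x - \<i>) + v * cmod (y - \<i>))\<^sup>2"
      by (intro power_mono) auto
    also have "\<dots> \<le> u * (cmod (x - \<i>))\<^sup>2 + v * (cmod (y - \<i>))\<^sup>2"
    proof -
      have v: "v = 1 - u" using uv by simp
      have "u * (cmod (x - \<i>))\<^sup>2 + v * (cmod (y - \<i>))\<^sup>2 - (u * cmod (x - \<i>) + v * cmod (y - \<i>))\<^sup>2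
        = u * v * (cmod (x - \<i>) - cmod (y - \<i>))\<^sup>2"
        unfolding v by (simp add: power2_eq_square algebra_simps)
      moreover have "\<dots> \<ge> 0" using uv by simp
      ultimately show ?thesis by linarith
    qed
    also have "\<dots> \<le> u * (r * Im x) + v * (r * Im y)"
      using xy uv unfolding T_def by (intro add_mono mult_left_mono) auto
    also have "\<dots> = r * Im (u *\<^sub>R x + v *\<^sub>R y)" by (simp add: algebra_simps)
    finally have "(cmod (u *\<^sub>R x + v *\<^sub>R y - \<i>))\<^sup>2 \<le> r * Im (u *\<^sub>R x + v *\<^sub>R y)" .
    moreover have "Im (u *\<^sub>R x + v *\<^sub>R y) > 0"
    proof (cases "u = 0")
      case True then show ?thesis using xy uv by (simp add: T_def)
    next
      case False
      then have "u * Im x > 0" "v * Im y \<ge> 0" using xy uv by (auto simp: T_def)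
      then show ?thesis by simp
    qed
    ultimately show "u *\<^sub>R x + v *\<^sub>R y \<in> T" by (simp add: T_def)
  qed
  moreover have "T \<subseteq> thick r"
  proof
    fix z assume z: "z \<in> T"
    then have "ptd z (mob mid \<i>) \<le> r" by (simp add: T_def ptd_def divide_simps mult.commute)
    then show "z \<in> thick r" using z mid_in unfolding thick_def T_def by blast
  qed
  moreover have "\<i> \<in> T" using assms(3) by (simp add: T_def)
  moreover have "mob s \<i> \<in> T"
    using s Im_orbit_pos[OF s(1)] by (simp add: T_def ptd_def divide_simps mult.commute)
  ultimately show ?case using s(1) path_component_convex by blast
next
  case (gen_mul g h)
  have gS: "g \<in> SL2" "h \<in> SL2" using gen_mul in_SL2 by blast+
  have "path_component (thick r) (mob g \<i>) (mob g (mob h \<i>))"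
  proof (rule path_component_continuous_image[where f="mob g"])
    show "path_component (thick r) \<i> (mob h \<i>)" using gen_mul by blast
    show "continuous_on (thick r) (mob g)"
      by (rule continuous_on_subset[OF continuous_on_mob[OF gS(1)]]) (auto simp: thick_def Hplane_def)
    show "mob g ` thick r \<subseteq> thick r" using thick_mob gen_mul by blast
  qed
  also have "mob g (mob h \<i>) = mob (mmul g h) \<i>" using gS by (simp add: mob_mmul)
  finally show ?case using gen_mul mmul_in path_component_trans by blast
next
  case (gen_inv g)
  have gS: "g \<in> SL2" using gen_inv in_SL2 by blast
  have ig: "minv g \<in> G" using gen_inv minv_in by blast
  have "path_component (thick r) (mob (minv g) \<i>) (mob (minv g) (mob g \<i>))"
  proof (rule path_component_continuous_image[where f="mob (minv g)"])
    show "path_component (thick r) \<i> (mob g \<i>)" using gen_inv by blast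
    show "continuous_on (thick r) (mob (minv g))"
      by (rule continuous_on_subset[OF continuous_on_mob[OF in_SL2[OF ig]]]) (auto simp: thick_def Hplane_def)
    show "mob (minv g) ` thick r \<subseteq> thick r" using thick_mob ig by blast
  qed
  also have "mob (minv g) (mob g \<i>) = \<i>" using gS by simp
  finally show ?case using ig path_component_sym by blast
qed

lemma thick_connected:
  assumes "finitely_generated G"
  obtains r where "r > 0" "\<And>g. g \<in> G \<Longrightarrow> path_component (thick r) \<i> (mob g \<i>)"
proof -
  obtain S where S: "finite S" "S \<subseteq> G" "G = gen_group S"
    using assms unfolding finitely_generated_def by blast
  define r where "r = Max (insert 1 ((\<lambda>x. ptd (mob x \<i>) \<i>) ` S))"
  have r: "r \<ge> 1" "\<And>x. x \<in> S \<Longrightarrow> ptd (mob x \<i>) \<i> \<le> r" using S(1) by (simp_all add: r_def)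
  show thesis
  proof (rule that)
    show "r > 0" using r by simp
    show "path_component (thick r) \<i> (mob g \<i>)" if g: "g \<in> G" for g
      using thick_path_component[OF r(2) S(2), of g] r(1) g S(3) by simp
  qed
qed

lemma Im_thick_le:
  assumes e: "e > 0" "\<And>g. g \<in> G \<Longrightarrow> e \<le> norm (row2 g)" and z: "z \<in> thick r" "r \<ge> 0"
  shows "Im z \<le> (r + 2) / e\<^sup>2"
proof -
  obtain g where g: "g \<in> G" "ptd z (mob g \<i>) \<le> r" "Im z > 0" using z by (auto simp: thick_def)
  obtain a b c d where gg: "g = (a,b,c,d)" by (cases g)
  have "e\<^sup>2 \<le> (norm (c,d))\<^sup>2" using e(2)[OF g(1)] e(1) by (intro power_mono) (auto simp: gg)
  then have ecd: "e\<^sup>2 \<le> c\<^sup>2 + d\<^sup>2" by (simp add: norm_Pair)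
  have "Im (mob g \<i>) = 1 / (c\<^sup>2 + d\<^sup>2)"
    using in_SL2[OF g(1)] by (simp add: gg Im_mob cmod_power2 del: mob.simps)
  also have "\<dots> \<le> 1 / e\<^sup>2" using ecd zero_less_power[OF e(1), of 2]
    by (intro divide_left_mono mult_pos_pos) linarith+
  finally have "Im (mob g \<i>) \<le> 1 / e\<^sup>2" .
  then have "(r + 2) * Im (mob g \<i>) \<le> (r + 2) * (1 / e\<^sup>2)" using z(2) by (intro mult_left_mono) auto
  with ptd_Im_le[OF g(3) Im_orbit_pos[OF g(1)] g(2)] show ?thesis by simp
qed

text \<open>Going up from an orbit point one leaves the \<open>(r+1)\<close>-neighbourhood of the orbit for the last time
  at \<open>u\<close>.\<close>

lemma escape_point:
  assumes e: "e > 0" "\<And>g. g \<in> G \<Longrightarrow> e \<le> norm (row2 g)" and r: "r > 0" and \<gamma>: "\<gamma> \<in> G"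
  obtains u h where "Re u = Re (mob \<gamma> \<i>)" "Im u > 0" "h \<in> G" "ptd u (mob h \<i>) \<le> r + 1"
    "\<And>y. y \<ge> Im u \<Longrightarrow> Complex (Re u) y \<notin> thick r" "\<And>g. g \<in> G \<Longrightarrow> ptd u (mob g \<i>) \<ge> r + 1"
proof -
  define w where "w = mob \<gamma> \<i>"
  have Iw: "Im w > 0" using \<gamma> by (simp add: w_def Im_orbit_pos)
  define B where "B = (r + 3) / e\<^sup>2"
  have B: "Im z \<le> B" if "z \<in> thick (r+1)" for z
    using Im_thick_le[OF e that] r by (simp add: B_def add.commute add.left_commute)
  have "ptd w (mob \<gamma> \<i>) \<le> r + 1" using r by (simp add: w_def)
  then have wT: "w \<in> thick (r+1)" using Iw \<gamma> unfolding thick_def by blast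
  define K where "K = cbox (Complex (Re w) (Im w)) (Complex (Re w) B)"
  have K: "z \<in> K \<longleftrightarrow> Re z = Re w \<and> Im w \<le> Im z \<and> Im z \<le> B" for z
    by (auto simp: K_def in_cbox_complex_iff)
  have "K \<subseteq> Hplane" using K Iw by (auto simp: Hplane_def)
  then have "compact (thick (r+1) \<inter> K)" by (intro thick_inter_compact) (simp add: K_def)
  moreover have "w \<in> thick (r+1) \<inter> K" using wT B[OF wT] by (simp add: K)
  ultimately obtain u where u: "u \<in> thick (r+1) \<inter> K" "\<And>z. z \<in> thick (r+1) \<inter> K \<Longrightarrow> Im z \<le> Im u"
    using continuous_attains_sup[of "thick (r+1) \<inter> K" Im] continuous_on_Im[OF continuous_on_id] by blast
  have Ru: "Re u = Re w" "Im u > 0" using u(1) K Iw by auto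
  have above: "Complex (Re u) y \<notin> thick (r+1)" if "y > Im u" for y
  proof
    assume t: "Complex (Re u) y \<in> thick (r+1)"
    have "Im w \<le> Im u" using u(1) K by auto
    then have "Complex (Re u) y \<in> thick (r+1) \<inter> K" using t B[OF t] that Ru by (simp add: K)
    from u(2)[OF this] that show False by simp
  qed
  obtain h where h: "h \<in> G" "ptd u (mob h \<i>) \<le> r + 1" using u(1) by (auto simp: thick_def)
  \<comment> \<open>Were an orbit point strictly closer than \<open>r + 1\<close>, a point slightly
    above \<open>u\<close> would still lie in the neighbourhood, against the maximality of its
    height.\<close>
  have ge: "ptd u (mob g \<i>) \<ge> r + 1" if g: "g \<in> G" for g
  proof (rule ccontr)
    assume lt: "\<not> ?thesis"
    have "((\<lambda>y. ptd (Complex (Re u) y) (mob g \<i>)) \<longlongrightarrow> ptd (Complex (Re u) (Im u)) (mob g \<i>)) (at_right (Im u))"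
      unfolding ptd_def Complex_eq using Ru(2) Im_orbit_pos[OF g] by (intro tendsto_intros) auto
    then have "eventually (\<lambda>y. ptd (Complex (Re u) y) (mob g \<i>) < r + 1) (at_right (Im u))"
      using lt by (intro order_tendstoD(2)) auto
    then obtain b where b: "b > Im u" "\<And>y. Im u < y \<Longrightarrow> y < b \<Longrightarrow> ptd (Complex (Re u) y) (mob g \<i>) < r + 1"
      unfolding eventually_at_right_field by blast
    define y where "y = (Im u + b) / 2"
    have y: "Im u < y" "y < b" using b(1) by (auto simp: y_def)
    then have "ptd (Complex (Re u) y) (mob g \<i>) \<le> r + 1" "Im (Complex (Re u) y) > 0"
      using b(2)[OF y] Ru(2) by simp_all
    then have "Complex (Re u) y \<in> thick (r+1)" using g unfolding thick_def by blast
    then show False using above y by blast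
  qed
  have "Complex (Re u) y \<notin> thick r" if "y \<ge> Im u" for y
  proof
    assume t: "Complex (Re u) y \<in> thick r"
    then obtain g where g: "g \<in> G" "ptd (Complex (Re u) y) (mob g \<i>) \<le> r" "y > 0" by (auto simp: thick_def)
    show False
    proof (cases "y = Im u")
      case True
      then show False using ge[OF g(1)] g(2) by (simp add: complex_surj)
    next
      case False
      have "ptd (Complex (Re u) y) (mob g \<i>) \<le> r + 1" "Im (Complex (Re u) y) > 0" using g by simp_all
      then have "Complex (Re u) y \<in> thick (r+1)" using g(1) unfolding thick_def by blast
      then show False using above[of y] False that by simp
    qed
  qed
  then show thesis using that[of u h] Ru h ge by (simp add: w_def)
qed

end

lemma minus_inverse_eq_cnj:
  "- 1 / (of_real k * z) = - cnj z / of_real (k * (cmod z)\<^sup>2)"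
proof (cases "z = 0")
  case False
  have "- cnj z / of_real (k * (cmod z)\<^sup>2) = - cnj z / ((of_real k * z) * cnj z)"
    by (simp only: of_real_mult complex_norm_square mult.assoc)
  also have "\<dots> = - 1 / (of_real k * z)" using False by simp
  finally show ?thesis by simp
qed simp

context discrete_SL2 begin

text \<open>With \<open>g\<infinity> = a/c\<close>: the curve descending from infinity through \<open>u\<close>, \<open>gv\<close> and along the image of the ray above
  \<open>v\<close> to \<open>g\<infinity>\<close> avoids the connected set \<open>thick r\<close>, but separates \<open>w\<close> from \<open>gw\<close> once \<open>Re w\<close> is large.\<close>

lemma no_separating_curve:
  fixes \<sigma> :: real
  assumes \<sigma>: "\<sigma> = 1 \<or> \<sigma> = -1"
    and g: "g \<in> G" "fst (row2 g) \<noteq> 0"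
    and conn: "\<And>h. h \<in> G \<Longrightarrow> path_component (thick r) \<i> (mob h \<i>)"
    and Bd: "\<And>z. z \<in> thick r \<Longrightarrow> Im z \<le> B"
    and unb: "\<And>N. \<exists>h\<in>G. \<sigma> * Re (mob h \<i>) > N"
    and u: "\<And>y. y \<ge> Im u \<Longrightarrow> Complex (Re u) y \<notin> thick r" "Im u > 0"
    and v: "\<And>y. y \<ge> Im v \<Longrightarrow> Complex (Re v) y \<notin> thick r" "Im v > 0"
    and K: "compact K" "path_connected K" "K \<subseteq> Hplane" "K \<inter> thick r = {}" "u \<in> K" "mob g v \<in> K"
  shows False
proof -
  obtain a b c d where gg: "g = (a,b,c,d)" by (cases g)
  have c: "c \<noteq> 0" using g(2) by (simp add: gg)
  have S: "(a,b,c,d) \<in> SL2" using in_SL2[OF g(1)] by (simp add: gg)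
  define p where "p = a / c"
  define q where "q = - d / c"
  have mp: "mob g w - of_real p = - 1 / (of_real (c^2) * (w - of_real q))" if "Im w > 0" for w
    using mob_minus_pole[OF S c that] by (simp add: gg p_def q_def del: mob.simps)
  have mpq: "(mob g w - of_real p) * (of_real (c^2) * (w - of_real q)) = - 1"
    and nz: "w - of_real q \<noteq> 0" if "Im w > 0" for w
  proof -
    show "w - of_real q \<noteq> 0" using that by (auto simp: complex_eq_iff)
    then show "(mob g w - of_real p) * (of_real (c^2) * (w - of_real q)) = - 1"
      unfolding mp[OF that] using c by simp
  qed
  define Ray where "Ray = insert (of_real p) (mob g ` {Complex (Re v) y | y. y \<ge> Im v})"
  have Ray_conn: "path_connected Ray" and Ray_comp: "compact Ray"
  proof -
    \<comment> \<open>Parametrised by the reciprocal t of the height, the image of the ray extends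
      continuously to \<open>t = 0\<close>, where it ends at p.\<close>
    define f where "f t = of_real p - of_real t / (of_real (c^2) * (of_real t * of_real (Re v - q) + \<i>))" for t :: real
    have "of_real t * of_real (Re v - q) + \<i> \<noteq> 0" for t :: real by (simp add: complex_eq_iff)
    then have fc: "continuous_on {0..1 / Im v} f"
      unfolding f_def using c by (intro continuous_intros) auto
    have f0: "f 0 = of_real p" by (simp add: f_def)
    have ft: "f t = mob g (Complex (Re v) (1 / t))" if "t > 0" for t
    proof -
      have e: "Complex (Re v) (1/t) - of_real q = (of_real t * of_real (Re v - q) + \<i>) / of_real t"
        using that by (simp add: complex_eq_iff)
      have "mob g (Complex (Re v) (1/t)) = of_real p - 1 / (of_real (c^2) * (Complex (Re v) (1/t) - of_real q))"
        using mp[of "Complex (Re v) (1/t)"] that by (simp add: algebra_simps)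
      then show ?thesis unfolding e f_def using that by simp
    qed
    have "Ray = f ` {0..1 / Im v}"
    proof (intro equalityI subsetI)
      fix z assume "z \<in> Ray"
      then consider "z = of_real p" | y where "z = mob g (Complex (Re v) y)" "y \<ge> Im v" by (auto simp: Ray_def)
      then show "z \<in> f ` {0..1 / Im v}"
      proof cases
        case 1 then show ?thesis using f0 v(2) by (metis atLeastAtMost_iff image_eqI order_refl zero_le_divide_1_iff less_imp_le)
      next
        case 2
        then have "y > 0" using v(2) by simp
        then have "z = f (1 / y)" "1 / y \<in> {0..1 / Im v}" using 2 v(2) ft[of "1/y"] by (auto simp: frac_le)
        then show ?thesis by blast
      qed
    next
      fix z assume "z \<in> f ` {0..1 / Im v}"
      then obtain t where t: "z = f t" "0 \<le> t" "t \<le> 1 / Im v" by auto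
      show "z \<in> Ray"
      proof (cases "t = 0")
        case True then show ?thesis using t f0 by (simp add: Ray_def)
      next
        case False
        then have "Im v \<le> 1 / t" using t v(2) by (simp add: field_simps)
        then show ?thesis using ft[of t] t False unfolding Ray_def by auto
      qed
    qed
    then show "path_connected Ray" "compact Ray"
      using fc by (auto intro: path_connected_continuous_image compact_continuous_image convex_imp_path_connected)
  qed
  have p_Ray: "of_real p \<in> Ray" and gv_Ray: "mob g v \<in> Ray"
    unfolding Ray_def by (auto intro!: imageI exI[of _ "Im v"] simp: complex_surj simp del: mob.simps)
  have Ray_thick: "Ray \<inter> thick r = {}"
  proof -
    have "mob g (Complex (Re v) y) \<notin> thick r" if "y \<ge> Im v" for y
    proof
      assume "mob g (Complex (Re v) y) \<in> thick r"
      then have "mob (minv g) (mob g (Complex (Re v) y)) \<in> thick r" using g minv_in thick_mob by blast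
      then show False using v that in_SL2[OF g(1)] by simp
    qed
    moreover have "of_real p \<notin> thick r" by (simp add: thick_def)
    ultimately show ?thesis unfolding Ray_def by blast
  qed
  have Ray_Im: "Im z \<ge> 0" if "z \<in> Ray" for z
    using that v(2) Im_mob_pos[OF in_SL2[OF g(1)]] unfolding Ray_def by (force simp: less_imp_le simp del: mob.simps)
  obtain m0 where m0: "m0 \<in> K" "\<And>z. z \<in> K \<Longrightarrow> Im m0 \<le> Im z"
    using continuous_attains_inf[of K Im] K(1,5) continuous_on_Im[OF continuous_on_id] by blast
  \<comment> \<open>A height below both K and the vertical ray above u.\<close>
  define \<mu> where "\<mu> = min (Im m0) (Im u)"
  have \<mu>: "\<mu> > 0" using m0(1) K(3) u(2) by (auto simp: \<mu>_def Hplane_def)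
  obtain R where R: "\<And>z. z \<in> K \<union> Ray \<Longrightarrow> cmod z \<le> R"
    using compact_imp_bounded[OF compact_Un[OF K(1) Ray_comp]] bounded_iff by metis
  \<comment> \<open>Far enough for four purposes: w is beyond K and Ray, beyond u and v, on the side
    of q from which g sends it to the opposite side of p, and so distant from q that g w is lower
    than \<mu>.\<close>
  define N0 where "N0 = R + \<bar>q\<bar> + 1 + \<bar>Re v\<bar> + \<bar>B\<bar> / (c^2 * \<mu>) + \<bar>Re u\<bar>"
  obtain h where h: "h \<in> G" "\<sigma> * Re (mob h \<i>) > N0" using unb by blast
  define w where "w = mob h \<i>"
  have wT: "w \<in> thick r" using conn[OF h(1)] path_component_mem(2) unfolding w_def by blast
  have Iw: "Im w > 0" using wT by (simp add: thick_def)
  have R0: "R \<ge> 0" using R[of u] K(5) norm_ge_zero order_trans by blast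
  have s: "\<bar>\<sigma>\<bar> = 1" "\<sigma> * \<sigma> = 1" "\<And>x. \<sigma> * x \<le> \<bar>x\<bar>" "\<And>x. \<bar>\<sigma> * x\<bar> = \<bar>x\<bar>" using \<sigma> by (auto simp: abs_mult)
  have Nfrac: "0 \<le> \<bar>B\<bar> / (c^2 * \<mu>)" using \<mu> by simp
  have Nq: "\<sigma> * (Re w - q) \<ge> 1 + \<bar>B\<bar> / (c^2 * \<mu>)" "\<sigma> * Re w > \<sigma> * Re v" "\<sigma> * Re w > R" "Re w \<noteq> Re u"
  proof -
    define f where "f = \<bar>B\<bar> / (c^2 * \<mu>)"
    have f: "f \<ge> 0" using Nfrac by (simp add: f_def)
    have h2: "R + \<bar>q\<bar> + 1 + \<bar>Re v\<bar> + f + \<bar>Re u\<bar> < \<sigma> * Re w"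
      using h(2) unfolding N0_def f_def w_def[symmetric] .
    show "\<sigma> * (Re w - q) \<ge> 1 + \<bar>B\<bar> / (c^2 * \<mu>)" unfolding f_def[symmetric] right_diff_distrib
      using h2 s(3)[of q] R0 f by linarith
    show "\<sigma> * Re w > \<sigma> * Re v" "\<sigma> * Re w > R" using h2 s(3)[of "Re v"] R0 f by linarith+
    show "Re w \<noteq> Re u" using h2 s(3)[of "Re u"] R0 f by auto
  qed
  define w' where "w' = mob g w"
  have Iw': "Im w' > 0" using Im_mob_pos[OF in_SL2[OF g(1)] Iw] by (simp add: w'_def)
  have dw: "w' - of_real p = - cnj (w - of_real q) / of_real (c^2 * (cmod (w - of_real q))\<^sup>2)"
  proof -
    have "w' - of_real p = - 1 / (of_real (c^2) * (w - of_real q))" using mp[OF Iw] by (simp add: w'_def)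
    then show ?thesis unfolding minus_inverse_eq_cnj .
  qed
  have cm: "cmod (w - of_real q) > 0" using nz[OF Iw] by simp
  have "Re (w' - of_real p) = - (Re w - q) / (c^2 * (cmod (w - of_real q))\<^sup>2)"
    unfolding dw by (simp add: Re_divide_of_real)
  then have rw: "\<sigma> * (Re w' - p) = - (\<sigma> * (Re w - q)) / (c^2 * (cmod (w - of_real q))\<^sup>2)"
    unfolding minus_complex.sel Re_complex_of_real by (simp only: times_divide_eq_right mult_minus_right)
  have ordA: "\<sigma> * Re w' < \<sigma> * p"
  proof -
    have "- (\<sigma> * (Re w - q)) / (c^2 * (cmod (w - of_real q))\<^sup>2) < 0"
      using Nq(1) Nfrac c cm by (intro divide_neg_pos) auto
    then show ?thesis using rw by (simp add: right_diff_distrib)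
  qed
  have Imw': "Im w' < \<mu>"
  proof -
    have "Im (w' - of_real p) = Im w / (c^2 * (cmod (w - of_real q))\<^sup>2)"
      unfolding dw by (simp add: Im_divide_of_real)
    then have "Im w' = Im w / (c^2 * (cmod (w - of_real q))\<^sup>2)" by simp
    also have "\<dots> < \<mu>"
    proof -
      define X where "X = \<sigma> * (Re w - q)"
      have X: "X \<ge> 1 + \<bar>B\<bar> / (c^2 * \<mu>)" using Nq(1) by (simp add: X_def)
      have "X \<ge> 1" using X Nfrac by linarith
      then have "X * 1 \<le> X * X" by (intro mult_left_mono) auto
      also have "X * X = (\<sigma> * \<sigma>) * ((Re w - q) * (Re w - q))" by (simp only: X_def mult_ac)
      also have "\<dots> = (Re w - q)\<^sup>2" using s(2) by (simp add: power2_eq_square)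
      also have "\<dots> \<le> (cmod (w - of_real q))\<^sup>2" by (simp add: cmod_power2)
      finally have "\<bar>B\<bar> / (c^2 * \<mu>) < (cmod (w - of_real q))\<^sup>2" using X by linarith
      then have "\<bar>B\<bar> < (cmod (w - of_real q))\<^sup>2 * (c^2 * \<mu>)" using \<mu> c by (subst (asm) pos_divide_less_eq) auto
      then have "Im w < \<mu> * (c^2 * (cmod (w - of_real q))\<^sup>2)" using Bd[OF wT] by (simp add: mult_ac)
      then show ?thesis using c cm by (subst pos_divide_less_eq) auto
    qed
    finally show ?thesis .
  qed
  obtain A where A: "A \<subseteq> thick r" "compact A" "path_component A w' w"
  proof -
    have "path_component (thick r) \<i> w" "path_component (thick r) \<i> w'"
      using conn[OF h(1)] conn[OF mmul_in[OF g(1) h(1)]] mob_mmul[OF in_SL2[OF g(1)] in_SL2[OF h(1)], of \<i>]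
      by (simp_all add: w_def w'_def)
    then have "path_component (thick r) w' w" by (meson path_component_sym path_component_trans)
    then show thesis using that path_component_compact by blast
  qed
  obtain RA where RA: "\<And>z. z \<in> A \<Longrightarrow> cmod z \<le> RA" using compact_imp_bounded[OF A(2)] bounded_iff by metis
  define M where "M = \<sigma> * (\<bar>RA\<bar> + \<bar>Re w\<bar> + \<bar>Re w'\<bar> + 1)"
  define Y where "Y = \<bar>B\<bar> + Im w + Im w' + Im u"
  have \<sigma>M: "\<sigma> * M = \<bar>RA\<bar> + \<bar>Re w\<bar> + \<bar>Re w'\<bar> + 1" using s(2) by (simp add: M_def flip: mult.assoc)
  \<comment> \<open>The path inside the neighbourhood, extended at both ends by vertical segments
    down to the real axis.\<close>
  define A' where "A' = A \<union> {z. Re z = Re w' \<and> 0 \<le> Im z \<and> Im z \<le> Im w'} \<union> {z. Re z = Re w \<and> 0 \<le> Im z \<and> Im z \<le> Im w}"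
  \<comment> \<open>The separating curve, closed off by a horizontal line above all of
    \<open>A'\<close> and a vertical segment beyond it. A crossing can therefore only occur on the
    first three pieces, which avoid the neighbourhood, and so only on the vertical segments of
    \<open>A'\<close>.\<close>
  define P where "P = Ray \<union> K \<union> {z. Re z = Re u \<and> Im z \<ge> Im u} \<union> {z. Im z = Y} \<union> {z. Re z = M \<and> 0 \<le> Im z \<and> Im z \<le> Y}"
  have conv: "convex {z. Re z = x \<and> 0 \<le> Im z \<and> Im z \<le> y}" "convex {z. Re z = x \<and> Im z \<ge> y}" "convex {z. Im z = y}" for x y
  proof -
    have 1: "{z. Re z = x \<and> 0 \<le> Im z \<and> Im z \<le> y} = cbox (Complex x 0) (Complex x y)"
      by (auto simp: in_cbox_complex_iff)
    show "convex {z. Re z = x \<and> 0 \<le> Im z \<and> Im z \<le> y}" unfolding 1 by (rule convex_box)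
    show "convex {z. Re z = x \<and> Im z \<ge> y}" "convex {z. Im z = y}"
    proof -
      have "{z. Re z = x \<and> Im z \<ge> y} = {z. Re z \<ge> x} \<inter> {z. Re z \<le> x} \<inter> {z. Im z \<ge> y}" by auto
      then show "convex {z. Re z = x \<and> Im z \<ge> y}"
        by (simp only: convex_Int convex_halfspace_Re_ge convex_halfspace_Re_le convex_halfspace_Im_ge)
      have "{z. Im z = y} = {z. Im z \<ge> y} \<inter> {z. Im z \<le> y}" by auto
      then show "convex {z. Im z = y}"
        by (simp only: convex_Int convex_halfspace_Im_ge convex_halfspace_Im_le)
    qed
  qed
  have pcA: "path_component A' (of_real (Re w')) (of_real (Re w))"
  proof -
    have "path_component A' (of_real (Re w')) w'"
      by (rule path_component_convex[OF conv(1)[of "Re w'" "Im w'"]]) (use Iw' in \<open>auto simp: A'_def\<close>)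
    moreover have "path_component A' w' w"
      by (rule path_component_of_subset[OF _ A(3)]) (auto simp: A'_def)
    moreover have "path_component A' w (of_real (Re w))"
      by (rule path_component_convex[OF conv(1)[of "Re w" "Im w"]]) (use Iw in \<open>auto simp: A'_def\<close>)
    ultimately show ?thesis by (meson path_component_trans)
  qed
  have Y: "Y \<ge> Im u" "Y > Im w" "Y > Im w'" "Y > B" "Y \<ge> 0" using Iw Iw' u(2) by (auto simp: Y_def)
  have pcP: "path_component P (of_real p) (of_real M)"
  proof -
    have "path_component Ray (of_real p) (mob g v)" using Ray_conn p_Ray gv_Ray path_connected_component by blast
    then have "path_component P (of_real p) (mob g v)" by (rule path_component_of_subset[rotated]) (auto simp: P_def)
    moreover have "path_component K (mob g v) u" using K path_connected_component by blast
    then have "path_component P (mob g v) u" by (rule path_component_of_subset[rotated]) (auto simp: P_def)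
    moreover have "path_component P u (Complex (Re u) Y)"
      by (rule path_component_convex[OF conv(2)[of "Re u" "Im u"]]) (use Y in \<open>auto simp: P_def\<close>)
    moreover have "path_component P (Complex (Re u) Y) (Complex M Y)"
      by (rule path_component_convex[OF conv(3)[of Y]]) (auto simp: P_def)
    moreover have "path_component P (Complex M Y) (of_real M)"
      by (rule path_component_convex[OF conv(1)[of M Y]]) (use Y in \<open>auto simp: P_def\<close>)
    ultimately show ?thesis by (meson path_component_trans)
  qed
  have "\<sigma> * p < \<sigma> * Re w"
  proof -
    have "\<sigma> * p \<le> R" using R[of "of_real p"] p_Ray s(3)[of p] by simp
    then show ?thesis using Nq(3) by simp
  qed
  moreover have "\<sigma> * Re w < \<sigma> * M" using s(3)[of "Re w"] unfolding \<sigma>M by linarith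
  ultimately have "A' \<inter> P \<noteq> {}"
    using interlaced_paths_meet_sgn[OF pcA pcP _ _ \<sigma> ordA] A(1) Ray_Im K(3) u(2) Y(5)
    by (auto simp: A'_def P_def thick_def Hplane_def less_imp_le subset_iff)
  then obtain z where z: "z \<in> A'" "z \<in> P" by blast
  have zM: "Re z \<noteq> M"
  proof
    assume "Re z = M"
    then have 1: "\<sigma> * Re z = \<bar>RA\<bar> + \<bar>Re w\<bar> + \<bar>Re w'\<bar> + 1" using \<sigma>M by simp
    have "\<sigma> * Re z \<le> \<bar>Re z\<bar>" by (rule s(3))
    then show False using z(1) RA[of z] abs_Re_le_cmod[of z] 1 unfolding A'_def by auto
  qed
  have zY: "Im z < Y" using z(1) A(1) Bd Y unfolding A'_def by fastforce
  have zP: "z \<in> Ray \<or> z \<in> K \<or> (Re z = Re u \<and> Im z \<ge> Im u)" using z(2) zM zY by (auto simp: P_def)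
  have "z \<notin> thick r"
    using zP Ray_thick K(4) u(1)[of "Im z"] by (metis complex_surj disjoint_iff)
  then consider "Re z = Re w'" "0 \<le> Im z" "Im z \<le> Im w'" | "Re z = Re w"
    using z(1) A(1) by (auto simp: A'_def)
  then show False
  proof cases
    case 1
    have "Im z < \<mu>" using 1 Imw' by simp
    then have "z \<in> Ray" using zP m0(2)[of z] by (auto simp: \<mu>_def)
    then consider "z = of_real p" | y where "z = mob g (Complex (Re v) y)" "y \<ge> Im v" by (auto simp: Ray_def)
    then show False
    proof cases
      case 1
      then show False using ordA \<open>Re z = Re w'\<close> by simp
    next
      case (2 y)
      define x where "x = Complex (Re v) y"
      have Ix: "Im x > 0" using 2 v(2) by (simp add: x_def)
      \<comment> \<open>The inverse of g in the coordinates centred at p and q. Among points on a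
        fixed vertical line, the closer to p, the farther their preimage is from q in the horizontal
        direction.\<close>
      have Rx: "\<sigma> * (Re x' - q) = \<sigma> * (p - Re (mob g x')) / (c^2 * (cmod (mob g x' - of_real p))\<^sup>2)" if "Im x' > 0" for x'
      proof -
        have zz: "mob g x' - of_real p \<noteq> 0" using mpq[OF that] by auto
        have "x' - of_real q = - 1 / (of_real (c^2) * (mob g x' - of_real p))"
          using mpq[OF that] zz c by (simp add: field_simps)
        also have "\<dots> = - cnj (mob g x' - of_real p) / of_real (c^2 * (cmod (mob g x' - of_real p))\<^sup>2)"
          by (rule minus_inverse_eq_cnj)
        finally have "Re (x' - of_real q) = (p - Re (mob g x')) / (c^2 * (cmod (mob g x' - of_real p))\<^sup>2)"
          by (simp add: Re_divide_of_real)
        then show ?thesis unfolding minus_complex.sel Re_complex_of_real by (simp only: times_divide_eq_right)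
      qed
      have mx: "mob g x = z" using 2 by (simp add: x_def)
      have pos: "\<sigma> * (p - Re w') > 0" using ordA by (simp add: right_diff_distrib)
      have zp: "(cmod (z - of_real p))\<^sup>2 \<le> (cmod (w' - of_real p))\<^sup>2"
        using \<open>Re z = Re w'\<close> \<open>0 \<le> Im z\<close> \<open>Im z \<le> Im w'\<close> by (simp add: cmod_power2 power_mono)
      have zp0: "(cmod (z - of_real p))\<^sup>2 > 0" using pos \<open>Re z = Re w'\<close> by auto
      \<comment> \<open>A crossing z lies vertically below g w, hence nearer to p. Its preimage
        would be horizontally at least as far out as w, but it lies on the line through v, which w
        has passed.\<close>
      have "\<sigma> * (Re w - q) = \<sigma> * (p - Re w') / (c^2 * (cmod (w' - of_real p))\<^sup>2)"
        using Rx[OF Iw] by (simp add: w'_def)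
      also have "\<dots> \<le> \<sigma> * (p - Re w') / (c^2 * (cmod (z - of_real p))\<^sup>2)"
      proof (rule divide_left_mono)
        show le: "c^2 * (cmod (z - of_real p))\<^sup>2 \<le> c^2 * (cmod (w' - of_real p))\<^sup>2"
          using zp by (rule mult_left_mono) simp
        have pz: "c^2 * (cmod (z - of_real p))\<^sup>2 > 0" using c by (intro mult_pos_pos zp0) simp
        show "0 < c^2 * (cmod (w' - of_real p))\<^sup>2 * (c^2 * (cmod (z - of_real p))\<^sup>2)"
          by (rule mult_pos_pos[OF order.strict_trans2[OF pz le] pz])
      qed (use pos in linarith)
      also have "\<dots> = \<sigma> * (Re x - q)" using Rx[OF Ix] mx \<open>Re z = Re w'\<close> by simp
      finally have "\<sigma> * Re w \<le> \<sigma> * Re v" by (simp add: x_def right_diff_distrib)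
      then show False using Nq(2) by simp
    qed
  next
    case 2
    then have "Re z \<noteq> Re u" using Nq(4) by simp
    then have "z \<in> K \<union> Ray" using zP by auto
    then have "\<sigma> * Re z \<le> R" using R[of z] abs_Re_le_cmod[of z] s(3)[of "Re z"] by linarith
    then show False using Nq(3) 2 by simp
  qed
qed

end

section \<open>Boundedness of the real parts of the orbit\<close>

context horocycle_closed begin

text \<open>Powers of g have bottom rows \<open>(0, d^n)\<close>, and those of its inverse
  \<open>(0, a^n)\<close>; the lower bound on rows forces \<open>|a| = |d| = 1\<close>. Then g^2 is
  unipotent, hence trivial.\<close>

lemma upper_triangular_trivial:
  assumes e: "e > 0" "\<And>g. g \<in> G \<Longrightarrow> e \<le> norm (row2 g)" and g: "g \<in> G" "fst (row2 g) = 0"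
  shows "g = mid \<or> g = (-1,0,0,-1)"
proof -
  have pw: "\<exists>h\<in>G. row2 h = (0, t ^ n)" if "k \<in> G" "row2 k = (0,t)" for k t n
  proof (induction n)
    case 0
    have "row2 mid = (0,1)" by (simp add: mid_def)
    then show ?case using mid_in by auto
  next
    case (Suc n)
    then obtain h where h: "h \<in> G" "row2 h = (0, t^n)" by blast
    obtain a b c d where k: "k = (a,b,c,d)" by (cases k)
    have "row2 (mmul h k) = (0, t ^ Suc n)" using h(2) that(2) by (simp add: row2_mmul k mult.commute)
    then show ?case using h(1) that(1) mmul_in by blast
  qed
  have ge: "\<bar>t\<bar> \<ge> 1" if "k \<in> G" "row2 k = (0,t)" for k t
  proof (rule ccontr)
    assume "\<not> ?thesis"
    then obtain n where "\<bar>t\<bar> ^ n < e" using real_arch_pow_inv[OF e(1), of "\<bar>t\<bar>"] by auto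
    moreover obtain h where "h \<in> G" "row2 h = (0, t^n)" using pw \<open>k \<in> G\<close> \<open>row2 k = (0,t)\<close> by blast
    ultimately show False using e(2)[of h] by (simp add: norm_Pair power_abs)
  qed
  obtain a b c d where gg: "g = (a,b,c,d)" by (cases g)
  have c: "c = 0" using g(2) by (simp add: gg)
  have ad: "a * d = 1" using in_SL2[OF g(1)] c by (simp add: gg SL2_iff)
  have "\<bar>d\<bar> \<ge> 1" using ge[OF g(1)] c by (simp add: gg)
  moreover have "\<bar>a\<bar> \<ge> 1" using ge[OF minv_in[OF g(1)]] c by (simp add: gg)
  moreover have "\<bar>a\<bar> * \<bar>d\<bar> = 1" using ad by (simp flip: abs_mult)
  ultimately have "\<bar>d\<bar> = 1" using mult_mono[of 1 "\<bar>a\<bar>" "\<bar>d\<bar>" "\<bar>d\<bar>"] by auto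
  then have "d = 1 \<or> d = -1" by linarith
  then have d: "d = 1 \<and> a = 1 \<or> d = -1 \<and> a = -1" using ad by auto
  have "mmul g g = nx (a*b + b*d)" using d c by (auto simp: gg nx_def)
  then have "mmul g g \<in> G \<inter> Nsub" using mmul_in[OF g(1) g(1)] by (auto simp: Nsub_def)
  then have "mmul g g = mid" using trivGN by blast
  then have "b = 0" using d c by (auto simp: gg mid_def)
  then show ?thesis using d c by (auto simp: gg mid_def)
qed

text \<open>Escape points have distance measure exactly at the level \<open>r + 1\<close> from the
  orbit, so their translates to the vicinity of \<open>\<i>\<close> cannot accumulate in
  \<open>thick r\<close>. Two of these translates lie in one ball avoiding \<open>thick r\<close>,
  and the image of that ball is the connecting set K required by
  \<open>no_separating_curve\<close>.\<close>

lemma orbit_bounded_in_direction: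
  fixes \<sigma> :: real
  assumes \<sigma>: "\<sigma> = 1 \<or> \<sigma> = -1" and fg: "finitely_generated G"
    and e: "e > 0" "\<And>g. g \<in> G \<Longrightarrow> e \<le> norm (row2 g)"
  shows "\<exists>N. \<forall>h\<in>G. \<sigma> * Re (mob h \<i>) \<le> N"
proof (rule ccontr)
  assume "\<not> ?thesis"
  then have unb: "\<exists>h\<in>G. \<sigma> * Re (mob h \<i>) > N" for N by (meson not_le)
  obtain r where r: "r > 0" "\<And>g. g \<in> G \<Longrightarrow> path_component (thick r) \<i> (mob g \<i>)"
    using thick_connected[OF fg] by blast
  have "\<exists>u h. \<sigma> * Re u > real n \<and> Im u > 0 \<and> h \<in> G \<and> ptd u (mob h \<i>) \<le> r + 1 \<and>
     (\<forall>y\<ge>Im u. Complex (Re u) y \<notin> thick r) \<and> (\<forall>g\<in>G. ptd u (mob g \<i>) \<ge> r + 1)" for n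
  proof -
    obtain \<gamma> where \<gamma>: "\<gamma> \<in> G" "\<sigma> * Re (mob \<gamma> \<i>) > real n" using unb by blast
    obtain u h where uh: "Re u = Re (mob \<gamma> \<i>)" "Im u > 0" "h \<in> G" "ptd u (mob h \<i>) \<le> r + 1"
      "\<And>y. y \<ge> Im u \<Longrightarrow> Complex (Re u) y \<notin> thick r" "\<And>g. g \<in> G \<Longrightarrow> ptd u (mob g \<i>) \<ge> r + 1"
      using escape_point[OF e r(1) \<gamma>(1)] by blast
    have "\<sigma> * Re u > real n" using uh(1) \<gamma>(2) by simp
    then show ?thesis using uh by blast
  qed
  then obtain u h where uh: "\<And>n. \<sigma> * Re (u n) > real n" "\<And>n. Im (u n) > 0" "\<And>n. h n \<in> G"
     "\<And>n. ptd (u n) (mob (h n) \<i>) \<le> r + 1" "\<And>n y. y \<ge> Im (u n) \<Longrightarrow> Complex (Re (u n)) y \<notin> thick r"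
     "\<And>n g. g \<in> G \<Longrightarrow> ptd (u n) (mob g \<i>) \<ge> r + 1"
    by metis
  \<comment> \<open>Moves the orbit point near \<open>u n\<close> back to \<open>\<i>\<close>, which
    puts the sequence into a compact set.\<close>
  define k where "k n = mob (minv (h n)) (u n)" for n
  have hS: "h n \<in> SL2" for n using uh(3) in_SL2 by blast
  have kI: "Im (k n) > 0" for n unfolding k_def by (intro Im_mob_pos SL2_minv hS uh)
  have hk: "mob (h n) (k n) = u n" for n unfolding k_def using hS uh(2) by simp
  have k1: "ptd (k n) \<i> \<le> r + 1" for n
    using ptd_mob[OF hS[of n] kI[of n], of \<i>] uh(4)[of n] by (simp add: hk)
  have k2: "ptd (k n) (mob g \<i>) \<ge> r + 1" if "g \<in> G" for n g
  proof -
    have "ptd (k n) (mob g \<i>) = ptd (mob (h n) (k n)) (mob (h n) (mob g \<i>))"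
      using ptd_mob[OF hS[of n] kI[of n] Im_orbit_pos[OF that]] by simp
    also have "\<dots> = ptd (u n) (mob (mmul (h n) g) \<i>)" using that hS in_SL2 by (simp add: hk mob_mmul)
    finally show ?thesis using uh(6) mmul_in[OF uh(3) that] by simp
  qed
  have kIm: "Im (k n) \<le> r + 3" "1 / (r + 3) \<le> Im (k n)" for n
    using ptd_Im_le[OF kI[of n] _ k1] ptd_Im_ge[OF kI[of n] _ k1] by (simp_all add: add.commute)
  have "cmod (k n) \<le> sqrt ((r + 1) * (r + 3)) + 1" for n
  proof -
    have "(cmod (k n - \<i>))\<^sup>2 \<le> (r + 1) * (Im (k n) * Im \<i>)" by (rule ptd_dist_le[OF kI _ k1]) simp
    also have "\<dots> \<le> (r + 1) * (r + 3)" using kIm(1)[of n] r(1) by (intro mult_left_mono) auto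
    finally have "cmod (k n - \<i>) \<le> sqrt ((r + 1) * (r + 3))" by (rule real_le_rsqrt)
    then show ?thesis using norm_triangle_ineq[of "k n - \<i>" \<i>] by simp
  qed
  then have "bounded (range k)" unfolding bounded_iff by blast
  then obtain l \<rho> where \<rho>: "strict_mono (\<rho> :: nat \<Rightarrow> nat)" "(k \<circ> \<rho>) \<longlonglongrightarrow> l"
    using bounded_imp_convergent_subsequence by blast
  have "1 / (r + 3) \<le> Im l"
    by (rule tendsto_lowerbound[OF tendsto_Im[OF \<rho>(2)]]) (auto simp: kIm)
  then have Il: "Im l > 0" using r(1) by (smt (verit) divide_pos_pos)
  \<comment> \<open>The margin between \<open>r + 1\<close> and r survives the passage to the
    limit.\<close>
  have "l \<notin> thick r"
  proof
    assume "l \<in> thick r"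
    then obtain g where g: "g \<in> G" "ptd l (mob g \<i>) \<le> r" unfolding thick_def by blast
    have "((\<lambda>n. ptd ((k \<circ> \<rho>) n) (mob g \<i>)) \<longlonglongrightarrow> ptd l (mob g \<i>))"
      unfolding ptd_def using Il Im_orbit_pos[OF g(1)] by (intro tendsto_intros \<rho>(2)) auto
    then have "r + 1 \<le> ptd l (mob g \<i>)"
      by (rule tendsto_lowerbound) (use k2[OF g(1)] in simp_all)
    then show False using g(2) by simp
  qed
  then obtain \<epsilon> where \<epsilon>: "\<epsilon> > 0" "cball l \<epsilon> \<subseteq> Hplane" "cball l \<epsilon> \<inter> thick r = {}"
    using ball_avoiding_thick[OF Il] by blast
  obtain n0 where n0: "\<And>j. j \<ge> n0 \<Longrightarrow> dist (k (\<rho> j)) l < \<epsilon>"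
    using tendstoD[OF \<rho>(2) \<epsilon>(1)] by (auto simp: eventually_sequentially)
  define n where "n = \<rho> n0"
  define C where "C = sqrt ((r + 1) * ((r + 3) / e\<^sup>2 * ((r + 3) / e\<^sup>2)))"
  have close: "\<sigma> * Re (mob (h j) \<i>) \<ge> real j - C" for j
  proof -
    have t: "u j \<in> thick (r+1)" "mob (h j) \<i> \<in> thick (r+1)"
    proof -
      show "u j \<in> thick (r+1)" using uh(2,3,4) unfolding thick_def by blast
      have "ptd (mob (h j) \<i>) (mob (h j) \<i>) \<le> r + 1" using r(1) by simp
      then show "mob (h j) \<i> \<in> thick (r+1)" using uh(3) Im_orbit_pos unfolding thick_def by blast
    qed
    have I: "Im (u j) \<le> (r + 3) / e\<^sup>2" "Im (mob (h j) \<i>) \<le> (r + 3) / e\<^sup>2"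
      using Im_thick_le[OF e t(1)] Im_thick_le[OF e t(2)] r(1) by (simp_all add: add.commute)
    have "(cmod (u j - mob (h j) \<i>))\<^sup>2 \<le> (r + 1) * (Im (u j) * Im (mob (h j) \<i>))"
      by (rule ptd_dist_le[OF uh(2) Im_orbit_pos[OF uh(3)] uh(4)])
    also have "\<dots> \<le> (r + 1) * ((r + 3) / e\<^sup>2 * ((r + 3) / e\<^sup>2))"
      using I r(1) uh(2)[of j] Im_orbit_pos[OF uh(3), of j] by (intro mult_left_mono mult_mono) auto
    finally have "cmod (u j - mob (h j) \<i>) \<le> C" unfolding C_def by (rule real_le_rsqrt)
    then have "\<bar>Re (u j) - Re (mob (h j) \<i>)\<bar> \<le> C" using abs_Re_le_cmod[of "u j - mob (h j) \<i>"] by simp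
    then show ?thesis using uh(1)[of j] \<sigma> by auto
  qed
  \<comment> \<open>Guarantees that the two orbit points have different real parts. Then g is not
    plus or minus the identity, and by \<open>upper_triangular_trivial\<close> it moves
    infinity.\<close>
  obtain N :: nat where N: "real N > \<sigma> * Re (mob (h n) \<i>) + C" using reals_Archimedean2 by blast
  define m where "m = \<rho> (max n0 N)"
  have mN: "m \<ge> N" using seq_suble[OF \<rho>(1), of "max n0 N"] by (simp add: m_def)
  have Rneq: "Re (mob (h m) \<i>) \<noteq> Re (mob (h n) \<i>)" using close[of m] mN N by auto
  define g where "g = mmul (h n) (minv (h m))"
  have gG: "g \<in> G" unfolding g_def by (intro mmul_in minv_in uh)
  have gact: "mob g (mob (h m) z) = mob (h n) z" if "Im z > 0" for z
    unfolding g_def using that hS SL2_minv Im_mob_pos by (simp add: mob_mmul)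
  have g0: "fst (row2 g) \<noteq> 0"
  proof
    assume "fst (row2 g) = 0"
    then have "g = mid \<or> g = (-1,0,0,-1)" using upper_triangular_trivial[OF e gG] by simp
    then have "mob g (mob (h m) \<i>) = mob (h m) \<i>" by (auto simp del: mob.simps) simp
    then show False using gact[of \<i>] Rneq by simp
  qed
  define K where "K = mob (h n) ` cball l \<epsilon>"
  have mc: "continuous_on (cball l \<epsilon>) (mob (h n))"
    using continuous_on_mob[OF hS] \<epsilon>(2) continuous_on_subset by blast
  have "u n \<in> K" unfolding K_def hk[symmetric] using n0[of n0] by (intro imageI) (simp add: n_def dist_commute less_imp_le)
  moreover have "mob g (u m) \<in> K"
  proof -
    have "mob g (u m) = mob (h n) (k m)" using gact[OF kI[of m]] by (simp add: hk)
    then show ?thesis unfolding K_def using n0[of "max n0 N"] by (simp add: m_def dist_commute less_imp_le)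
  qed
  moreover have "compact K" unfolding K_def using mc by (rule compact_continuous_image) simp
  moreover have "path_connected K" unfolding K_def using mc
    by (rule path_connected_continuous_image) (simp add: convex_imp_path_connected)
  moreover have "K \<subseteq> Hplane" unfolding K_def using \<epsilon>(2) hS by blast
  moreover have "K \<inter> thick r = {}"
  proof -
    have "mob (h n) z \<notin> thick r" if z: "z \<in> cball l \<epsilon>" for z
    proof
      assume "mob (h n) z \<in> thick r"
      then have "mob (minv (h n)) (mob (h n) z) \<in> thick r" by (rule thick_mob[OF minv_in[OF uh(3)]])
      moreover have "Im z > 0" using z \<epsilon>(2) by (auto simp: Hplane_def)
      ultimately have "z \<in> thick r" using hS by simp
      then show False using z \<epsilon>(3) by blast
    qed
    then show ?thesis unfolding K_def by blast
  qed
  ultimately show False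
    using no_separating_curve[OF \<sigma> gG g0 r(2) _ unb uh(5)[of n] uh(2)[of n] uh(5)[of m] uh(2)[of m], where B="(r+2)/e\<^sup>2" and K=K]
      Im_thick_le[OF e, of _ r] r(1) by simp
qed

lemma orbit_bounded:
  assumes "finitely_generated G" and e: "e > 0" "\<And>g. g \<in> G \<Longrightarrow> e \<le> norm (row2 g)"
  shows "\<exists>R. \<forall>g\<in>G. cmod (mob g \<i>) \<le> R"
proof -
  obtain r where r: "r > 0" "\<And>g. g \<in> G \<Longrightarrow> path_component (thick r) \<i> (mob g \<i>)"
    using thick_connected[OF assms(1)] by blast
  obtain N1 where N1: "\<forall>h\<in>G. 1 * Re (mob h \<i>) \<le> N1"
    using orbit_bounded_in_direction[of 1, OF _ assms(1) e] by auto
  obtain N2 where N2: "\<forall>h\<in>G. (-1) * Re (mob h \<i>) \<le> N2"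
    using orbit_bounded_in_direction[of "-1", OF _ assms(1) e] by auto
  have "cmod (mob g \<i>) \<le> \<bar>N1\<bar> + \<bar>N2\<bar> + (r + 2) / e\<^sup>2" if "g \<in> G" for g
  proof -
    have "mob g \<i> \<in> thick r" using path_component_mem(2)[OF r(2)[OF that]] .
    then have "Im (mob g \<i>) \<le> (r + 2) / e\<^sup>2" using Im_thick_le[OF e] r(1) by simp
    then show ?thesis
      using cmod_le[of "mob g \<i>"] bspec[OF N1 that] bspec[OF N2 that] Im_orbit_pos[OF that] by linarith
  qed
  then show ?thesis by blast
qed

end

section \<open>Unfolding the norm\<close>

context discrete_SL2 begin

text \<open>A bounded orbit makes infinity an ordinary point. If infinity and its images under g and
  the inverse of g are of comparable nature only through large entries, the determinant bounds the
  norm; otherwise \<open>a / c\<close> and \<open>d / c\<close> are bounded, and either all entries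
  are bounded or g maps the far region into a bounded disc.\<close>

lemma finite_overlap:
  assumes R0: "\<And>g. g \<in> G \<Longrightarrow> cmod (mob g \<i>) \<le> R0"
  shows "\<exists>R>0. finite {g \<in> G. \<exists>z. Im z > 0 \<and> cmod z > R \<and> cmod (mob g z) > R}"
proof -
  define R where "R = max R0 1"
  have R: "R \<ge> 1" by (simp add: R_def)
  have sq: "a\<^sup>2 + b\<^sup>2 \<le> R\<^sup>2 * (c\<^sup>2 + d\<^sup>2)" if g: "(a,b,c,d) \<in> G" for a b c d
  proof -
    have nz: "of_real c * \<i> + complex_of_real d \<noteq> 0" using mob_denom_nonzero[OF in_SL2[OF g], of \<i>] by simp
    have "cmod (mob (a,b,c,d) \<i>) \<le> R" using R0[OF g] by (simp add: R_def)
    then have "cmod (of_real a * \<i> + of_real b) \<le> R * cmod (of_real c * \<i> + of_real d)"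
      using nz by (simp add: norm_divide divide_le_eq)
    then have "(cmod (of_real a * \<i> + of_real b))\<^sup>2 \<le> (R * cmod (of_real c * \<i> + of_real d))\<^sup>2"
      by (intro power_mono) auto
    then show ?thesis by (simp add: power_mult_distrib cmod_power2 algebra_simps)
  qed
  define R1 where "R1 = 4 * R\<^sup>2"
  have R2: "R\<^sup>2 \<ge> 1" using R by simp
  then have R1: "R1 \<ge> 4" by (simp add: R1_def)
  \<comment> \<open>The orbit bound is used for g and for its inverse. With d dominating c, the
    product \<open>a d\<close> has size at least \<open>3 d^2 / (4 R)\<close> while
    \<open>b c\<close> is at most \<open>d^2 / (2 R)\<close>, so the determinant condition bounds
    \<open>d^2\<close>, and with it every entry.\<close>
  have key: "(norm (a,b,c,d))\<^sup>2 \<le> (2 * R\<^sup>2 + 2) * (4 * R)" if g: "(a,b,c,d) \<in> G" "\<bar>d\<bar> > R1 * \<bar>c\<bar>" for a b c d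
  proof -
    have i1: "a\<^sup>2 + b\<^sup>2 \<le> R\<^sup>2 * (c\<^sup>2 + d\<^sup>2)" using sq[OF g(1)] .
    have i2: "d\<^sup>2 + b\<^sup>2 \<le> R\<^sup>2 * (c\<^sup>2 + a\<^sup>2)" using sq[of d "-b" "-c" a] minv_in[OF g(1)] by simp
    have "(R1 * \<bar>c\<bar>)\<^sup>2 \<le> \<bar>d\<bar>\<^sup>2" using g(2) R1 by (intro power_mono) auto
    then have cd: "16 * R^4 * c\<^sup>2 \<le> d\<^sup>2" by (simp add: R1_def power_mult_distrib power2_eq_square eval_nat_numeral algebra_simps)
    have R4: "R\<^sup>2 \<le> R^4" using R by (simp add: power_increasing)
    have c1: "16 * R\<^sup>2 * c\<^sup>2 \<le> d\<^sup>2" using mult_right_mono[OF R4, of "16 * c\<^sup>2"] cd by (simp add: mult_ac)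
    have "c\<^sup>2 \<le> R\<^sup>2 * c\<^sup>2" using mult_right_mono[OF R2, of "c\<^sup>2"] by simp
    moreover have "16 * (R\<^sup>2 * c\<^sup>2) \<le> d\<^sup>2" using c1 by (simp add: mult.assoc)
    ultimately have c2: "c\<^sup>2 \<le> d\<^sup>2" using zero_le_power2[of c] by linarith
    have rd: "R\<^sup>2 * (x + y) = R\<^sup>2 * x + R\<^sup>2 * y" for x y by (rule distrib_left)
    have b2: "b\<^sup>2 \<le> 2 * R\<^sup>2 * d\<^sup>2"
      using i1 mult_left_mono[OF c2, of "R\<^sup>2"] zero_le_power2[of a] zero_le_power2[of R] unfolding rd by linarith
    have a2: "15 * d\<^sup>2 \<le> 16 * R\<^sup>2 * a\<^sup>2"
      using i2 c1 zero_le_power2[of b] unfolding rd by linarith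
    define t where "t = d\<^sup>2 / R"
    have t: "t * R = d\<^sup>2" "t \<ge> 0" using R by (auto simp: t_def)
    have ad: "(3/4) * t \<le> \<bar>a * d\<bar>"
    proof (rule power2_le_imp_le)
      have "16 * R\<^sup>2 * (a*d)\<^sup>2 = (16 * R\<^sup>2 * a\<^sup>2) * d\<^sup>2" by (simp add: power_mult_distrib)
      also have "\<dots> \<ge> (15 * d\<^sup>2) * d\<^sup>2" using a2 by (intro mult_right_mono) auto
      finally have "16 * R\<^sup>2 * (a*d)\<^sup>2 \<ge> 9 * (d\<^sup>2 * d\<^sup>2)" using zero_le_square[of "d\<^sup>2"] by linarith
      also have "d\<^sup>2 * d\<^sup>2 = R\<^sup>2 * t\<^sup>2" unfolding t(1)[symmetric] by (simp add: power2_eq_square mult_ac)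
      finally have "R\<^sup>2 * (9 * t\<^sup>2) \<le> R\<^sup>2 * (16 * (a*d)\<^sup>2)" by (simp add: mult_ac)
      then have "9 * t\<^sup>2 \<le> 16 * (a*d)\<^sup>2" using R2 by (subst (asm) mult_le_cancel_left_pos) auto
      then show "((3/4) * t)\<^sup>2 \<le> \<bar>a * d\<bar>\<^sup>2" by (simp add: power_mult_distrib power_divide)
    qed simp
    have bc: "\<bar>b * c\<bar> \<le> t / 2"
    proof (rule power2_le_imp_le)
      have "16 * R^4 * (b*c)\<^sup>2 = b\<^sup>2 * (16 * R^4 * c\<^sup>2)" by (simp add: power_mult_distrib)
      also have "\<dots> \<le> (2 * R\<^sup>2 * d\<^sup>2) * d\<^sup>2" using b2 cd by (intro mult_mono) auto
      also have "\<dots> = 2 * R\<^sup>2 * (R\<^sup>2 * t\<^sup>2)" unfolding t(1)[symmetric] by (simp add: power2_eq_square mult_ac)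
      also have "\<dots> = R^4 * (2 * t\<^sup>2)" by (simp add: eval_nat_numeral)
      finally have "R^4 * (16 * (b*c)\<^sup>2) \<le> R^4 * (2 * t\<^sup>2)" by (simp add: mult_ac)
      moreover have "R^4 > 0" using R by simp
      ultimately have "16 * (b*c)\<^sup>2 \<le> 2 * t\<^sup>2" by (subst (asm) mult_le_cancel_left_pos) auto
      then have "4 * (b*c)\<^sup>2 \<le> t\<^sup>2" using zero_le_power2[of "b*c"] by linarith
      then show "\<bar>b * c\<bar>\<^sup>2 \<le> (t / 2)\<^sup>2" by (simp add: power_divide)
    qed (use t in simp)
    have "a * d - b * c = 1" using in_SL2[OF g(1)] SL2_iff by blast
    then have "t \<le> 4" using ad bc by linarith
    then have d2: "d\<^sup>2 \<le> 4 * R" using R t(1) mult_right_mono[of t 4 R] by simp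
    have "(norm (a,b,c,d))\<^sup>2 = (a\<^sup>2 + b\<^sup>2) + c\<^sup>2 + d\<^sup>2" by (simp add: norm_Pair)
    also have "\<dots> \<le> R\<^sup>2 * (d\<^sup>2 + d\<^sup>2) + d\<^sup>2 + d\<^sup>2"
    proof -
      have "R\<^sup>2 * (c\<^sup>2 + d\<^sup>2) \<le> R\<^sup>2 * (d\<^sup>2 + d\<^sup>2)" using c2 by (intro mult_left_mono) simp_all
      then show ?thesis using i1 c2 by linarith
    qed
    also have "\<dots> = (2 * R\<^sup>2 + 2) * d\<^sup>2" by (simp add: algebra_simps)
    also have "\<dots> \<le> (2 * R\<^sup>2 + 2) * (4 * R)" using d2 by (intro mult_left_mono) auto
    finally show ?thesis .
  qed
  define Q where "Q = max ((2 * R\<^sup>2 + 2) * (4 * R)) (R\<^sup>2 * (1 + R1\<^sup>2) + 1 + R1\<^sup>2)"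
  let ?E = "{g \<in> G. \<exists>z. Im z > 0 \<and> cmod z > R1 + 1 \<and> cmod (mob g z) > R1 + 1}"
  have "norm g \<le> sqrt Q" if gE: "g \<in> ?E" for g
  proof -
    obtain z where z: "Im z > 0" "cmod z > R1 + 1" "cmod (mob g z) > R1 + 1" and gG: "g \<in> G" using gE by blast
    obtain a b c d where gg: "g = (a,b,c,d)" by (cases g)
    have g: "(a,b,c,d) \<in> G" using gG gg by simp
    have "(norm g)\<^sup>2 \<le> Q"
    proof (cases "\<bar>d\<bar> > R1 * \<bar>c\<bar> \<or> \<bar>a\<bar> > R1 * \<bar>c\<bar>")
      case True
      then show ?thesis
      proof
        assume "\<bar>d\<bar> > R1 * \<bar>c\<bar>"
        then show ?thesis using key[OF g] by (simp add: Q_def gg)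
      next
        assume "\<bar>a\<bar> > R1 * \<bar>c\<bar>"
        then have "(norm (d,-b,-c,a))\<^sup>2 \<le> (2 * R\<^sup>2 + 2) * (4 * R)"
          using key[of d "-b" "-c" a] minv_in[OF g] by simp
        then show ?thesis using norm_minv[of g] by (simp add: Q_def gg)
      qed
    next
      case False
      then have le: "\<bar>d\<bar> \<le> R1 * \<bar>c\<bar>" "\<bar>a\<bar> \<le> R1 * \<bar>c\<bar>" by auto
      have c0: "c \<noteq> 0" using le in_SL2[OF g] by (auto simp: SL2_iff)
      show ?thesis
      proof (cases "\<bar>c\<bar> \<ge> 1")
        case True
        have S: "(a,b,c,d) \<in> SL2" using in_SL2[OF g] .
        have "cmod (z - of_real (- d / c)) \<ge> cmod z - \<bar>d / c\<bar>"
          using norm_triangle_ineq2[of z "of_real (- d / c)"] unfolding norm_of_real by simp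
        moreover have "\<bar>d / c\<bar> \<le> R1" "\<bar>a / c\<bar> \<le> R1" using le c0 by (auto simp: abs_divide pos_divide_le_eq)
        ultimately have zd: "cmod (z - of_real (- d / c)) > 1" using z(2) by linarith
        have c2: "c\<^sup>2 \<ge> 1" using power_mono[OF True, of 2] by simp
        \<comment> \<open>For \<open>|c| \<ge> 1\<close> points at distance more than 1 from the
          pole are sent to within distance 1 of \<open>a / c\<close>, hence not into the far
          region.\<close>
        have "cmod (mob g z - of_real (a / c)) = 1 / (c\<^sup>2 * cmod (z - of_real (- d / c)))"
          unfolding gg mob_minus_pole[OF S c0 z(1)] by (simp add: norm_divide norm_mult norm_power)
        also have "\<dots> \<le> 1"
        proof -
          have "1 * 1 \<le> c\<^sup>2 * cmod (z - of_real (- d / c))" using c2 zd by (intro mult_mono) auto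
          then show ?thesis by (simp add: divide_le_eq)
        qed
        finally have "cmod (mob g z) \<le> \<bar>a / c\<bar> + 1"
          using norm_triangle_ineq2[of "mob g z" "of_real (a / c)"] unfolding norm_of_real by linarith
        then show ?thesis using z(3) \<open>\<bar>a / c\<bar> \<le> R1\<close> by simp
      next
        case False
        then have cc: "\<bar>c\<bar> \<le> 1" by simp
        have "\<bar>d\<bar> \<le> R1 * 1" using le(1) mult_left_mono[OF cc, of R1] R1 by linarith
        then have "\<bar>d\<bar>\<^sup>2 \<le> R1\<^sup>2" by (intro power_mono) auto
        moreover have "\<bar>c\<bar>\<^sup>2 \<le> 1\<^sup>2" using cc by (intro power_mono) auto
        ultimately have "c\<^sup>2 + d\<^sup>2 \<le> 1 + R1\<^sup>2" by simp
        then have "a\<^sup>2 + b\<^sup>2 + (c\<^sup>2 + d\<^sup>2) \<le> R\<^sup>2 * (1 + R1\<^sup>2) + (1 + R1\<^sup>2)"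
          using sq[OF g] mult_left_mono[of "c\<^sup>2 + d\<^sup>2" "1 + R1\<^sup>2" "R\<^sup>2"] by simp
        then show ?thesis by (simp add: Q_def gg norm_Pair)
      qed
    qed
    then show ?thesis by (rule real_le_rsqrt)
  qed
  then have "bounded ?E" unfolding bounded_iff by blast
  then have "finite ?E" by (intro finite_of_bounded) auto
  then show ?thesis using R1 by (intro exI[of _ "R1 + 1"]) auto
qed

end

section \<open>Invariance of the hyperbolic area\<close>

definition cplx_of_vec :: "real^2 \<Rightarrow> complex" where "cplx_of_vec v = Complex (v $ 1) (v $ 2)"
definition vec_of_cplx :: "complex \<Rightarrow> real^2" where "vec_of_cplx z = vector [Re z, Im z]"

lemma cplx_vec_sel [simp]:
  "Re (cplx_of_vec v) = v $ 1" "Im (cplx_of_vec v) = v $ 2" "vec_of_cplx z $ 1 = Re z" "vec_of_cplx z $ 2 = Im z"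
  "vec_of_cplx (cplx_of_vec v) = v" "cplx_of_vec (vec_of_cplx z) = z"
  by (simp_all add: cplx_of_vec_def vec_of_cplx_def vector_2 vec_eq_iff forall_2 complex_eq_iff)

lemma bounded_linear_cplx_of_vec: "bounded_linear cplx_of_vec"
proof -
  have "linear cplx_of_vec" by (rule linearI) (auto simp: complex_eq_iff)
  then show ?thesis by (simp add: linear_conv_bounded_linear)
qed

lemma bounded_linear_vec_of_cplx: "bounded_linear vec_of_cplx"
proof -
  have "linear vec_of_cplx" by (rule linearI) (auto simp: vec_eq_iff forall_2)
  then show ?thesis by (simp add: linear_conv_bounded_linear)
qed

lemma measurable_cplx_of_vec [measurable]: "cplx_of_vec \<in> borel_measurable borel"
  by (intro borel_measurable_continuous_onI linear_continuous_on bounded_linear_cplx_of_vec)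

lemma lborel_complex_eq_distr_vec: "(lborel :: complex measure) = distr lborel borel cplx_of_vec"
proof (rule lborel_eqI)
  fix l u :: complex assume le: "\<And>b. b \<in> Basis \<Longrightarrow> l \<bullet> b \<le> u \<bullet> b"
  have le': "Re l \<le> Re u" "Im l \<le> Im u" using le[of 1] le[of \<i>] by (simp_all add: Basis_complex_def)
  have "cplx_of_vec -` box l u = box (vec_of_cplx l) (vec_of_cplx u)"
    by (auto simp: in_box_complex_iff mem_box_cart forall_2)
  then have "emeasure (distr lborel borel cplx_of_vec) (box l u) = emeasure lborel (box (vec_of_cplx l) (vec_of_cplx u))"
    by (subst emeasure_distr) auto
  also have "\<dots> = ennreal (\<Prod>b\<in>Basis. (vec_of_cplx u - vec_of_cplx l) \<bullet> b)"
  proof -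
    have "vec_of_cplx l $ i \<le> vec_of_cplx u $ i" for i using le' exhaust_2[of i] by auto
    then show ?thesis by (intro emeasure_lborel_box) (auto simp: Basis_vec_def inner_axis)
  qed
  also have "(\<Prod>b\<in>Basis. (vec_of_cplx u - vec_of_cplx l) \<bullet> b) = (\<Prod>i\<in>UNIV. (vec_of_cplx u - vec_of_cplx l) $ i)"
  proof -
    have B: "(Basis :: (real^2) set) = (\<lambda>i. axis i 1) ` UNIV" by (auto simp: Basis_vec_def)
    show ?thesis unfolding B by (subst prod.reindex) (auto simp: inj_on_def axis_eq_axis inner_axis)
  qed
  also have "\<dots> = (Re u - Re l) * (Im u - Im l)"
    by (simp add: UNIV_2)
  also have "\<dots> = (\<Prod>b\<in>Basis. (u - l) \<bullet> b)" by (simp add: Basis_complex_def)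
  finally show "emeasure (distr lborel borel cplx_of_vec) (box l u) = ennreal (\<Prod>b\<in>Basis. (u - l) \<bullet> b)" .
qed simp

lemma nn_integral_complex_vec:
  "f \<in> borel_measurable borel \<Longrightarrow> (\<integral>\<^sup>+z. f z \<partial>lborel) = (\<integral>\<^sup>+v. f (cplx_of_vec v) \<partial>lborel)"
  by (subst lborel_complex_eq_distr_vec) (simp add: nn_integral_distr)

lemma measurable_mob [measurable]: "mob g \<in> borel_measurable borel"
proof -
  obtain a b c d where g: "g = (a,b,c,d)" by (cases g)
  have "(\<lambda>z. (of_real a * z + of_real b) / (of_real c * z + of_real d)) \<in> borel_measurable (borel :: complex measure)"
    by measurable
  then show ?thesis by (simp add: g cong: measurable_cong)
qed

lemma measurable_Hplane [measurable]: "Hplane \<in> sets borel"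
proof -
  have "open Hplane" unfolding Hplane_def by (simp add: open_halfspace_Im_gt)
  then show ?thesis by simp
qed

lemma nn_integral_hyp_measure:
  assumes [measurable]: "f \<in> borel_measurable borel"
  shows "(\<integral>\<^sup>+z. f z \<partial>hyp_measure) = (\<integral>\<^sup>+z. indicator Hplane z * ennreal (1 / (Im z)\<^sup>2) * f z \<partial>lborel)"
  unfolding hyp_measure_def by (rule nn_integral_density) measurable

text \<open>The Jacobian \<open>|c z + d|^(-4)\<close> cancels against the change of
  \<open>(Im z)^(-2)\<close>. The change of variables is carried out on \<open>real^2\<close> for
  absolutely integrable functions, which is what the finiteness hypothesis supplies.\<close>

lemma nn_integral_hyp_mob:
  fixes f :: "complex \<Rightarrow> real"
  assumes g: "g \<in> SL2" and [measurable]: "f \<in> borel_measurable borel" and nn: "\<And>z. f z \<ge> 0"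
    and fin: "(\<integral>\<^sup>+z. f z \<partial>hyp_measure) < \<infinity>"
  shows "(\<integral>\<^sup>+z. f (mob g z) \<partial>hyp_measure) = (\<integral>\<^sup>+z. f z \<partial>hyp_measure)"
proof -
  obtain a b c d where gg: "g = (a,b,c,d)" by (cases g)
  define S :: "(real^2) set" where "S = {v. v $ 2 > 0}"
  define T where "T v = vec_of_cplx (mob g (cplx_of_vec v))" for v
  define m where "m v = 1 / (of_real c * cplx_of_vec v + of_real d)\<^sup>2" for v
  define T' where "T' v = (\<lambda>h. vec_of_cplx (m v * cplx_of_vec h))" for v
  define H where "H v = f (cplx_of_vec v) / (v $ 2)\<^sup>2" for v :: "real^2"
  have SH: "v \<in> S \<longleftrightarrow> cplx_of_vec v \<in> Hplane" for v by (simp add: S_def Hplane_def)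
  have SI: "Im (cplx_of_vec v) > 0" if "v \<in> S" for v using that by (simp add: S_def)
  have S_meas [measurable]: "S \<in> sets borel"
  proof -
    have "S = cplx_of_vec -` Hplane \<inter> space borel" using SH by auto
    then show ?thesis using measurable_sets[OF measurable_cplx_of_vec measurable_Hplane] by simp
  qed
  have H_meas [measurable]: "H \<in> borel_measurable borel"
  proof -
    have "H = (\<lambda>v. (\<lambda>z. f z / (Im z)\<^sup>2) (cplx_of_vec v))" by (simp add: H_def fun_eq_iff)
    moreover have "(\<lambda>v. (\<lambda>z. f z / (Im z)\<^sup>2) (cplx_of_vec v)) \<in> borel_measurable borel"
      by measurable
    ultimately show ?thesis by simp
  qed
  have Hnn: "H v \<ge> 0" for v using nn by (simp add: H_def)
  have I: "(\<integral>\<^sup>+z. f z \<partial>hyp_measure) = (\<integral>\<^sup>+v. ennreal (indicator S v * H v) \<partial>lborel)"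
  proof -
    have "(\<integral>\<^sup>+z. f z \<partial>hyp_measure) = (\<integral>\<^sup>+z. ennreal (indicator Hplane z * (f z / (Im z)\<^sup>2)) \<partial>lborel)"
      by (subst nn_integral_hyp_measure)
        (auto intro!: nn_integral_cong simp: indicator_def ennreal_mult[symmetric] nn)
    also have "\<dots> = (\<integral>\<^sup>+v. ennreal (indicator S v * H v) \<partial>lborel)"
      by (subst nn_integral_complex_vec) (auto intro!: nn_integral_cong simp: indicator_def SH H_def)
    finally show ?thesis .
  qed
  obtain r where r: "(\<integral>\<^sup>+v. ennreal (indicator S v * H v) \<partial>lborel) = ennreal r" "r \<ge> 0"
    using fin unfolding I by (cases "\<integral>\<^sup>+v. ennreal (indicator S v * H v) \<partial>lborel" rule: ennreal_cases) auto
  have "((\<lambda>v. indicator S v * H v) has_integral r) UNIV"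
    by (rule nn_integral_has_integral) (use r Hnn in auto)
  then have "((\<lambda>v. if v \<in> S then H v else 0) has_integral r) UNIV"
    by (rule has_integral_cong[THEN iffD1, rotated]) (simp add: indicator_def)
  then have Hr: "(H has_integral r) S" by (simp add: has_integral_restrict_UNIV)
  have der: "(T has_derivative T' v) (at v within S)" if v: "v \<in> S" for v
  proof -
    have nz: "of_real c * cplx_of_vec v + of_real d \<noteq> 0"
      using mob_denom_nonzero[of a b c d] g SI[OF v] by (simp add: gg)
    have ad: "complex_of_real a * of_real d - of_real b * of_real c = 1"
      using g by (simp add: gg SL2_iff flip: of_real_mult of_real_diff)
    have "(mob g has_field_derivative m v) (at (cplx_of_vec v))"
    proof -
      define z where "z = cplx_of_vec v"
      have "((\<lambda>z. (of_real a * z + of_real b) / (of_real c * z + of_real d)) has_field_derivative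
        (of_real a * (of_real c * z + of_real d) - (of_real a * z + of_real b) * of_real c) /
          ((of_real c * z + of_real d) * (of_real c * z + of_real d))) (at z)"
        using nz unfolding z_def by (intro DERIV_divide) (auto intro!: derivative_eq_intros)
      also have "of_real a * (of_real c * z + of_real d) - (of_real a * z + of_real b) * of_real c = 1"
        using ad by (simp add: algebra_simps)
      finally have "((\<lambda>z. (of_real a * z + of_real b) / (of_real c * z + of_real d)) has_field_derivative m v) (at z)"
        by (simp add: m_def z_def power2_eq_square)
      moreover have "mob g = (\<lambda>z. (of_real a * z + of_real b) / (of_real c * z + of_real d))"
        by (simp add: gg fun_eq_iff)
      ultimately show ?thesis by (simp only: z_def)
    qed
    then have d1: "(mob g has_derivative (*) (m v)) (at (cplx_of_vec v))"
      by (simp add: has_field_derivative_def)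
    have d2: "(cplx_of_vec has_derivative cplx_of_vec) (at v within S)"
      using bounded_linear_cplx_of_vec by (rule bounded_linear_imp_has_derivative)
    have d3: "((\<lambda>v. mob g (cplx_of_vec v)) has_derivative (\<lambda>h. m v * cplx_of_vec h)) (at v within S)"
      by (rule has_derivative_compose[OF d2 d1])
    show ?thesis unfolding T_def[abs_def] T'_def
      by (rule bounded_linear.has_derivative[OF bounded_linear_vec_of_cplx d3])
  qed
  have TS: "T ` S = S"
  proof (intro equalityI subsetI)
    fix v assume "v \<in> T ` S"
    then show "v \<in> S" using g by (auto simp: T_def SH)
  next
    fix v assume "v \<in> S"
    then have "Im (cplx_of_vec v) > 0" by (rule SI)
    then have "v = T (vec_of_cplx (mob (minv g) (cplx_of_vec v)))" "vec_of_cplx (mob (minv g) (cplx_of_vec v)) \<in> S"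
      using g SL2_minv Im_mob_pos by (simp_all add: T_def S_def)
    then show "v \<in> T ` S" by blast
  qed
  have inj: "inj_on T S"
  proof (rule inj_onI)
    fix x y assume xy: "x \<in> S" "y \<in> S" "T x = T y"
    then have "cplx_of_vec (T x) = cplx_of_vec (T y)" by simp
    then have "mob g (cplx_of_vec x) = mob g (cplx_of_vec y)" by (simp add: T_def)
    then have "mob (minv g) (mob g (cplx_of_vec x)) = mob (minv g) (mob g (cplx_of_vec y))" by simp
    then have "cplx_of_vec x = cplx_of_vec y" using g SI xy by simp
    then have "vec_of_cplx (cplx_of_vec x) = vec_of_cplx (cplx_of_vec y)" by simp
    then show "x = y" by simp
  qed
  have det: "\<bar>det (matrix (T' v))\<bar> = (cmod (m v))\<^sup>2" for v
  proof -
    have "det (matrix (T' v)) = Re (m v) * Re (m v) + Im (m v) * Im (m v)"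
      by (simp add: det_2 matrix_def T'_def axis_def)
    then show ?thesis by (simp add: cmod_power2) (simp add: power2_eq_square)
  qed
  have int: "\<bar>det (matrix (T' v))\<bar> * H (T v) = f (mob g (cplx_of_vec v)) / (v $ 2)\<^sup>2" if v: "v \<in> S" for v
  proof -
    define k where "k = cmod (of_real c * cplx_of_vec v + of_real d)"
    have k: "k > 0" using mob_denom_nonzero[of a b c d] g SI[OF v] by (simp add: gg k_def)
    have "Im (mob g (cplx_of_vec v)) = v $ 2 / k\<^sup>2"
      using Im_mob[of a b c d "cplx_of_vec v"] g by (simp add: gg k_def)
    moreover have "(cmod (m v))\<^sup>2 = 1 / (k\<^sup>2)\<^sup>2" by (simp add: m_def norm_divide norm_power k_def power_divide)
    ultimately show ?thesis using k SI[OF v] unfolding det by (simp add: H_def T_def power_divide)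
  qed
  have S_leb: "S \<in> sets lebesgue" using S_meas by (simp add: sets_completionI_sets)
  have iff: "(\<lambda>v. \<bar>det (matrix (T' v))\<bar> *\<^sub>R ((vec::real\<Rightarrow>real^1) (H (T v)))) absolutely_integrable_on S \<and>
      integral S (\<lambda>v. \<bar>det (matrix (T' v))\<bar> *\<^sub>R ((vec::real\<Rightarrow>real^1) (H (T v)))) = vec r
    \<longleftrightarrow> (\<lambda>v. (vec::real\<Rightarrow>real^1) (H v)) absolutely_integrable_on (T ` S) \<and> integral (T ` S) (\<lambda>v. (vec::real\<Rightarrow>real^1) (H v)) = vec r"
    by (rule has_absolute_integral_change_of_variables[OF S_leb der inj])
  have "H absolutely_integrable_on S"
    using Hr Hnn by (subst absolutely_integrable_on_iff_nonneg) auto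
  then have "(\<lambda>v. \<bar>det (matrix (T' v))\<bar> * H (T v)) absolutely_integrable_on S \<and>
     integral S (\<lambda>v. \<bar>det (matrix (T' v))\<bar> * H (T v)) = r"
    using iff Hr unfolding TS absolutely_integrable_on_1_iff integral_on_1_eq
    by (auto simp: integral_unique vec_eq_iff)
  then have "((\<lambda>v. \<bar>det (matrix (T' v))\<bar> * H (T v)) has_integral r) S"
    using set_lebesgue_integral_eq_integral(1) integrable_integral by blast
  then have "((\<lambda>v. f (mob g (cplx_of_vec v)) / (v $ 2)\<^sup>2) has_integral r) S"
    by (rule has_integral_cong[THEN iffD1, rotated]) (rule int)
  then have "(\<integral>\<^sup>+v. ennreal (f (mob g (cplx_of_vec v)) / (v $ 2)\<^sup>2) * indicator S v \<partial>lborel) = ennreal r"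
    by (intro nn_integral_has_integral_lebesgue') (use nn in auto)
  moreover have "(\<integral>\<^sup>+z. f (mob g z) \<partial>hyp_measure) = (\<integral>\<^sup>+v. ennreal (f (mob g (cplx_of_vec v)) / (v $ 2)\<^sup>2) * indicator S v \<partial>lborel)"
  proof -
    have "(\<integral>\<^sup>+z. f (mob g z) \<partial>hyp_measure) = (\<integral>\<^sup>+z. ennreal (f (mob g z) / (Im z)\<^sup>2) * indicator Hplane z \<partial>lborel)"
      by (subst nn_integral_hyp_measure)
        (auto intro!: nn_integral_cong simp: indicator_def ennreal_mult[symmetric] nn)
    also have "\<dots> = (\<integral>\<^sup>+v. ennreal (f (mob g (cplx_of_vec v)) / (v $ 2)\<^sup>2) * indicator S v \<partial>lborel)"
      by (subst nn_integral_complex_vec) (auto intro!: nn_integral_cong simp: indicator_def SH)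
    finally show ?thesis .
  qed
  ultimately show ?thesis using I r by simp
qed

context discrete_SL2 begin

text \<open>Unfolding: a region that meets each orbit a bounded number of times carries at most that many
  copies of the mass of a fundamental domain.\<close>

lemma integral_far_finite:
  assumes E: "finite {g \<in> G. \<exists>z. Im z > 0 \<and> cmod z > R \<and> cmod (mob g z) > R}"
    and inv: "invariant G \<phi>" and L2: "L2_quot G \<phi>"
  shows "(\<integral>\<^sup>+z. ennreal ((cmod (\<phi> z))\<^sup>2) * indicator {z. Im z > 0 \<and> cmod z > R} z \<partial>hyp_measure) < \<infinity>"
proof -
  define E where "E = {g \<in> G. \<exists>z. Im z > 0 \<and> cmod z > R \<and> cmod (mob g z) > R}"
  have finE: "finite E" using E by (simp add: E_def)
  define D where "D = {z. Im z > 0 \<and> cmod z > R}"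
  obtain F where F: "fund_domain G F"
    "(\<integral>\<^sup>+ z. ennreal ((cmod (\<phi> z))^2) * indicator F z \<partial>hyp_measure) < \<infinity>"
    and \<phi>_meas: "\<phi> \<in> borel_measurable lborel"
    using L2 unfolding L2_quot_def by blast
  have \<phi>_meas' [measurable]: "\<phi> \<in> borel_measurable borel" using \<phi>_meas by simp
  have F_meas [measurable]: "F \<in> sets borel" using F(1) by (simp add: fund_domain_def)
  have FH: "F \<subseteq> Hplane" and Fcov: "\<And>z. z \<in> Hplane \<Longrightarrow> \<exists>g\<in>G. mob g z \<in> F"
    using F(1) by (auto simp: fund_domain_def)
  have D_meas [measurable]: "D \<in> sets borel"
  proof -
    have "open D" unfolding D_def
      by (intro open_Collect_conj open_Collect_less continuous_intros)
    then show ?thesis by simp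
  qed
  define q where "q z = (cmod (\<phi> z))\<^sup>2" for z
  have q_meas [measurable]: "q \<in> borel_measurable borel" unfolding q_def[abs_def] by measurable
  have qinv: "q (mob g z) = q z" if "g \<in> G" "z \<in> Hplane" for g z
    using inv that by (simp add: invariant_def q_def)
  have AE_H: "AE z in hyp_measure. z \<in> Hplane"
    unfolding hyp_measure_def by (subst AE_density) (auto simp: indicator_def)
  \<comment> \<open>The mass of the fundamental domain that the inverse of \<open>g\<close> moves
    into the far region D.\<close>
  define f where "f g w = q w * indicator F w * indicator D (mob (minv g) w)" for g w
  have f_meas [measurable]: "f g \<in> borel_measurable borel" for g
  proof -
    have "(\<lambda>w. indicator D (mob (minv g) w) :: real) \<in> borel_measurable borel"
      using measurable_compose[OF measurable_mob[of "minv g"], of "indicator D :: complex \<Rightarrow> real" borel] by simp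
    then show ?thesis unfolding f_def[abs_def] by measurable
  qed
  have fnn: "f g w \<ge> 0" for g w by (simp add: f_def q_def)
  have f_le: "f g w \<le> q w * indicator F w" for g w by (simp add: f_def q_def indicator_def)
  have hyp_sets [measurable_cong]: "sets hyp_measure = sets borel" by (simp add: hyp_measure_def)
  have qF: "(\<integral>\<^sup>+ z. ennreal (q z * indicator F z) \<partial>hyp_measure) < \<infinity>"
  proof -
    have "(\<integral>\<^sup>+ z. ennreal (q z * indicator F z) \<partial>hyp_measure) = (\<integral>\<^sup>+ z. ennreal ((cmod (\<phi> z))^2) * indicator F z \<partial>hyp_measure)"
      by (intro nn_integral_cong) (auto simp: q_def indicator_def)
    then show ?thesis using F(2) by simp
  qed
  have ffin: "(\<integral>\<^sup>+w. f g w \<partial>hyp_measure) < \<infinity>" for g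
    using nn_integral_mono[of hyp_measure "\<lambda>w. ennreal (f g w)" "\<lambda>w. ennreal (q w * indicator F w)"] f_le qF
    by (meson ennreal_leI le_less_trans)
  have count: "(\<integral>\<^sup>+g. indicator D (mob (minv g) w) \<partial>count_space G) \<le> ennreal (real (card E))" if w: "w \<in> Hplane" for w
  proof -
    define A where "A = {g \<in> G. mob (minv g) w \<in> D}"
    have "finite A \<and> card A \<le> card E"
    proof (cases "A = {}")
      case False
      then obtain g0 where g0: "g0 \<in> A" by blast
      \<comment> \<open>All translates of w inside D are compared with one of them:
        \<open>m g\<close> maps the chosen translate to another, so it belongs to
        \<open>E\<close>.\<close>
      define m where "m g = mmul (minv g) g0" for g
      have g0G: "g0 \<in> G" "mob (minv g0) w \<in> D" using g0 by (auto simp: A_def simp del: mob.simps)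
      have mE: "m g \<in> E" if gA: "g \<in> A" for g
      proof -
        have gG: "g \<in> G" "mob (minv g) w \<in> D" using gA unfolding A_def by blast+
        have Iw: "Im w > 0" using w by (simp add: Hplane_def)
        define z where "z = mob (minv g0) w"
        have z: "Im z > 0" "cmod z > R" using g0G(2) by (auto simp: D_def z_def)
        have "mob (m g) z = mob (minv g) w"
          using in_SL2[OF g0G(1)] in_SL2[OF gG(1)] SL2_minv z(1) Iw by (simp add: m_def mob_mmul z_def)
        then have "cmod (mob (m g) z) > R" using gG(2) by (simp add: D_def)
        moreover have "m g \<in> G" unfolding m_def using gG g0G mmul_in minv_in by blast
        ultimately show ?thesis using z unfolding E_def by blast
      qed
      have "inj_on m A"
      proof (rule inj_onI)
        fix x y assume xy: "x \<in> A" "y \<in> A" "m x = m y"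
        have "g0 \<in> SL2" using g0G in_SL2 by blast
        then have "minv x = minv y" using xy(3) mmul_cancel_right(1) unfolding m_def by metis
        then show "x = y" by (metis minv_minv)
      qed
      then show ?thesis using mE finE by (meson card_inj_on_le finite_imageD finite_subset image_subsetI)
    qed simp
    then have fin: "finite A" "card A \<le> card E" by auto
    have "(\<integral>\<^sup>+g. indicator D (mob (minv g) w) \<partial>count_space G) = (\<integral>\<^sup>+g. indicator A g \<partial>count_space G)"
      by (intro nn_integral_cong) (simp add: A_def indicator_def)
    also have "\<dots> = emeasure (count_space G) A"
      by (rule nn_integral_indicator) (auto simp: A_def)
    also have "\<dots> = of_nat (card A)" using fin by (intro emeasure_count_space_finite) (auto simp: A_def)
    also have "\<dots> = ennreal (real (card A))" by (simp add: ennreal_of_nat_eq_real_of_nat)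
    also have "\<dots> \<le> ennreal (real (card E))" using fin by (intro ennreal_leI) simp
    finally show ?thesis .
  qed
  \<comment> \<open>Each z in D is moved into F by some g, and this single term of the sum already
    equals \<open>q z\<close> by invariance.\<close>
  have cover: "ennreal (q z) * indicator D z \<le> (\<integral>\<^sup>+g. f g (mob g z) \<partial>count_space G)" if z: "z \<in> Hplane" for z
  proof -
    obtain g where g: "g \<in> G" "mob g z \<in> F" using Fcov[OF z] by blast
    have "f g (mob g z) = q z * indicator D z"
      using g z in_SL2[OF g(1)] qinv[OF g(1) z] by (simp add: f_def Hplane_def)
    then have "ennreal (q z) * indicator D z = ennreal (f g (mob g z))" by (simp add: indicator_def)
    also have "\<dots> = (\<integral>\<^sup>+h. ennreal (f g (mob g z)) * indicator {g} h \<partial>count_space G)"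
      using g(1) by (subst nn_integral_cmult_indicator) auto
    also have "\<dots> \<le> (\<integral>\<^sup>+h. f h (mob h z) \<partial>count_space G)"
      by (intro nn_integral_mono) (simp add: indicator_def)
    finally show ?thesis .
  qed
  have fm: "(\<lambda>z. ennreal (f g (mob g z))) \<in> borel_measurable hyp_measure" for g
    using measurable_compose[OF measurable_mob f_meas] by (simp add: measurable_cong_sets[OF hyp_sets refl])
  have "(\<integral>\<^sup>+z. ennreal ((cmod (\<phi> z))\<^sup>2) * indicator {z. Im z > 0 \<and> cmod z > R} z \<partial>hyp_measure)
     = (\<integral>\<^sup>+z. ennreal (q z) * indicator D z \<partial>hyp_measure)" by (simp add: q_def D_def)
  also have "\<dots> \<le> (\<integral>\<^sup>+z. \<integral>\<^sup>+g. f g (mob g z) \<partial>count_space G \<partial>hyp_measure)"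
    using AE_H cover by (intro nn_integral_mono_AE) auto
  also have "\<dots> = (\<integral>\<^sup>+g. \<integral>\<^sup>+z. f g (mob g z) \<partial>hyp_measure \<partial>count_space G)"
    by (intro nn_integral_count_space_nn_integral countable_G fm)
  also have "\<dots> = (\<integral>\<^sup>+g. \<integral>\<^sup>+w. f g w \<partial>hyp_measure \<partial>count_space G)"
    by (intro nn_integral_cong nn_integral_hyp_mob in_SL2 f_meas fnn ffin) simp
  also have "\<dots> = (\<integral>\<^sup>+w. \<integral>\<^sup>+g. f g w \<partial>count_space G \<partial>hyp_measure)"
    by (intro nn_integral_count_space_nn_integral[symmetric] countable_G) measurable
  also have "\<dots> \<le> (\<integral>\<^sup>+w. ennreal (real (card E)) * ennreal (q w * indicator F w) \<partial>hyp_measure)"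
  proof (intro nn_integral_mono_AE, use AE_H in eventually_elim)
    fix w assume w: "w \<in> Hplane"
    have "(\<integral>\<^sup>+g. f g w \<partial>count_space G) = (\<integral>\<^sup>+g. ennreal (q w * indicator F w) * indicator D (mob (minv g) w) \<partial>count_space G)"
      by (intro nn_integral_cong) (simp add: f_def indicator_def)
    also have "\<dots> = ennreal (q w * indicator F w) * (\<integral>\<^sup>+g. indicator D (mob (minv g) w) \<partial>count_space G)"
      by (rule nn_integral_cmult) simp
    also have "\<dots> \<le> ennreal (q w * indicator F w) * ennreal (real (card E))"
      by (intro mult_left_mono count w) simp
    finally show "(\<integral>\<^sup>+g. f g w \<partial>count_space G) \<le> ennreal (real (card E)) * ennreal (q w * indicator F w)"
      by (simp add: mult.commute)
  qed
  also have "\<dots> = ennreal (real (card E)) * (\<integral>\<^sup>+w. ennreal (q w * indicator F w) \<partial>hyp_measure)"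
    by (rule nn_integral_cmult) measurable
  also have "\<dots> < \<infinity>" using qF by (simp add: ennreal_mult_less_top)
  finally show ?thesis .
qed

end

section \<open>The decay estimate\<close>

lemma measurable_Complex_pair: "(\<lambda>p. Complex (fst p) (snd p)) \<in> borel_measurable (borel :: (real \<times> real) measure)"
  unfolding Complex_eq by (intro borel_measurable_continuous_onI continuous_intros)

text \<open>The Green inequality is integrated over pairs of reals, whereas
  \<open>hyp_measure\<close> lives on the complex numbers.\<close>

lemma lborel_complex_eq_distr_pair:
  "(lborel :: complex measure) = distr (lborel :: (real \<times> real) measure) borel (\<lambda>p. Complex (fst p) (snd p))"
proof (rule lborel_eqI)
  fix l u :: complex assume le: "\<And>b. b \<in> Basis \<Longrightarrow> l \<bullet> b \<le> u \<bullet> b"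
  have le': "Re l \<le> Re u" "Im l \<le> Im u" using le[of 1] le[of \<i>] by (simp_all add: Basis_complex_def)
  have "(\<lambda>p. Complex (fst p) (snd p)) -` box l u = {Re l<..<Re u} \<times> {Im l<..<Im u}"
    by (auto simp: in_box_complex_iff)
  then have "emeasure (distr (lborel :: (real \<times> real) measure) borel (\<lambda>p. Complex (fst p) (snd p))) (box l u)
     = emeasure lborel ({Re l<..<Re u} \<times> {Im l<..<Im u})"
    using measurable_Complex_pair by (subst emeasure_distr) auto
  also have "\<dots> = emeasure (lborel \<Otimes>\<^sub>M lborel) ({Re l<..<Re u} \<times> {Im l<..<Im u})"
    by (simp add: lborel_prod)
  also have "\<dots> = emeasure lborel {Re l<..<Re u} * emeasure lborel {Im l<..<Im u}"
    by (intro lborel.emeasure_pair_measure_Times) auto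
  also have "\<dots> = ennreal ((Re u - Re l) * (Im u - Im l))"
    using le' by (simp add: ennreal_mult)
  also have "(Re u - Re l) * (Im u - Im l) = (\<Prod>b\<in>Basis. (u - l) \<bullet> b)" by (simp add: Basis_complex_def)
  finally show "emeasure (distr (lborel :: (real \<times> real) measure) borel (\<lambda>p. Complex (fst p) (snd p))) (box l u)
    = ennreal (\<Prod>b\<in>Basis. (u - l) \<bullet> b)" .
qed simp

lemma nn_integral_complex_pair:
  "f \<in> borel_measurable borel \<Longrightarrow>
    (\<integral>\<^sup>+z. f z \<partial>lborel) = (\<integral>\<^sup>+p. f (Complex (fst p) (snd p)) \<partial>(lborel :: (real \<times> real) measure))"
  by (subst lborel_complex_eq_distr_pair) (simp add: nn_integral_distr measurable_Complex_pair)

text \<open>The comparison argument concerns real functions. A real-linear L of norm at most 1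
  preserves the equation and the square integrability, which treats \<open>Re\<close> and
  \<open>Im\<close> at once.\<close>

lemma real_component_decay:
  fixes L :: "complex \<Rightarrow> real"
  assumes L: "bounded_linear L" "\<And>z. \<bar>L z\<bar> \<le> cmod z"
    and s: "s > 1/2" and R: "R > 0" and eig: "laplace_eigenfunction \<phi> (s * (1 - s))"
    and meas: "\<phi> \<in> borel_measurable borel"
    and fin: "(\<integral>\<^sup>+z. ennreal ((cmod (\<phi> z))\<^sup>2) * indicator {z. Im z > 0 \<and> cmod z > R} z \<partial>hyp_measure) < \<infinity>"
  shows "\<exists>C K. \<forall>x y. y > 0 \<longrightarrow> x\<^sup>2 + y\<^sup>2 \<ge> K \<longrightarrow> \<bar>L (\<phi> (Complex x y))\<bar> \<le> C * height x y powr s"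
proof -
  obtain \<phi>x \<phi>y \<phi>xx \<phi>yy where c: "continuous_on Hplane \<phi>" "continuous_on Hplane \<phi>x" "continuous_on Hplane \<phi>y"
      "continuous_on Hplane \<phi>xx" "continuous_on Hplane \<phi>yy"
    and d: "\<And>z. z \<in> Hplane \<Longrightarrow> ((\<lambda>t. \<phi> (Complex t (Im z))) has_vector_derivative \<phi>x z) (at (Re z))"
      "\<And>z. z \<in> Hplane \<Longrightarrow> ((\<lambda>t. \<phi> (Complex (Re z) t)) has_vector_derivative \<phi>y z) (at (Im z))"
      "\<And>z. z \<in> Hplane \<Longrightarrow> ((\<lambda>t. \<phi>x (Complex t (Im z))) has_vector_derivative \<phi>xx z) (at (Re z))"
      "\<And>z. z \<in> Hplane \<Longrightarrow> ((\<lambda>t. \<phi>y (Complex (Re z) t)) has_vector_derivative \<phi>yy z) (at (Im z))"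
    and pde: "\<And>z. z \<in> Hplane \<Longrightarrow> - (of_real ((Im z)^2)) * (\<phi>xx z + \<phi>yy z) = of_real (s * (1 - s)) * \<phi> z"
    using eig unfolding laplace_eigenfunction_def by blast
  have H: "Complex x y \<in> Hplane" if "y > 0" for x y using that by (simp add: Hplane_def)
  interpret L: bounded_linear L by (rule L(1))
  define q where "q = (\<lambda>p. indicator {p. snd p > 0 \<and> (fst p)\<^sup>2 + (snd p)\<^sup>2 > R\<^sup>2} p * ((L (\<phi> (Complex (fst p) (snd p))))\<^sup>2 / (snd p)\<^sup>2))"
  have cont: "continuous_on upper (\<lambda>p. L (g (Complex (fst p) (snd p))))" if "continuous_on Hplane g" for g
  proof -
    have "continuous_on upper (\<lambda>p. Complex (fst p) (snd p))" unfolding Complex_eq by (intro continuous_intros)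
    then have "continuous_on upper (\<lambda>p. g (Complex (fst p) (snd p)))"
      by (rule continuous_on_compose2[OF that]) (auto simp: Hplane_def)
    then show ?thesis by (rule L.continuous_on)
  qed
  have der: "((\<lambda>t. L (g t)) has_real_derivative L g') (at t)" if "(g has_vector_derivative g') (at t)" for g g' t
    using L.has_vector_derivative[OF that] by (simp add: has_real_derivative_iff_has_vector_derivative)
  have C2: "C2_on upper (\<lambda>x y. L (\<phi> (Complex x y))) (\<lambda>x y. L (\<phi>x (Complex x y))) (\<lambda>x y. L (\<phi>y (Complex x y)))
     (\<lambda>x y. L (\<phi>xx (Complex x y))) (\<lambda>x y. L (\<phi>yy (Complex x y)))"
    unfolding C2_on_def case_prod_beta
  proof (intro conjI ballI cont c)
    fix p :: "real \<times> real" assume p: "p \<in> upper"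
    then have z: "Complex (fst p) (snd p) \<in> Hplane" using H by simp
    show "((\<lambda>t. L (\<phi> (Complex t (snd p)))) has_real_derivative L (\<phi>x (Complex (fst p) (snd p)))) (at (fst p))"
      "((\<lambda>t. L (\<phi> (Complex (fst p) t))) has_real_derivative L (\<phi>y (Complex (fst p) (snd p)))) (at (snd p))"
      "((\<lambda>t. L (\<phi>x (Complex t (snd p)))) has_real_derivative L (\<phi>xx (Complex (fst p) (snd p)))) (at (fst p))"
      "((\<lambda>t. L (\<phi>y (Complex (fst p) t))) has_real_derivative L (\<phi>yy (Complex (fst p) (snd p)))) (at (snd p))"
      using d[OF z] by (auto intro!: der)
  qed
  have eig': "L (\<phi>xx (Complex x y)) + L (\<phi>yy (Complex x y)) = s * (s - 1) / y\<^sup>2 * L (\<phi> (Complex x y))" if y: "y > 0" for x y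
  proof -
    have "(- (y\<^sup>2)) *\<^sub>R (\<phi>xx (Complex x y) + \<phi>yy (Complex x y)) = (s * (1 - s)) *\<^sub>R \<phi> (Complex x y)"
      using pde[OF H[OF y], of x] by (simp add: scaleR_conv_of_real)
    then have "L ((- (y\<^sup>2)) *\<^sub>R (\<phi>xx (Complex x y) + \<phi>yy (Complex x y))) = L ((s * (1 - s)) *\<^sub>R \<phi> (Complex x y))" by simp
    then have "- (y\<^sup>2) * (L (\<phi>xx (Complex x y)) + L (\<phi>yy (Complex x y))) = s * (1 - s) * L (\<phi> (Complex x y))"
      unfolding L.scaleR L.add by simp
    then have "(L (\<phi>xx (Complex x y)) + L (\<phi>yy (Complex x y))) * y\<^sup>2 = s * (s - 1) * L (\<phi> (Complex x y))"
      by (simp add: algebra_simps)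
    then show ?thesis using y by (simp add: eq_divide_eq)
  qed
  have L_meas: "L \<in> borel_measurable borel" by (intro borel_measurable_continuous_onI L.continuous_on continuous_on_id)
  have \<phi>p: "(\<lambda>p. \<phi> (Complex (fst p) (snd p))) \<in> borel_measurable borel"
    using measurable_compose[OF measurable_Complex_pair meas] .
  have D_meas: "{p :: real \<times> real. snd p > 0 \<and> (fst p)\<^sup>2 + (snd p)\<^sup>2 > R\<^sup>2} \<in> sets borel"
  proof -
    have "open {p :: real \<times> real. snd p > 0 \<and> (fst p)\<^sup>2 + (snd p)\<^sup>2 > R\<^sup>2}"
      by (intro open_Collect_conj open_Collect_less continuous_intros)
    then show ?thesis by simp
  qed
  have q_meas: "q \<in> borel_measurable borel"
  proof -
    have 1: "(\<lambda>p. L (\<phi> (Complex (fst p) (snd p)))) \<in> borel_measurable borel" using measurable_compose[OF \<phi>p L_meas] .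
    have 2: "(\<lambda>p. snd p) \<in> borel_measurable (borel :: (real \<times> real) measure)" by (intro borel_measurable_continuous_onI continuous_intros)
    show ?thesis unfolding q_def
      by (intro borel_measurable_times borel_measurable_divide borel_measurable_power 1 2 borel_measurable_indicator D_meas)
  qed
  have "(\<integral>\<^sup>+p. ennreal (q p) \<partial>lborel) \<le> (\<integral>\<^sup>+z. ennreal ((cmod (\<phi> z))\<^sup>2) * indicator {z. Im z > 0 \<and> cmod z > R} z \<partial>hyp_measure)"
  proof -
    have D': "{z. Im z > 0 \<and> cmod z > R} \<in> sets borel"
    proof -
      have "open {z. Im z > 0 \<and> cmod z > R}" by (intro open_Collect_conj open_Collect_less continuous_intros)
      then show ?thesis by simp
    qed
    define h where "h z = indicator Hplane z * ennreal (1 / (Im z)\<^sup>2) * (ennreal ((cmod (\<phi> z))\<^sup>2) * indicator {z. Im z > 0 \<and> cmod z > R} z)" for z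
    note [measurable] = meas D'
    have h: "h \<in> borel_measurable borel" unfolding h_def[abs_def] by measurable
    have "(\<integral>\<^sup>+z. ennreal ((cmod (\<phi> z))\<^sup>2) * indicator {z. Im z > 0 \<and> cmod z > R} z \<partial>hyp_measure) = (\<integral>\<^sup>+z. h z \<partial>lborel)"
      unfolding h_def by (rule nn_integral_hyp_measure) measurable
    also have "\<dots> = (\<integral>\<^sup>+p. h (Complex (fst p) (snd p)) \<partial>lborel)" by (rule nn_integral_complex_pair[OF h])
    finally have e: "(\<integral>\<^sup>+z. ennreal ((cmod (\<phi> z))\<^sup>2) * indicator {z. Im z > 0 \<and> cmod z > R} z \<partial>hyp_measure) = (\<integral>\<^sup>+p. h (Complex (fst p) (snd p)) \<partial>lborel)" .
    show ?thesis unfolding e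
    proof (rule nn_integral_mono)
      fix p :: "real \<times> real"
      show "ennreal (q p) \<le> h (Complex (fst p) (snd p))"
      proof (cases "snd p > 0 \<and> (fst p)\<^sup>2 + (snd p)\<^sup>2 > R\<^sup>2")
        case False then show ?thesis by (simp add: q_def)
      next
        case True
        then have "R\<^sup>2 < (cmod (Complex (fst p) (snd p)))\<^sup>2" by (simp add: cmod_power2)
        then have "R < cmod (Complex (fst p) (snd p))" by (rule power2_less_imp_less) simp
        then have "h (Complex (fst p) (snd p)) = ennreal (1 / (snd p)\<^sup>2 * (cmod (\<phi> (Complex (fst p) (snd p))))\<^sup>2)"
          using True by (simp add: h_def H ennreal_mult[symmetric])
        moreover have "q p \<le> 1 / (snd p)\<^sup>2 * (cmod (\<phi> (Complex (fst p) (snd p))))\<^sup>2"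
        proof -
          have "\<bar>L (\<phi> (Complex (fst p) (snd p)))\<bar>\<^sup>2 \<le> (cmod (\<phi> (Complex (fst p) (snd p))))\<^sup>2" using L(2) by (intro power_mono) auto
          then show ?thesis using True by (simp add: q_def divide_right_mono)
        qed
        ultimately show ?thesis by (simp add: ennreal_leI)
      qed
    qed
  qed
  then have "(\<integral>\<^sup>+p. ennreal (q p) \<partial>lborel) < \<infinity>" using fin by (rule le_less_trans)
  then have "integrable lborel q" using q_meas by (intro integrableI_nonneg) (auto simp: q_def)
  then show ?thesis
    using eigenfunction_decay[OF s R C2 eig'] by (simp add: q_def)
qed

theorem theorem1p9:
  fixes \<Gamma> :: "mat2 set" and \<phi> :: "complex \<Rightarrow> complex" and s :: real
  assumes "is_subgroup_SL2 \<Gamma>" and "finitely_generated \<Gamma>" and "discrete_set \<Gamma>"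
    and "critical_exponent \<Gamma> > 1/2"
    and "infinite_covolume \<Gamma>"
    and "closed {mmul g n | g n. g \<in> \<Gamma> \<and> n \<in> Nsub}"
    and "\<Gamma> \<inter> Nsub = {mid}"
    and "invariant \<Gamma> \<phi>" and "L2_quot \<Gamma> \<phi>"
    and "s > 1/2" and "s * (1 - s) < 1/4"
    and "laplace_eigenfunction \<phi> (s * (1 - s))"
  shows "\<exists>x0 y0 C. x0 > 0 \<and> 0 < y0 \<and> y0 < 1 \<and>
           (\<forall>x y. \<bar>x\<bar> > x0 \<longrightarrow> 0 < y \<longrightarrow> y < y0 \<longrightarrow>
              cmod (\<phi> (Complex x y)) \<le> C * (y / (x^2 + y^2)) powr s)"
proof -
  interpret horocycle_closed \<Gamma> by unfold_locales (fact assms)+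
  obtain e where e: "e > 0" "\<And>g. g \<in> \<Gamma> \<Longrightarrow> e \<le> norm (row2 g)"
    using rows_bounded_below[OF assms(4)] by blast
  obtain R0 where R0: "\<And>g. g \<in> \<Gamma> \<Longrightarrow> cmod (mob g \<i>) \<le> R0"
    using orbit_bounded[OF assms(2) e] by blast
  obtain R where R: "R > 0" "finite {g \<in> \<Gamma>. \<exists>z. Im z > 0 \<and> cmod z > R \<and> cmod (mob g z) > R}"
    using finite_overlap[OF R0] by blast
  note fin = integral_far_finite[OF R(2) assms(8,9)]
  have meas: "\<phi> \<in> borel_measurable borel" using assms(9) by (simp add: L2_quot_def)
  obtain C1 K1 where 1: "\<And>x y. y > 0 \<Longrightarrow> x\<^sup>2 + y\<^sup>2 \<ge> K1 \<Longrightarrow> \<bar>Re (\<phi> (Complex x y))\<bar> \<le> C1 * height x y powr s"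
    using real_component_decay[OF bounded_linear_Re abs_Re_le_cmod assms(10) R(1) assms(12) meas fin] by blast
  obtain C2 K2 where 2: "\<And>x y. y > 0 \<Longrightarrow> x\<^sup>2 + y\<^sup>2 \<ge> K2 \<Longrightarrow> \<bar>Im (\<phi> (Complex x y))\<bar> \<le> C2 * height x y powr s"
    using real_component_decay[OF bounded_linear_Im abs_Im_le_cmod assms(10) R(1) assms(12) meas fin] by blast
  \<comment> \<open>At least 1, so that \<open>|x| > X\<close> implies \<open>x^2 \<ge> X\<close>,
    which exceeds both thresholds.\<close>
  define X where "X = \<bar>K1\<bar> + \<bar>K2\<bar> + 1"
  have "cmod (\<phi> (Complex x y)) \<le> (C1 + C2) * (y / (x^2 + y^2)) powr s" if x: "\<bar>x\<bar> > X" and y: "0 < y" for x y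
  proof -
    have "X * 1 \<le> \<bar>x\<bar> * \<bar>x\<bar>" using x by (intro mult_mono) (auto simp: X_def)
    then have "X \<le> x\<^sup>2 + y\<^sup>2" by (simp add: power2_eq_square add_increasing2)
    then have "K1 \<le> x\<^sup>2 + y\<^sup>2" "K2 \<le> x\<^sup>2 + y\<^sup>2" by (auto simp: X_def)
    then have "\<bar>Re (\<phi> (Complex x y))\<bar> + \<bar>Im (\<phi> (Complex x y))\<bar> \<le> C1 * height x y powr s + C2 * height x y powr s"
      using 1 2 y by (intro add_mono) auto
    then show ?thesis
      using cmod_le[of "\<phi> (Complex x y)"] unfolding height_def distrib_right by linarith
  qed
  then show ?thesis by (intro exI[of _ X] exI[of _ "1/2"] exI[of _ "C1 + C2"]) (auto simp: X_def)
qed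

end
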